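(* Fix $c\in(0,1)$. Then: (1) $\displaystyle\lim_{n\to\infty}\frac{R_{c,n}}{p_{\frac{n}{1-c}}}=1$. More precisely, there exists a constant $\beta_{1,c}>0$ such that $\left|R_{c,n}-p_{\frac{n}{1-c}}\right|\le \beta_{1,c}\, n\log\log n$ for all sufficiently large $n$. (2) There exists a constant $\beta_{5,c}$ such that for all sufficiently large $N$, $$\left|\frac{\pi_c(N)}{\pi(N)}-(1-c)\right|\le \frac{\beta_{5,c}\log\log N}{\log N}.$$ In particular, the proportion of primes that are $c$-Ramanujan primes tends to $1-c$.
   Context: For $x>0$, $\pi(x)$ denotes the number of primes at most $x$. For a fixed $c\in(0,1)$ and an integer $n\ge 1$, the $n$th $c$-Ramanujan prime $R_{c,n}$ is the smallest positive integer such that for every real $x\ge R_{c,n}$ the interval $(cx,x]$ contains at least $n$ primes, i.e. $\pi(x)-\pi(cx)\ge n$. For real $m\ge1$, $p_m$ denotes the $\lfloor m\rfloor$th prime. $\pi_c(x)$ denotes the number of $c$-Ramanujan primes (i.e. numbers of the form $R_{c,n}$, $n\ge1$) that are at most $x$. *)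

theory Defs
  imports Complex_Main "HOL-Library.Infinite_Set" "HOL-Computational_Algebra.Primes"
begin

definition prime_pi :: "real \<Rightarrow> nat" where
  "prime_pi x = card {p::nat. prime p \<and> real p \<le> x}"

(* enumerate counts from 0, whereas the first prime is p_1 = 2.
   Only meaningful for m \<ge> 1. *)
definition nth_prime :: "real \<Rightarrow> nat" where
  "nth_prime m = enumerate {p::nat. prime p} (nat \<lfloor>m\<rfloor> - 1)"

(* The difference is taken in int to avoid truncated subtraction. *)
definition ramanujan_prime :: "real \<Rightarrow> nat \<Rightarrow> nat" where
  "ramanujan_prime c n =
     (LEAST R::nat. R > 0 \<and>
        (\<forall>x::real. x \<ge> real R \<longrightarrow> int (prime_pi x) - int (prime_pi (c * x)) \<ge> int n))"

definition ramanujan_primes :: "real \<Rightarrow> nat set" where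
  "ramanujan_primes c = {ramanujan_prime c n |n. n \<ge> 1}"

definition ramanujan_pi :: "real \<Rightarrow> real \<Rightarrow> nat" where
  "ramanujan_pi c x = card {r \<in> ramanujan_primes c. real r \<le> x}"

end

theory Submission
  imports Defs "HOL-Complex_Analysis.Complex_Analysis" "HOL-Number_Theory.Prime_Powers" "HOL-Real_Asymp.Real_Asymp"
begin

text \<open>
  Everything reduces to the estimate \<open>\<pi>(x) = x / ln x + O(x ln ln x / (ln x)\<^sup>2)\<close>: it gives
  \<open>\<pi>(x) - \<pi>(c x) = (1 - c) x / ln x\<close> with the same relative error, so that both \<open>R\<^sub>n\<close> and the
  prime with index \<open>n / (1 - c)\<close> approximately solve \<open>y / ln y = n / (1 - c)\<close>, and the number of
  \<open>n\<close> with \<open>R\<^sub>n \<le> N\<close> is the minimum of \<open>\<pi>(x) - \<pi>(c x)\<close> over \<open>x \<ge> N\<close>.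

  For the estimate of \<open>\<pi>\<close> no zero-free region of the usual shape is needed. On \<open>Re s > 1\<close> the series
  \<open>\<Sum>n. (\<Lambda>(n) - 1) n powr (-s)\<close> equals \<open>-\<zeta>'(s)/\<zeta>(s) - \<zeta>(s)\<close>, which is regular at
  \<open>s = 1\<close>, and by the 3-4-1 inequality it and its first two derivatives grow at most like
  \<open>\<bar>Im s\<bar> powr (1/2)\<close>, uniformly up to the line \<open>Re s = 1\<close>. Integrating by parts twice in Perron's formula
  for \<open>\<Sum>n\<le>x. (\<Lambda>(n) - 1) (x - n)\<close> yields the bound \<open>O(x\<^sup>2 / (ln x)\<^sup>2)\<close>; comparing the points
  \<open>x\<close> and \<open>x \<plusminus> x / ln x\<close> turns it into \<open>\<psi>(x) = x + O(x / ln x)\<close>.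
\<close>

section \<open>Dirichlet series\<close>

text \<open>The required precision dictates the choices. A relative error
  \<open>ln ln x / ln x\<close> for \<open>\<pi>\<close> already follows from an error
  \<open>O(x / ln x)\<close> for \<open>\<psi>\<close>; the factor \<open>ln ln x\<close> enters
  afterwards, when weighted sums over primes are compared with counts by a cut at
  \<open>x / (ln x)^2\<close>. Recovering \<open>\<psi>\<close> from its integral with step
  \<open>x / ln x\<close> gives back one of the two logarithms won by integrating by parts, hence
  two derivatives. The obstacle is uniformity up to the line \<open>Re s = 1\<close>. The kernel
  \<open>1 / (s * (s + 1))\<close> decays like the inverse square of the height, so any growth
  exponent below 1 is affordable; 1/2 is what the small losses of the single stages add up to.
  Derivatives are bounded by Cauchy's estimate on discs that may cross the line, so zeta has to be
  continued a little to the left, with a small growth exponent, and has to be nonzero on these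
  discs. Subtracting 1 from the von Mangoldt function removes the pole beforehand: no residue at 1
  has to be collected, and for fixed \<open>x\<close> the abscissa can simply tend to 1.\<close>

text \<open>The term with index 0 vanishes, since \<open>0 powr s = 0\<close>.\<close>

definition dirichlet_series :: "(nat \<Rightarrow> complex) \<Rightarrow> complex \<Rightarrow> complex" where
  "dirichlet_series a s = (\<Sum>n. a n * of_nat n powr (-s))"

text \<open>Absolute convergence is demanded at every abscissa beyond 1, not at a single one: this
  makes the notion stable under multiplication by \<open>ln n\<close>, that is, under
  differentiation of the series.\<close>

definition dirichlet_summable :: "(nat \<Rightarrow> complex) \<Rightarrow> bool" where
  "dirichlet_summable a \<longleftrightarrow> (\<forall>\<sigma>>1. summable (\<lambda>n. norm (a n) * real n powr (-\<sigma>)))"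

lemma norm_nat_powr: "norm (of_nat n powr s :: complex) = real n powr (Re s)"
  by (cases "n = 0") (simp_all add: norm_powr_real powr_def)

lemma summable_nat_powr: "\<sigma> > 1 \<Longrightarrow> summable (\<lambda>n. real n powr (-\<sigma>))"
  by (subst summable_real_powr_iff) auto

lemma dirichlet_summableD:
  "dirichlet_summable a \<Longrightarrow> \<sigma> > 1 \<Longrightarrow> summable (\<lambda>n. norm (a n) * real n powr (-\<sigma>))"
  unfolding dirichlet_summable_def by blast

lemma dirichlet_summable_norm:
  assumes "dirichlet_summable a" "Re s > 1"
  shows "summable (\<lambda>n. norm (a n * of_nat n powr (-s)))"
proof -
  have "norm (a n * of_nat n powr (-s)) = norm (a n) * real n powr (-Re s)" for n
    unfolding norm_mult norm_nat_powr by simp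
  with dirichlet_summableD[OF assms] show ?thesis by presburger
qed

lemma dirichlet_series_sums:
  assumes "dirichlet_summable a" "Re s > 1"
  shows "(\<lambda>n. a n * of_nat n powr (-s)) sums dirichlet_series a s"
  unfolding dirichlet_series_def
  by (rule summable_sums[OF summable_norm_cancel[OF dirichlet_summable_norm[OF assms]]])

lemma dirichlet_summable_comparison:
  assumes "dirichlet_summable b" "\<And>n. n > 0 \<Longrightarrow> norm (a n) \<le> norm (b n)"
  shows "dirichlet_summable a"
  unfolding dirichlet_summable_def
proof (intro allI impI)
  fix \<sigma> :: real assume "\<sigma> > 1"
  hence *: "summable (\<lambda>n. norm (b n) * real n powr (-\<sigma>))"
    by (rule dirichlet_summableD[OF assms(1)])
  show "summable (\<lambda>n. norm (a n) * real n powr (-\<sigma>))"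
  proof (rule summable_comparison_test'[OF *, of 0])
    fix n :: nat
    show "norm (norm (a n) * real n powr - \<sigma>) \<le> norm (b n) * real n powr - \<sigma>"
      using assms(2)[of n] by (cases "n = 0") (auto intro!: mult_right_mono)
  qed
qed

text \<open>Half of the distance from the abscissa to 1 is spent on the logarithm, by
  \<open>ln n \<le> n powr e / e\<close>; the other half keeps the series convergent.\<close>

lemma dirichlet_summable_mult_ln:
  assumes "dirichlet_summable a"
  shows "dirichlet_summable (\<lambda>n. a n * of_real (ln (real n)))"
  unfolding dirichlet_summable_def
proof (intro allI impI)
  fix \<sigma> :: real assume s: "\<sigma> > 1"
  define e where "e = (\<sigma> - 1) / 2"
  have e: "e > 0" using s by (simp add: e_def)
  have "summable (\<lambda>n. norm (a n) * real n powr (-(1 + e)))"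
    by (rule dirichlet_summableD[OF assms]) (use e in auto)
  hence *: "summable (\<lambda>n. (1 / e) * (norm (a n) * real n powr (-(1 + e))))"
    by (rule summable_mult)
  show "summable (\<lambda>n. norm (a n * complex_of_real (ln (real n))) * real n powr - \<sigma>)"
  proof (rule summable_comparison_test'[OF *, of 1])
    fix n :: nat assume n: "n \<ge> 1"
    have "ln (real n) \<le> real n powr e / e"
      using ln_powr_bound[of "real n" e] n e by simp
    hence "norm (a n) * ln (real n) * real n powr - \<sigma> \<le> norm (a n) * (real n powr e / e) * real n powr - \<sigma>"
      by (intro mult_right_mono mult_left_mono) auto
    also have "\<dots> = (1 / e) * (norm (a n) * (real n powr e * real n powr - \<sigma>))"
      by simp
    also have "real n powr e * real n powr - \<sigma> = real n powr (-(1 + e))"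
    proof -
      have "e - \<sigma> = -(1 + e)" by (simp add: e_def field_simps)
      thus ?thesis by (simp only: powr_add [symmetric] diff_conv_add_uminus)
    qed
    finally show "norm (norm (a n * complex_of_real (ln (real n))) * real n powr - \<sigma>)
      \<le> (1 / e) * (norm (a n) * real n powr (-(1 + e)))"
      using n by (simp add: norm_mult)
  qed
qed

text \<open>Convergence is locally uniform: on the disc about \<open>x\<close> whose radius
  \<open>d\<close> is half the distance to the line, every term with \<open>n > 0\<close> is at most
  its modulus at the abscissa \<open>1 + d\<close>.\<close>

lemma dirichlet_series_deriv:
  assumes a: "dirichlet_summable a" and s: "Re s > 1"
  shows "(dirichlet_series a has_field_derivative
           - dirichlet_series (\<lambda>n. a n * of_real (ln (real n))) s) (at s)"
proof -
  define f where "f = (\<lambda>n s. a n * of_nat n powr (-s))"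
  define f' where "f' = (\<lambda>n s. - (a n * of_real (ln (real n))) * of_nat n powr (-s))"
  have "\<exists>g g'. \<forall>x \<in> {s. Re s > 1}. ((\<lambda>n. f n x) sums g x) \<and> ((\<lambda>n. f' n x) sums g' x) \<and>
          (g has_field_derivative g' x) (at x)"
  proof (rule series_and_derivative_comparison_local)
    show "open {s::complex. Re s > 1}" by (rule open_halfspace_Re_gt)
    show "(f n has_field_derivative f' n x) (at x)" for n x
    proof (cases "n = 0")
      case False
      have "((\<lambda>x. (of_nat n :: complex) powr (-x)) has_field_derivative
              (Ln (of_nat n) * of_nat n powr (-x)) * (-1)) (at x)"
        by (rule DERIV_chain2[OF has_field_derivative_powr_right])
           (use False in \<open>auto intro!: derivative_eq_intros\<close>)
      from DERIV_cmult[OF this, of "a n"] False show ?thesis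
        by (simp add: f_def f'_def Ln_of_nat mult_ac)
    qed (simp add: f_def f'_def)
    fix x :: complex assume "x \<in> {s. Re s > 1}"
    hence x: "Re x > 1" by simp
    define d where "d = (Re x - 1) / 2"
    have d: "d > 0" using x by (simp add: d_def)
    have *: "summable (\<lambda>n. norm (a n) * real n powr (-(1 + d)))"
      by (rule dirichlet_summableD[OF a]) (use d in auto)
    show "\<exists>d h. 0 < d \<and> summable h \<and> (\<forall>\<^sub>F n in sequentially. \<forall>y\<in>ball x d \<inter> {s. Re s > 1}. norm (f n y) \<le> h n)"
    proof (rule exI[of _ d], rule exI[of _ "\<lambda>n. norm (a n) * real n powr (-(1 + d))"], intro conjI d *)
      show "\<forall>\<^sub>F n in sequentially. \<forall>y\<in>ball x d \<inter> {s. Re s > 1}. norm (f n y) \<le> norm (a n) * real n powr (-(1 + d))"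
        using eventually_ge_at_top[of "1::nat"]
      proof eventually_elim
        case (elim n)
        show ?case
        proof
          fix y assume "y \<in> ball x d \<inter> {s. Re s > 1}"
          hence "\<bar>Re (x - y)\<bar> < d"
            using abs_Re_le_cmod[of "x - y"] by (auto simp: dist_norm)
          hence "Re y > Re x - d" by (simp add: abs_less_iff)
          hence "Re y \<ge> 1 + d" unfolding d_def by argo
          thus "norm (f n y) \<le> norm (a n) * real n powr (-(1 + d))"
            using elim by (auto simp: f_def norm_mult norm_nat_powr intro!: mult_left_mono powr_mono)
        qed
      qed
    qed
  qed
  then obtain g g' where g: "\<And>x. Re x > 1 \<Longrightarrow> (\<lambda>n. f n x) sums g x"
      "\<And>x. Re x > 1 \<Longrightarrow> (\<lambda>n. f' n x) sums g' x"
      "\<And>x. Re x > 1 \<Longrightarrow> (g has_field_derivative g' x) (at x)"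
    by auto
  have eq: "g x = dirichlet_series a x" if "Re x > 1" for x
    using g(1)[OF that] by (simp add: dirichlet_series_def f_def sums_iff)
  have "(\<lambda>n. - f' n s) sums (- g' s)" using g(2)[OF s] by (rule sums_minus)
  hence "- g' s = dirichlet_series (\<lambda>n. a n * of_real (ln (real n))) s"
    by (simp add: dirichlet_series_def f'_def sums_iff)
  hence "g' s = - dirichlet_series (\<lambda>n. a n * of_real (ln (real n))) s"
    by (metis minus_minus)
  with g(3)[OF s] have "(g has_field_derivative - dirichlet_series (\<lambda>n. a n * of_real (ln (real n))) s) (at s)"
    by simp
  thus ?thesis
    by (rule has_field_derivative_transform_within_open[of _ _ _ "{s. Re s > 1}"])
       (use s eq in \<open>auto simp: open_halfspace_Re_gt\<close>)
qed

lemma dirichlet_summable_one: "dirichlet_summable (\<lambda>_. 1)"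
  by (simp add: dirichlet_summable_def summable_nat_powr)

lemma dirichlet_summable_ln: "dirichlet_summable (\<lambda>n. of_real (ln (real n)))"
  using dirichlet_summable_mult_ln[OF dirichlet_summable_one] by simp

lemma dirichlet_summable_mangoldt: "dirichlet_summable mangoldt"
  by (rule dirichlet_summable_comparison[OF dirichlet_summable_ln]) (auto simp: mangoldt_le)

lemma dirichlet_summable_diff:
  assumes "dirichlet_summable a" "dirichlet_summable b"
  shows "dirichlet_summable (\<lambda>n. a n - b n)"
  unfolding dirichlet_summable_def
proof (intro allI impI)
  fix \<sigma> :: real assume "\<sigma> > 1"
  hence *: "summable (\<lambda>n. norm (a n) * real n powr (-\<sigma>) + norm (b n) * real n powr (-\<sigma>))"
    using assms by (intro summable_add dirichlet_summableD)
  show "summable (\<lambda>n. norm (a n - b n) * real n powr (-\<sigma>))"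
  proof (rule summable_comparison_test'[OF *, of 0])
    fix n :: nat
    have "norm (a n - b n) * real n powr (-\<sigma>) \<le> (norm (a n) + norm (b n)) * real n powr (-\<sigma>)"
      by (intro mult_right_mono norm_triangle_ineq4) auto
    thus "norm (norm (a n - b n) * real n powr (-\<sigma>)) \<le>
            norm (a n) * real n powr (-\<sigma>) + norm (b n) * real n powr (-\<sigma>)"
      by (simp add: distrib_right)
  qed
qed

lemma dirichlet_series_diff:
  assumes "dirichlet_summable a" "dirichlet_summable b" "Re s > 1"
  shows "dirichlet_series (\<lambda>n. a n - b n) s = dirichlet_series a s - dirichlet_series b s"
proof -
  have "(\<lambda>n. (a n - b n) * of_nat n powr (-s)) sums (dirichlet_series a s - dirichlet_series b s)"
    unfolding left_diff_distrib
    by (intro sums_diff dirichlet_series_sums assms)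
  thus ?thesis unfolding dirichlet_series_def[of "\<lambda>n. a n - b n"] by (rule sums_unique [symmetric])
qed

text \<open>The double series over pairs \<open>(d, m)\<close> converges absolutely and may be
  regrouped by the product \<open>n = d * m\<close>. It is applied to the von Mangoldt function,
  whose divisor sums are \<open>ln n\<close>.\<close>

lemma dirichlet_series_divisor_sum:
  assumes a: "dirichlet_summable a" and s: "Re s > 1"
  assumes c: "\<And>n. n > 0 \<Longrightarrow> c n = (\<Sum>d | d dvd n. a d)"
  shows "dirichlet_series a s * dirichlet_series (\<lambda>_. 1) s = dirichlet_series c s"
proof -
  define u where "u = (\<lambda>n. of_nat n powr (-s) :: complex)"
  define A B where "A = dirichlet_series a s" and "B = dirichlet_series (\<lambda>_. 1) s"
  let ?N = "{0<..} :: nat set"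
  have u0: "u 0 = 0" by (simp add: u_def)
  have u_mult: "u (m * n) = u m * u n" for m n
    unfolding u_def of_nat_mult by (rule powr_times_real_left) auto
  have sumA_norm: "summable (\<lambda>n. norm (a n * u n))"
    using dirichlet_summable_norm[OF a s] unfolding u_def .
  have sumB_norm: "summable (\<lambda>n. norm (u n))"
    using dirichlet_summable_norm[OF dirichlet_summable_one s] unfolding u_def by simp
  have hasA: "((\<lambda>n. a n * u n) has_sum A) UNIV"
    by (rule norm_summable_imp_has_sum[OF sumA_norm])
       (use dirichlet_series_sums[OF a s] in \<open>simp add: u_def A_def\<close>)
  have hasB: "(u has_sum B) UNIV"
    by (rule norm_summable_imp_has_sum[OF sumB_norm])
       (use dirichlet_series_sums[OF dirichlet_summable_one s] in \<open>simp add: u_def B_def\<close>)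
  have hasA': "((\<lambda>n. a n * u n) has_sum A) ?N"
    using hasA by (subst has_sum_cong_neutral[where T = UNIV and g = "\<lambda>n. a n * u n"]) (auto simp: u0)
  have hasB': "(u has_sum B) ?N"
    using hasB by (subst has_sum_cong_neutral[where T = UNIV and g = u]) (auto simp: u0)
  have nB: "(\<lambda>n. norm (u n)) summable_on ?N"
    by (rule summable_on_subset_banach[of _ UNIV])
       (use sumB_norm in \<open>auto intro!: norm_summable_imp_summable_on\<close>)
  have nA: "(\<lambda>n. norm (a n * u n)) summable_on ?N"
    by (rule summable_on_subset_banach[of _ UNIV])
       (use sumA_norm in \<open>auto intro!: norm_summable_imp_summable_on\<close>)
  have "(\<lambda>p. norm (case p of (d, m) \<Rightarrow> a d * u d * u m)) summable_on (?N \<times> ?N)"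
  proof (rule summable_on_SigmaI)
    show "((\<lambda>y. norm (case (x, y) of (d, m) \<Rightarrow> a d * u d * u m)) has_sum
            (norm (a x * u x) * (\<Sum>\<^sub>\<infinity>y\<in>?N. norm (u y)))) ?N" for x
      using has_sum_cmult_right[OF has_sum_infsum[OF nB], of "norm (a x * u x)"]
      by (simp add: norm_mult)
    show "(\<lambda>x. norm (a x * u x) * (\<Sum>\<^sub>\<infinity>y\<in>?N. norm (u y))) summable_on ?N"
      by (rule summable_on_cmult_left[OF nA])
  qed auto
  hence abs1: "(\<lambda>(d, m). a d * u d * u m) summable_on (?N \<times> ?N)"
    by (rule abs_summable_summable)
  have "((\<lambda>(d, m). a d * u d * u m) has_sum (A * B)) (?N \<times> ?N)"
  proof (rule has_sum_SigmaI[OF _ _ abs1])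
    show "((\<lambda>y. case (x, y) of (d, m) \<Rightarrow> a d * u d * u m) has_sum (a x * u x * B)) ?N" for x
      using has_sum_cmult_right[OF hasB', of "a x * u x"] by simp
    show "((\<lambda>x. a x * u x * B) has_sum A * B) ?N"
      by (rule has_sum_cmult_left[OF hasA'])
  qed
  also have "?this \<longleftrightarrow> ((\<lambda>(n, d). a d * u n) has_sum (A * B)) (SIGMA n:?N. {d. d dvd n})"
  proof (rule has_sum_reindex_bij_witness[of _ "\<lambda>(n, d). (d, n div d)" "\<lambda>(d, m). (d * m, d)"])
    fix b assume "b \<in> (SIGMA n:?N. {d. d dvd n})"
    then obtain n d where b: "b = (n, d)" "n > 0" "d dvd n" by auto
    show "(case case b of (n, d) \<Rightarrow> (d, n div d) of (d, m) \<Rightarrow> (d * m, d)) = b"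
      using b by simp
    have "d > 0" "n div d > 0" using b by (auto intro: Nat.gr0I simp: dvd_div_eq_0_iff)
    thus "(case b of (n, d) \<Rightarrow> (d, n div d)) \<in> ?N \<times> ?N" using b by simp
  qed (auto simp: u_mult mult_ac)
  finally have *: "((\<lambda>(n, d). a d * u n) has_sum (A * B)) (SIGMA n:?N. {d. d dvd n})" .
  have "((\<lambda>n. c n * u n) has_sum (A * B)) ?N"
  proof (rule has_sum_SigmaD[OF *])
    fix n :: nat assume n: "n \<in> ?N"
    have "((\<lambda>d. a d * u n) has_sum (\<Sum>d | d dvd n. a d * u n)) {d. d dvd n}"
      by (rule has_sum_finite) (use n in auto)
    thus "((\<lambda>y. case (n, y) of (n, d) \<Rightarrow> a d * u n) has_sum c n * u n) {d. d dvd n}"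
      using n by (simp add: c sum_distrib_right)
  qed
  hence "((\<lambda>n. c n * u n) has_sum (A * B)) UNIV"
    by (subst has_sum_cong_neutral[where T = ?N and g = "\<lambda>n. c n * u n"]) (auto simp: u0)
  hence "(\<lambda>n. c n * u n) sums (A * B)" by (rule has_sum_imp_sums)
  thus ?thesis
    unfolding A_def B_def dirichlet_series_def[of c] u_def by (simp add: sums_iff)
qed

section \<open>The zeta function to the right of 1\<close>

abbreviation zeta_series :: "complex \<Rightarrow> complex" where
  "zeta_series \<equiv> dirichlet_series (\<lambda>_. 1)"

text \<open>At \<open>n = 0\<close> and \<open>n = 1\<close> the quotient is \<open>0 / 0 = 0\<close>.\<close>

definition log_zeta :: "complex \<Rightarrow> complex" where
  "log_zeta = dirichlet_series (\<lambda>n. mangoldt n / of_real (ln (real n)))"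

lemma dirichlet_summable_log_zeta: "dirichlet_summable (\<lambda>n. mangoldt n / of_real (ln (real n)))"
proof (rule dirichlet_summable_comparison[OF dirichlet_summable_one])
  fix n :: nat assume n: "n > 0"
  show "norm (mangoldt n / of_real (ln (real n)) :: complex) \<le> norm (1 :: complex)"
  proof (cases "n = 1")
    case False
    with n have "ln (real n) > 0" by simp
    thus ?thesis using mangoldt_le[of n] n by (simp add: norm_divide)
  qed auto
qed

lemma log_zeta_deriv:
  assumes "Re s > 1"
  shows "(log_zeta has_field_derivative - dirichlet_series mangoldt s) (at s)"
proof -
  have "mangoldt n / of_real (ln (real n)) * of_real (ln (real n)) = (mangoldt n :: complex)" for n
  proof (cases "n \<le> 1")
    case True
    hence "n = 0 \<or> n = 1" by auto
    thus ?thesis by auto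
  next
    case False
    hence "ln (real n) > 0" by simp
    thus ?thesis by simp
  qed
  hence "(\<lambda>n. mangoldt n / of_real (ln (real n)) * of_real (ln (real n))) = (mangoldt :: nat \<Rightarrow> complex)"
    by (rule ext)
  thus ?thesis
    using dirichlet_series_deriv[OF dirichlet_summable_log_zeta assms] by (simp add: log_zeta_def)
qed

lemma zeta_series_deriv:
  assumes "Re s > 1"
  shows "(zeta_series has_field_derivative - (dirichlet_series mangoldt s * zeta_series s)) (at s)"
proof -
  have "dirichlet_series mangoldt s * zeta_series s = dirichlet_series (\<lambda>n. of_real (ln (real n))) s"
    by (rule dirichlet_series_divisor_sum[OF dirichlet_summable_mangoldt assms])
       (simp add: mangoldt_sum)
  thus ?thesis
    using dirichlet_series_deriv[OF dirichlet_summable_one assms] by simp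
qed

lemma Re_powr_nat:
  assumes "n > 0"
  shows "Re (of_nat n powr (-Complex \<sigma> t)) = real n powr (-\<sigma>) * cos (t * ln (real n))"
proof -
  have "of_nat n powr (-Complex \<sigma> t) = exp (-Complex \<sigma> t * of_real (ln (real n)))"
    using assms by (simp add: powr_def Ln_of_nat)
  thus ?thesis using assms by (simp add: Re_exp powr_def)
qed

text \<open>The term with \<open>n = 1\<close> contributes 1 and all others are nonnegative. A
  single such value excludes the constant 0 in the exponential form of zeta.\<close>

lemma zeta_series_ge_1: "\<sigma> > 1 \<Longrightarrow> Re (zeta_series (of_real \<sigma>)) \<ge> 1"
proof -
  assume s: "\<sigma> > 1"
  define f where "f = (\<lambda>n. Re (1 * of_nat n powr (-complex_of_real \<sigma>)))"
  have f: "f n = real n powr (-\<sigma>)" for n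
  proof (cases "n = 0")
    case False
    thus ?thesis using Re_powr_nat[of n \<sigma> 0] by (simp add: f_def complex_of_real_def)
  qed (simp add: f_def)
  have *: "f sums Re (zeta_series (of_real \<sigma>))"
    unfolding f_def by (intro sums_Re dirichlet_series_sums dirichlet_summable_one) (use s in auto)
  have "sum f {1} \<le> suminf f"
    by (rule sum_le_suminf) (use * in \<open>auto simp: sums_iff f\<close>)
  thus ?thesis using * by (simp add: sums_iff f)
qed

text \<open>The identity \<open>\<Sum>d dvd n. \<Lambda>(d) = ln n\<close> makes \<open>\<zeta>\<close> a solution of \<open>\<zeta>' = L' \<zeta>\<close> with
  \<open>L = log_zeta\<close>; this replaces the Euler product.\<close>

lemma zeta_series_exp:
  "\<exists>C. C \<noteq> 0 \<and> (\<forall>s. Re s > 1 \<longrightarrow> zeta_series s = C * exp (log_zeta s))"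
proof -
  define h where "h = (\<lambda>s. zeta_series s * exp (- log_zeta s))"
  have "\<exists>c. \<forall>x\<in>{s. Re s > 1}. h x = c"
  proof (rule has_field_derivative_zero_constant)
    show "convex {s::complex. Re s > 1}" by (rule convex_halfspace_Re_gt)
    fix x :: complex assume "x \<in> {s. Re s > 1}"
    hence x: "Re x > 1" by simp
    have "(h has_field_derivative 0) (at x)"
      unfolding h_def
      by (rule derivative_eq_intros zeta_series_deriv[OF x] log_zeta_deriv[OF x] refl)+
         (simp add: algebra_simps)
    thus "(h has_field_derivative 0) (at x within {s. Re s > 1})"
      by (rule has_field_derivative_at_within)
  qed
  then obtain c where c: "\<And>s. Re s > 1 \<Longrightarrow> h s = c" by auto
  have eq: "zeta_series s = c * exp (log_zeta s)" if "Re s > 1" for s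
    using c[OF that] by (simp add: h_def exp_minus field_simps)
  have "c \<noteq> 0"
    using eq[of 2] zeta_series_ge_1[of 2] by auto
  with eq show ?thesis by blast
qed

lemma zeta_series_nonzero: "Re s > 1 \<Longrightarrow> zeta_series s \<noteq> 0"
  using zeta_series_exp by fastforce

text \<open>In the exponential form the product becomes \<open>norm C ^ 8\<close>, with 8 = 3 + 4 +
  1, times the exponential of a series whose terms carry the factor
  \<open>3 + 4 * cos x + cos (2 * x) = 2 * (1 + cos x) ^ 2\<close>, which is nonnegative.\<close>

lemma zeta_series_341:
  "\<exists>c>0. \<forall>\<sigma>>1. \<forall>t. norm (zeta_series (of_real \<sigma>)) ^ 3 * norm (zeta_series (Complex \<sigma> t)) ^ 4
      * norm (zeta_series (Complex \<sigma> (2 * t))) \<ge> c"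
proof -
  obtain C where C: "C \<noteq> 0" and eq: "\<And>s. Re s > 1 \<Longrightarrow> zeta_series s = C * exp (log_zeta s)"
    using zeta_series_exp by blast
  have "norm (zeta_series (of_real \<sigma>)) ^ 3 * norm (zeta_series (Complex \<sigma> t)) ^ 4
      * norm (zeta_series (Complex \<sigma> (2 * t))) \<ge> norm C ^ 8" if s: "\<sigma> > 1" for \<sigma> t
  proof -
    define a where "a = (\<lambda>n. mangoldt n / ln (real n) :: real)"
    have a: "a n \<ge> 0" for n
      unfolding a_def by (cases "n = 0") (auto intro!: divide_nonneg_nonneg mangoldt_nonneg)
    define f where "f = (\<lambda>t n. a n * (real n powr (-\<sigma>) * cos (t * ln (real n))))"
    have f: "f t sums Re (log_zeta (Complex \<sigma> t))" for t
    proof -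
      have "(\<lambda>n. Re (mangoldt n / of_real (ln (real n)) * of_nat n powr (-Complex \<sigma> t)))
              sums Re (log_zeta (Complex \<sigma> t))"
        unfolding log_zeta_def
        by (intro sums_Re dirichlet_series_sums dirichlet_summable_log_zeta) (use s in auto)
      also have "(\<lambda>n. Re (mangoldt n / of_real (ln (real n)) * of_nat n powr (-Complex \<sigma> t))) = f t"
      proof
        fix n
        have "mangoldt n / of_real (ln (real n)) = complex_of_real (a n)"
          by (simp add: a_def)
        moreover have "a 0 = 0" by (simp add: a_def)
        ultimately show "Re (mangoldt n / of_real (ln (real n)) * of_nat n powr (-Complex \<sigma> t)) = f t n"
          using Re_powr_nat[of n \<sigma> t] by (cases "n = 0") (simp_all add: f_def)
      qed
      finally show ?thesis .
    qed
    have s1: "(\<lambda>n. 3 * f 0 n + 4 * f t n + f (2 * t) n) sums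
            (3 * Re (log_zeta (Complex \<sigma> 0)) + 4 * Re (log_zeta (Complex \<sigma> t)) + Re (log_zeta (Complex \<sigma> (2*t))))"
      by (intro sums_add sums_mult f)
    have s2: "0 \<le> 3 * f 0 n + 4 * f t n + f (2 * t) n" for n
    proof -
      define x where "x = t * ln (real n)"
      have "3 * f 0 n + 4 * f t n + f (2 * t) n = a n * real n powr (-\<sigma>) * (3 + 4 * cos x + cos (2 * x))"
        by (simp add: f_def x_def algebra_simps)
      also have "3 + 4 * cos x + cos (2 * x) = 2 * (1 + cos x) ^ 2"
        unfolding cos_double_cos by (simp add: power2_eq_square algebra_simps)
      finally show ?thesis using a[of n] by simp
    qed
    have pos: "0 \<le> 3 * Re (log_zeta (Complex \<sigma> 0)) + 4 * Re (log_zeta (Complex \<sigma> t))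
        + Re (log_zeta (Complex \<sigma> (2*t)))" (is "0 \<le> ?E")
      by (rule sums_le[OF s2 sums_zero s1])
    have n: "norm (zeta_series (Complex \<sigma> u)) = norm C * exp (Re (log_zeta (Complex \<sigma> u)))" for u
      using eq[of "Complex \<sigma> u"] s by (simp add: norm_mult)
    have "norm C ^ 8 * 1 \<le> norm C ^ 8 * exp ?E"
      using pos by (intro mult_left_mono) auto
    also have "\<dots> = (norm C * exp (Re (log_zeta (Complex \<sigma> 0)))) ^ 3 * (norm C * exp (Re (log_zeta (Complex \<sigma> t)))) ^ 4
        * (norm C * exp (Re (log_zeta (Complex \<sigma> (2*t)))))"
      by (simp add: power_mult_distrib exp_add exp_of_nat_mult [of 3, simplified] exp_of_nat_mult [of 4, simplified]
                    eval_nat_numeral)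
    finally show ?thesis
      by (simp add: n [symmetric] complex_of_real_def)
  qed
  thus ?thesis using C by (intro exI[of _ "norm C ^ 8"]) auto
qed

section \<open>Continuation beyond the line Re s = 1\<close>

text \<open>For \<open>Re s > 1\<close> the powers \<open>n powr (1 - s)\<close> telescope, and the sum is \<open>(s - 1) \<zeta>(s) - 1\<close>.\<close>

definition zeta_num_term :: "nat \<Rightarrow> complex \<Rightarrow> complex" where
  "zeta_num_term n s = (s - 1) * of_nat (Suc n) powr (-s) - of_nat (Suc n) powr (1 - s)
     + of_nat (Suc (Suc n)) powr (1 - s)"

definition zeta_num :: "complex \<Rightarrow> complex" where
  "zeta_num s = 1 + (\<Sum>n. zeta_num_term n s)"

lemma norm_real_powr: "u > 0 \<Longrightarrow> norm (complex_of_real u powr s) = u powr Re s"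
  by (simp add: norm_powr_real powr_def)

text \<open>The mean value bound gains a power of \<open>N\<close> at the price of a factor
  \<open>norm s\<close>; the triangle inequality gains nothing but is free of that factor. A
  geometric mean of the two is used below.\<close>

lemma norm_powr_diff_le:
  assumes N: "N \<ge> (1::real)" and u: "N \<le> u" "u \<le> N + 1" and s: "Re s > 0"
  shows "norm (complex_of_real u powr (-s) - complex_of_real N powr (-s)) \<le> norm s * N powr (-Re s - 1)"
    and "norm (complex_of_real u powr (-s) - complex_of_real N powr (-s)) \<le> 2 * N powr (-Re s)"
proof -
  let ?S = "complex_of_real ` {N..N+1}"
  have conv: "convex ?S"
    by (intro convex_linear_image) (auto simp: linear_of_real)
  have "norm (complex_of_real u powr (-s) - complex_of_real N powr (-s)) \<le>
          (norm s * N powr (-Re s - 1)) * norm (complex_of_real u - of_real N)"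
  proof (rule field_differentiable_bound[OF conv])
    fix z assume "z \<in> ?S"
    then obtain v where v: "z = of_real v" "N \<le> v" "v \<le> N + 1" by auto
    have nz: "z \<notin> \<real>\<^sub>\<le>\<^sub>0" using v N by auto
    show "((\<lambda>z. z powr (-s)) has_field_derivative ((-s) * z powr (-s - 1))) (at z within ?S)"
      by (rule has_field_derivative_at_within[OF has_field_derivative_powr[OF nz]])
    have "norm ((-s) * z powr (-s - 1)) = norm s * v powr (-Re s - 1)"
      using v N by (simp add: norm_mult norm_real_powr)
    also have "\<dots> \<le> norm s * N powr (-Re s - 1)"
      using v N s by (intro mult_left_mono powr_mono2') auto
    finally show "norm ((-s) * z powr (-s - 1)) \<le> norm s * N powr (-Re s - 1)" .
  qed (use u in auto)
  also have "norm (complex_of_real u - of_real N) = \<bar>u - N\<bar>"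
    by (metis norm_of_real of_real_diff)
  also have "norm s * N powr (-Re s - 1) * \<bar>u - N\<bar> \<le> norm s * N powr (-Re s - 1) * 1"
    using u by (intro mult_left_mono) auto
  finally show "norm (complex_of_real u powr (-s) - complex_of_real N powr (-s)) \<le> norm s * N powr (-Re s - 1)"
    by simp
  have "norm (complex_of_real u powr (-s) - complex_of_real N powr (-s)) \<le> u powr (-Re s) + N powr (-Re s)"
    using norm_triangle_ineq4[of "complex_of_real u powr (-s)" "complex_of_real N powr (-s)"] u N
    by (simp add: norm_real_powr)
  also have "u powr (-Re s) \<le> N powr (-Re s)"
    using u N s by (intro powr_mono2') auto
  finally show "norm (complex_of_real u powr (-s) - complex_of_real N powr (-s)) \<le> 2 * N powr (-Re s)"
    by simp
qed

text \<open>The term is the increment over \<open>[N, N + 1]\<close> of a function with derivative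
  \<open>(1 - s) * (z powr (-s) - N powr (-s))\<close>, so a bound for the difference of powers
  carries over with the factor \<open>norm (s - 1)\<close>.\<close>

lemma norm_zeta_num_term_le_aux:
  assumes s: "Re s > 0" and B: "\<And>u. real (Suc n) \<le> u \<Longrightarrow> u \<le> real (Suc n) + 1 \<Longrightarrow>
    norm (complex_of_real u powr (-s) - complex_of_real (real (Suc n)) powr (-s)) \<le> B"
  shows "norm (zeta_num_term n s) \<le> norm (s - 1) * B"
proof -
  define N where "N = real (Suc n)"
  have N: "N \<ge> 1" by (simp add: N_def)
  let ?S = "complex_of_real ` {N..N+1}"
  have conv: "convex ?S"
    by (intro convex_linear_image) (auto simp: linear_of_real)
  define f where "f = (\<lambda>z. z powr (1 - s) + (s - 1) * z * of_real N powr (-s))"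
  have "norm (f (of_real (N + 1)) - f (of_real N)) \<le>
          (norm (s - 1) * B) * norm (complex_of_real (N + 1) - of_real N)"
  proof (rule field_differentiable_bound[OF conv])
    fix z assume "z \<in> ?S"
    then obtain v where v: "z = of_real v" "N \<le> v" "v \<le> N + 1" by auto
    have nz: "z \<notin> \<real>\<^sub>\<le>\<^sub>0" using v N by auto
    have "(f has_field_derivative ((1 - s) * z powr (1 - s - 1) + (s - 1) * of_real N powr (-s))) (at z)"
      unfolding f_def
      by (rule derivative_eq_intros has_field_derivative_powr[OF nz] refl)+ simp
    also have "(1 - s) * z powr (1 - s - 1) + (s - 1) * of_real N powr (-s)
        = (1 - s) * (z powr (-s) - of_real N powr (-s))"
      by (simp add: algebra_simps)
    finally show "(f has_field_derivative ((1 - s) * (z powr (-s) - of_real N powr (-s)))) (at z within ?S)"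
      by (rule has_field_derivative_at_within)
    show "norm ((1 - s) * (z powr (-s) - of_real N powr (-s))) \<le> norm (s - 1) * B"
      using B[of v] v unfolding norm_mult N_def norm_minus_commute[of 1 s]
      by (intro mult_left_mono) auto
  next
    show "complex_of_real (N + 1) \<in> ?S" "complex_of_real N \<in> ?S"
      by (rule imageI, simp)+
  qed
  also have "norm (complex_of_real (N + 1) - of_real N) = 1" by simp
  also have "f (of_real (N + 1)) - f (of_real N) = zeta_num_term n s"
    unfolding f_def zeta_num_term_def N_def by (simp add: algebra_simps)
  finally show ?thesis by simp
qed

text \<open>Interpolating between the two bounds trades decay in \<open>n\<close> for growth in \<open>s\<close>: this makes the
  series converge slightly to the left of the line \<open>Re s = 1\<close>, with growth of small exponent.\<close>

lemma norm_zeta_num_term_le: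
  assumes s: "Re s > 59/60"
  shows "norm (zeta_num_term n s) \<le> 2 * norm (s - 1) * norm s powr (1/30) * real (Suc n) powr (-(61/60))"
proof -
  define N where "N = real (Suc n)"
  have N: "N \<ge> 1" by (simp add: N_def)
  have s0: "norm s > 0" using s by auto
  \<comment> \<open>Weight 1/30 on the mean value bound gives \<open>N\<close> the exponent
    \<open>-Re s - 1/30\<close>, which is below -61/60 precisely when \<open>Re s > 59/60\<close>;
    the growth in \<open>s\<close> is then only \<open>norm s powr (1/30)\<close>.\<close>
  define B where "B = (norm s * N powr (-Re s - 1)) powr (1/30) * (2 * N powr (-Re s)) powr (29/30)"
  have 1: "norm (zeta_num_term n s) \<le> norm (s - 1) * B"
  proof (rule norm_zeta_num_term_le_aux)
    fix u assume u: "real (Suc n) \<le> u" "u \<le> real (Suc n) + 1"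
    let ?x = "norm (complex_of_real u powr (-s) - complex_of_real (real (Suc n)) powr (-s))"
    have "?x = ?x powr (1/30) * ?x powr (29/30)"
      by (simp flip: powr_add)
    also have "\<dots> \<le> B"
      unfolding B_def N_def using norm_powr_diff_le[of "real (Suc n)" u s] u s
      by (intro mult_mono powr_mono2) auto
    finally show "?x \<le> B" .
  qed (use s in auto)
  have "B = norm s powr (1/30) * 2 powr (29/30) * N powr (-Re s - 1/30)"
  proof -
    have "B = norm s powr (1/30) * 2 powr (29/30) * (N powr ((-Re s - 1) * (1/30)) * N powr ((-Re s) * (29/30)))"
      using N s0 unfolding B_def by (simp add: powr_mult powr_powr)
    also have "N powr ((-Re s - 1) * (1/30)) * N powr ((-Re s) * (29/30)) = N powr (-Re s - 1/30)"
      unfolding powr_add [symmetric] by (rule arg_cong[where f = "\<lambda>x. N powr x"]) (simp add: field_simps)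
    finally show ?thesis .
  qed
  also have "\<dots> \<le> norm s powr (1/30) * 2 powr 1 * N powr (-(61/60))"
    by (rule mult_mono[OF mult_left_mono[OF powr_mono] powr_mono]) (use N s in auto)
  finally have 2: "B \<le> norm s powr (1/30) * 2 powr 1 * N powr (-(61/60))" .
  from order_trans[OF 1 mult_left_mono[OF 2 norm_ge_zero]] show ?thesis
    unfolding N_def by (simp add: mult_ac)
qed

lemma zeta_num_term_summable:
  assumes s: "Re s > 59/60"
  shows "summable (\<lambda>n. norm (zeta_num_term n s))"
proof -
  have "summable (\<lambda>n. real (Suc n) powr (-(61/60)))"
    using summable_nat_powr[of "61/60"] by (subst summable_Suc_iff) simp
  hence *: "summable (\<lambda>n. 2 * norm (s - 1) * norm s powr (1/30) * real (Suc n) powr (-(61/60)))"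
    by (rule summable_mult)
  show ?thesis
    by (rule summable_comparison_test'[OF *, of 0]) (use norm_zeta_num_term_le[OF s] in auto)
qed

text \<open>The factor \<open>norm (s - 1)\<close> is kept separate, since it cancels when
  \<open>zeta_reg\<close> is formed by dividing by \<open>s - 1\<close>.\<close>

lemma zeta_num_minus_one_le:
  "\<exists>K>0. \<forall>s. Re s > 59/60 \<longrightarrow> norm (zeta_num s - 1) \<le> K * norm (s - 1) * norm s powr (1/30)"
proof -
  have sm: "summable (\<lambda>n. real (Suc n) powr (-(61/60)))"
    using summable_nat_powr[of "61/60"] by (subst summable_Suc_iff) simp
  define K where "K = (\<Sum>n. real (Suc n) powr (-(61/60)))"
  have "norm (zeta_num s - 1) \<le> (2 * K + 1) * norm (s - 1) * norm s powr (1/30)" if s: "Re s > 59/60" for s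
  proof -
    let ?c = "2 * norm (s - 1) * norm s powr (1/30)"
    have "norm (zeta_num s - 1) = norm (\<Sum>n. zeta_num_term n s)" by (simp add: zeta_num_def)
    also have "\<dots> \<le> (\<Sum>n. norm (zeta_num_term n s))"
      by (rule summable_norm[OF zeta_num_term_summable[OF s]])
    also have "\<dots> \<le> (\<Sum>n. ?c * real (Suc n) powr (-(61/60)))"
      by (intro suminf_le zeta_num_term_summable s norm_zeta_num_term_le summable_mult sm)
    also have "\<dots> = ?c * K" unfolding K_def by (rule suminf_mult[OF sm])
    also have "\<dots> \<le> (2 * K + 1) * norm (s - 1) * norm s powr (1/30)"
      by (simp add: algebra_simps)
    finally show ?thesis .
  qed
  moreover have "K \<ge> 0" unfolding K_def by (intro suminf_nonneg sm) auto
  ultimately show ?thesis by (intro exI[of _ "2 * K + 1"]) auto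
qed

lemma zeta_num_holomorphic: "zeta_num holomorphic_on {s. Re s > 59/60}"
proof -
  let ?S = "{s::complex. Re s > 59/60}"
  have op: "open ?S" by (rule open_halfspace_Re_gt)
  have "\<exists>g g'. \<forall>x \<in> ?S. ((\<lambda>n. zeta_num_term n x) sums g x) \<and> ((\<lambda>n. deriv (zeta_num_term n) x) sums g' x) \<and>
          (g has_field_derivative g' x) (at x)"
  proof (rule series_and_derivative_comparison_local[OF op])
    fix n and x :: complex assume "x \<in> ?S"
    have "zeta_num_term n holomorphic_on UNIV"
      unfolding zeta_num_term_def by (intro holomorphic_intros)
    thus "(zeta_num_term n has_field_derivative deriv (zeta_num_term n) x) (at x)"
      by (intro holomorphic_derivI[of _ UNIV]) auto
  next
    fix x :: complex assume "x \<in> ?S"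
    define h where "h = (\<lambda>n. 2 * (norm (x - 1) + 1) * (norm x + 1) powr (1/30) * real (Suc n) powr (-(61/60)))"
    have "summable (\<lambda>n. real (Suc n) powr (-(61/60)))"
      using summable_nat_powr[of "61/60"] by (subst summable_Suc_iff) simp
    hence h: "summable h" unfolding h_def by (rule summable_mult)
    have "norm (zeta_num_term n y) \<le> h n" if y: "y \<in> ball x 1 \<inter> ?S" for y n
    proof -
      have d: "norm (y - x) < 1" using y by (auto simp: dist_norm norm_minus_commute)
      have "norm y \<le> norm x + 1" "norm (y - 1) \<le> norm (x - 1) + 1"
        using d norm_triangle_ineq[of x "y - x"] norm_triangle_ineq[of "x - 1" "y - x"] by auto
      hence "2 * norm (y - 1) * norm y powr (1/30) * real (Suc n) powr (-(61/60)) \<le> h n"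
        unfolding h_def by (intro mult_right_mono mult_mono powr_mono2) auto
      with norm_zeta_num_term_le[of y n] y show ?thesis by auto
    qed
    thus "\<exists>d h. 0 < d \<and> summable h \<and> (\<forall>\<^sub>F n in sequentially. \<forall>y\<in>ball x d \<inter> ?S. norm (zeta_num_term n y) \<le> h n)"
      using h by (intro exI[of _ 1] exI[of _ h]) auto
  qed
  then obtain g g' where g: "\<And>x. x \<in> ?S \<Longrightarrow> (\<lambda>n. zeta_num_term n x) sums g x"
     "\<And>x. x \<in> ?S \<Longrightarrow> (g has_field_derivative g' x) (at x)" by blast
  have "(\<lambda>s. 1 + g s) holomorphic_on ?S"
  proof -
    have "g holomorphic_on ?S"
      unfolding holomorphic_on_open[OF op] using g(2) by blast
    thus ?thesis by (intro holomorphic_intros)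
  qed
  moreover have "1 + g s = zeta_num s" if "s \<in> ?S" for s
    using g(1)[OF that] by (simp add: zeta_num_def sums_iff)
  ultimately show ?thesis
    by (rule holomorphic_transform)
qed

lemma zeta_num_eq:
  assumes s: "Re s > 1"
  shows "zeta_num s = (s - 1) * zeta_series s"
proof -
  have "(\<lambda>n. of_nat n powr (-s)) sums zeta_series s"
    using dirichlet_series_sums[OF dirichlet_summable_one s] by simp
  hence "(\<lambda>n. of_nat (Suc n) powr (-s)) sums zeta_series s"
    by (subst sums_Suc_iff) simp
  hence 1: "(\<lambda>n. (s - 1) * of_nat (Suc n) powr (-s)) sums ((s - 1) * zeta_series s)"
    by (rule sums_mult)
  have "(\<lambda>n. real (Suc n) powr (1 - Re s)) \<longlonglongrightarrow> 0"
    using s by real_asymp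
  also have "(\<lambda>n. real (Suc n) powr (1 - Re s)) = (\<lambda>n. norm (of_nat (Suc n) powr (1 - s) :: complex))"
    unfolding norm_nat_powr by simp
  finally have "(\<lambda>n. of_nat (Suc n) powr (1 - s) :: complex) \<longlonglongrightarrow> 0"
    by (simp only: tendsto_norm_zero_iff)
  from telescope_sums[OF this]
  have 2: "(\<lambda>n. of_nat (Suc (Suc n)) powr (1 - s) - of_nat (Suc n) powr (1 - s) :: complex) sums (0 - 1)"
    by simp
  have "(\<lambda>n. zeta_num_term n s) sums ((s - 1) * zeta_series s + (0 - 1))"
    using sums_add[OF 1 2] unfolding zeta_num_term_def by (simp only: diff_conv_add_uminus add_ac)
  thus ?thesis by (simp add: zeta_num_def sums_iff)
qed

text \<open>Every term vanishes at 1, as both powers with exponent \<open>1 - s\<close> equal 1. The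
  value found is the residue of zeta at 1.\<close>

lemma zeta_num_1: "zeta_num 1 = 1"
proof -
  have "zeta_num_term n 1 = 0" for n
    by (simp add: zeta_num_term_def del: of_nat_Suc)
  thus ?thesis by (simp add: zeta_num_def)
qed

text \<open>This is the continuation of zeta minus its principal part \<open>1 / (s - 1)\<close>;
  the removable singularity is filled by the derivative.\<close>

definition zeta_reg :: "complex \<Rightarrow> complex" where
  "zeta_reg s = (if s = 1 then deriv zeta_num 1 else (zeta_num s - 1) / (s - 1))"

lemma zeta_reg_holomorphic: "zeta_reg holomorphic_on {s. Re s > 59/60}"
proof -
  have "(\<lambda>z. if z = 1 then deriv zeta_num 1 else (zeta_num z - zeta_num 1) / (z - 1))
          holomorphic_on {s. Re s > 59/60}"
    by (rule pole_lemma_open[OF zeta_num_holomorphic open_halfspace_Re_gt])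
  thus ?thesis
    unfolding zeta_reg_def[abs_def] zeta_num_1 .
qed

text \<open>Off the point 1 the bound is a division by \<open>s - 1\<close>; at 1 it survives the
  limit by continuity.\<close>

lemma zeta_reg_le:
  "\<exists>K>0. \<forall>s. Re s > 59/60 \<longrightarrow> norm (zeta_reg s) \<le> K * norm s powr (1/30)"
proof -
  obtain K where K: "K > 0" "\<And>s. Re s > 59/60 \<Longrightarrow> norm (zeta_num s - 1) \<le> K * norm (s - 1) * norm s powr (1/30)"
    using zeta_num_minus_one_le by blast
  have *: "norm (zeta_reg s) \<le> K * norm s powr (1/30)" if "Re s > 59/60" "s \<noteq> 1" for s
    using K(2)[OF that(1)] that(2) by (simp add: zeta_reg_def norm_divide field_simps)
  have cont: "isCont zeta_reg 1"
    by (rule continuous_on_interior[OF holomorphic_on_imp_continuous_on[OF zeta_reg_holomorphic]])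
       (subst interior_open[OF open_halfspace_Re_gt], simp)
  have "norm (zeta_reg 1) \<le> K * norm (1::complex) powr (1/30)"
  proof (rule tendsto_le)
    show "((\<lambda>s. norm (zeta_reg s)) \<longlongrightarrow> norm (zeta_reg 1)) (at 1)"
      using cont by (intro tendsto_norm) (simp add: isCont_def)
    show "((\<lambda>s. K * norm (s::complex) powr (1/30)) \<longlongrightarrow> K * norm (1::complex) powr (1/30)) (at 1)"
      by (intro tendsto_intros) auto
    have "\<forall>\<^sub>F s in at (1::complex). s \<in> {s. Re s > 59/60} - {1}"
      by (rule eventually_at_in_open[OF open_halfspace_Re_gt]) simp
    thus "\<forall>\<^sub>F s in at 1. norm (zeta_reg s) \<le> K * norm s powr (1/30)"
      by eventually_elim (use * in auto)
  qed auto
  with * have "norm (zeta_reg s) \<le> K * norm s powr (1/30)" if "Re s > 59/60" for s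
    using that by (cases "s = 1") auto
  with K(1) show ?thesis by blast
qed

section \<open>Bounds near the line Re s = 1\<close>

lemma norm_le_Re_Im:
  assumes "0 \<le> Re s" "Re s \<le> 3"
  shows "norm s \<le> 3 * (1 + \<bar>Im s\<bar>)" "norm (s - 1) \<le> 3 * (1 + \<bar>Im s\<bar>)"
  using assms cmod_le[of s] cmod_le[of "s - 1"] by auto

text \<open>In a vertical strip \<open>norm s\<close> and \<open>norm (s - 1)\<close> are comparable
  to the height, so growth can be measured by \<open>1 + \<bar>Im s\<bar>\<close>. The strip extends
  to 3 so that small discs about points with \<open>Re s \<le> 2\<close> stay inside it.\<close>

lemma zeta_upper_bounds:
  obtains A where "A \<ge> 1"
    "\<And>s. 59/60 < Re s \<Longrightarrow> Re s \<le> 3 \<Longrightarrow> norm (zeta_num s) \<le> A * (1 + \<bar>Im s\<bar>) * (1 + \<bar>Im s\<bar>) powr (1/30)"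
    "\<And>s. 59/60 < Re s \<Longrightarrow> Re s \<le> 3 \<Longrightarrow> norm (zeta_reg s) \<le> A * (1 + \<bar>Im s\<bar>) powr (1/30)"
proof -
  obtain K where K: "K > 0" "\<And>s. Re s > 59/60 \<Longrightarrow> norm (zeta_num s - 1) \<le> K * norm (s - 1) * norm s powr (1/30)"
    using zeta_num_minus_one_le by blast
  obtain L where L: "L > 0" "\<And>s. Re s > 59/60 \<Longrightarrow> norm (zeta_reg s) \<le> L * norm s powr (1/30)"
    using zeta_reg_le by blast
  define c where "c = (3::real) powr (1/30)"
  have c: "c > 0" by (simp add: c_def)
  define A where "A = 1 + 3 * K * c + L * c"
  have pw: "norm s powr (1/30) \<le> c * (1 + \<bar>Im s\<bar>) powr (1/30)" if "59/60 < Re s" "Re s \<le> 3" for s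
  proof -
    have "norm s powr (1/30) \<le> (3 * (1 + \<bar>Im s\<bar>)) powr (1/30)"
      using norm_le_Re_Im[of s] that by (intro powr_mono2) auto
    also have "\<dots> = c * (1 + \<bar>Im s\<bar>) powr (1/30)"
      unfolding c_def by (subst powr_mult) auto
    finally show ?thesis .
  qed
  show ?thesis
  proof (rule that[of A])
    show "A \<ge> 1" using K(1) L(1) c by (simp add: A_def)
    fix s :: complex assume s: "59/60 < Re s" "Re s \<le> 3"
    define X where "X = 1 + \<bar>Im s\<bar>"
    have X: "X \<ge> 1" by (simp add: X_def)
    have X30: "X powr (1/30) \<ge> 1" using X by (intro ge_one_powr_ge_zero) auto
    have 1: "norm (zeta_num s) \<le> 1 + norm (zeta_num s - 1)"
      using norm_triangle_ineq[of 1 "zeta_num s - 1"] by simp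
    have 2: "norm (zeta_num s - 1) \<le> K * (3 * X) * (c * X powr (1/30))"
      using K(2)[OF s(1)] pw[OF s] norm_le_Re_Im(2)[of s] s K(1) unfolding X_def
      by (elim order_trans, intro mult_mono) auto
    have 3: "1 \<le> X * X powr (1/30)"
      using mult_mono[OF X X30] X by simp
    have "norm (zeta_num s) \<le> X * X powr (1/30) + K * (3 * X) * (c * X powr (1/30))"
      using 1 2 3 by linarith
    also have "\<dots> = (1 + 3 * K * c) * (X * X powr (1/30))"
      by (simp add: algebra_simps)
    also have "\<dots> \<le> A * (X * X powr (1/30))"
      using L(1) c X by (intro mult_right_mono) (auto simp: A_def)
    finally show "norm (zeta_num s) \<le> A * (1 + \<bar>Im s\<bar>) * (1 + \<bar>Im s\<bar>) powr (1/30)"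
      by (simp add: X_def mult_ac)
    have "norm (zeta_reg s) \<le> L * (c * X powr (1/30))"
      using L(2)[OF s(1)] pw[OF s] L(1) unfolding X_def
      by (elim order_trans, intro mult_left_mono) auto
    also have "\<dots> = (L * c) * X powr (1/30)" by simp
    also have "\<dots> \<le> A * X powr (1/30)"
      using K(1) c by (intro mult_right_mono) (auto simp: A_def)
    finally show "norm (zeta_reg s) \<le> A * (1 + \<bar>Im s\<bar>) powr (1/30)"
      by (simp add: X_def)
  qed
qed

text \<open>Cauchy's estimate on discs of radius 1/240; these stay in the domain because
  \<open>119/120 - 1/240 > 59/60\<close>.\<close>

lemma deriv_zeta_num_bound:
  obtains B where "B \<ge> 1"
    "\<And>s. 119/120 \<le> Re s \<Longrightarrow> Re s \<le> 2 \<Longrightarrow> norm (deriv zeta_num s) \<le> B * (1 + \<bar>Im s\<bar>) * (1 + \<bar>Im s\<bar>) powr (1/30)"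
proof -
  obtain A where A: "A \<ge> 1"
    "\<And>s. 59/60 < Re s \<Longrightarrow> Re s \<le> 3 \<Longrightarrow> norm (zeta_num s) \<le> A * (1 + \<bar>Im s\<bar>) * (1 + \<bar>Im s\<bar>) powr (1/30)"
    using zeta_upper_bounds by metis
  \<comment> \<open>240 is the inverse radius; the factors \<open>2\<close> and
    \<open>2 powr (1/30)\<close> pay for \<open>1 + \<bar>Im z\<bar> \<le> 2 * X\<close> on the
    disc.\<close>
  define B where "B = A * 2 * 2 powr (1/30) * 240"
  have "1 * 1 * 1 * 1 \<le> B"
    unfolding B_def using A(1) by (intro mult_mono ge_one_powr_ge_zero) auto
  hence "B \<ge> 1" by simp
  moreover have "norm (deriv zeta_num s) \<le> B * (1 + \<bar>Im s\<bar>) * (1 + \<bar>Im s\<bar>) powr (1/30)"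
    if s: "119/120 \<le> Re s" "Re s \<le> 2" for s
  proof -
    define X where "X = 1 + \<bar>Im s\<bar>"
    have X: "X \<ge> 1" by (simp add: X_def)
    have sub: "Re z > 59/60 \<and> Re z \<le> 3 \<and> \<bar>Im z\<bar> \<le> \<bar>Im s\<bar> + 1" if "dist s z \<le> 1/240" for z
      using that s abs_Re_le_cmod[of "s - z"] abs_Im_le_cmod[of "s - z"]
      by (auto simp: dist_norm abs_if split: if_splits)
    have "norm ((deriv ^^ 1) zeta_num s) \<le> fact 1 * (A * (2 * X) * (2 * X) powr (1/30)) / (1/240)^1"
    proof (rule Cauchy_inequality)
      show "zeta_num holomorphic_on ball s (1/240)"
        by (rule holomorphic_on_subset[OF zeta_num_holomorphic]) (use sub in force)
      show "continuous_on (cball s (1/240)) zeta_num"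
        by (rule continuous_on_subset[OF holomorphic_on_imp_continuous_on[OF zeta_num_holomorphic]])
           (use sub in force)
      fix z assume "norm (s - z) = 1/240"
      hence z: "Re z > 59/60" "Re z \<le> 3" "\<bar>Im z\<bar> \<le> \<bar>Im s\<bar> + 1" using sub[of z] by (auto simp: dist_norm)
      hence Xz: "1 + \<bar>Im z\<bar> \<le> 2 * X" by (simp add: X_def)
      have "norm (zeta_num z) \<le> A * (1 + \<bar>Im z\<bar>) * (1 + \<bar>Im z\<bar>) powr (1/30)"
        by (rule A(2)[OF z(1,2)])
      also have "\<dots> \<le> A * (2 * X) * (2 * X) powr (1/30)"
        using Xz A(1) by (intro mult_mono powr_mono2) auto
      finally show "norm (zeta_num z) \<le> A * (2 * X) * (2 * X) powr (1/30)" .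
    qed auto
    also have "fact 1 * (A * (2 * X) * (2 * X) powr (1/30)) / (1/240)^1 = B * X * X powr (1/30)"
      using X by (simp add: B_def powr_mult)
    finally show ?thesis by (simp add: X_def)
  qed
  ultimately show ?thesis using that by blast
qed

text \<open>Write \<open>X = 1 + \<bar>t\<bar>\<close> and \<open>Y = X powr (1/120)\<close>, so that \<open>zeta_num\<close> and its derivative are
  \<open>O(X Y\<^sup>4)\<close>. The 3-4-1 inequality gives a lower bound \<open>c \<kappa>\<^sup>3 X / Y\<close> at distance \<open>\<kappa>\<^sup>4\<close> from
  the line; moving from there to the line costs \<open>O(\<kappa>\<^sup>4 X Y\<^sup>4)\<close>, which is affordable for
  \<open>\<kappa> = q / Y\<^sup>5\<close> with \<open>q\<close> small.\<close>

lemma zeta_num_lower_bound: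
  obtains c where "c > 0"
    "\<And>s. 1 < Re s \<Longrightarrow> Re s \<le> 2 \<Longrightarrow> norm (zeta_num s) \<ge> c * (1 + \<bar>Im s\<bar>) / ((1 + \<bar>Im s\<bar>) powr (1/120)) ^ 16"
proof -
  obtain A where A: "A \<ge> 1"
    "\<And>s. 59/60 < Re s \<Longrightarrow> Re s \<le> 3 \<Longrightarrow> norm (zeta_num s) \<le> A * (1 + \<bar>Im s\<bar>) * (1 + \<bar>Im s\<bar>) powr (1/30)"
    using zeta_upper_bounds by metis
  obtain B where B: "B \<ge> 1"
    "\<And>s. 119/120 \<le> Re s \<Longrightarrow> Re s \<le> 2 \<Longrightarrow> norm (deriv zeta_num s) \<le> B * (1 + \<bar>Im s\<bar>) * (1 + \<bar>Im s\<bar>) powr (1/30)"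
    using deriv_zeta_num_bound by metis
  obtain d where d: "d > 0" and d341: "\<And>\<sigma> t. \<sigma> > 1 \<Longrightarrow> norm (zeta_series (of_real \<sigma>)) ^ 3 *
       norm (zeta_series (Complex \<sigma> t)) ^ 4 * norm (zeta_series (Complex \<sigma> (2 * t))) \<ge> d"
    using zeta_series_341 by blast
  \<comment> \<open>Close to 1 the factor \<open>s - 1\<close> spoils a lower bound deduced from the
    3-4-1 inequality, but there \<open>zeta_num\<close> is near its value 1. Outside the disc of
    radius \<open>\<rho>\<close>, \<open>norm (s - 1)\<close> is at least a constant times the
    height.\<close>
  have "isCont zeta_num 1"
    by (rule continuous_on_interior[OF holomorphic_on_imp_continuous_on[OF zeta_num_holomorphic]])
       (subst interior_open[OF open_halfspace_Re_gt], simp)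
  then obtain r where r: "r > 0" "\<And>s. dist s 1 < r \<Longrightarrow> dist (zeta_num s) (zeta_num 1) < 1/2"
    unfolding continuous_at_eps_delta by (metis half_gt_zero zero_less_one)
  define \<rho> where "\<rho> = min r 1"
  have \<rho>: "\<rho> > 0" "\<rho> \<le> 1" "\<rho> \<le> r" using r(1) by (auto simp: \<rho>_def)
  have near: "norm (zeta_num s) \<ge> 1/2" if "norm (s - 1) < \<rho>" for s
    using r(2)[of s] that \<rho>(3) norm_triangle_ineq4[of "zeta_num s" "zeta_num s - 1"]
    by (simp add: zeta_num_1 dist_norm)
  define b where "b = \<rho> / 2"
  have b: "b > 0" using \<rho> by (simp add: b_def)
  have far: "norm (s - 1) \<ge> b * (1 + \<bar>Im s\<bar>)" if "norm (s - 1) \<ge> \<rho>" for s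
  proof -
    have "\<rho> * \<bar>Im s\<bar> \<le> 1 * \<bar>Im s\<bar>" using \<rho> by (intro mult_right_mono) auto
    also have "\<bar>Im s\<bar> \<le> norm (s - 1)" using abs_Im_le_cmod[of "s - 1"] by simp
    finally show ?thesis using that by (simp add: b_def algebra_simps)
  qed
  \<comment> \<open>The constant in \<open>e * \<kappa> ^ 12 * X ^ 4 / Y ^ 4 \<le> norm (zeta_num s)
    ^ 4\<close>: \<open>b ^ 5\<close> stems from the five factors \<open>b * X\<close>, the
    denominator from the upper bounds \<open>A\<close> (three times) and
    \<open>4 * A * X * Y ^ 4\<close>.\<close>
  define e where "e = d * b ^ 5 / (4 * A ^ 4)"
  have e: "e > 0" using d b A(1) by (simp add: e_def)
  define c where "c = root 4 e"
  have c: "c > 0" "c ^ 4 = e" using e by (simp_all add: c_def)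
  \<comment> \<open>Measuring the distance to the line by \<open>\<kappa> ^ 4\<close> keeps the
    fourth root of the inequality free of fractional powers:
    \<open>(\<sigma> - 1) ^ 3 \<ge> \<kappa> ^ 12\<close> turns into
    \<open>\<kappa> ^ 3\<close>.\<close>
  have step: "norm (zeta_num s) \<ge> c * \<kappa> ^ 3 * (1 + \<bar>Im s\<bar>) / (1 + \<bar>Im s\<bar>) powr (1/120)"
    if s: "1 < Re s" "Re s \<le> 2" "norm (s - 1) \<ge> \<rho>" and \<kappa>: "\<kappa> \<ge> 0" "\<kappa> ^ 4 \<le> Re s - 1" for s \<kappa>
  proof -
    define \<sigma> t where "\<sigma> = Re s" and "t = Im s"
    have s_eq: "s = Complex \<sigma> t" by (simp add: \<sigma>_def t_def)
    define s2 where "s2 = Complex \<sigma> (2 * t)"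
    define X Y where "X = 1 + \<bar>t\<bar>" and "Y = X powr (1/120)"
    have X: "X \<ge> 1" and Y: "Y \<ge> 1" by (auto simp: X_def Y_def ge_one_powr_ge_zero)
    have Y4: "X powr (1/30) = Y ^ 4" unfolding Y_def using X
      by (simp add: powr_powr flip: powr_realpow)
    have \<sigma>: "1 < \<sigma>" "\<sigma> \<le> 2" using s by (auto simp: \<sigma>_def)
    have 1: "norm (zeta_num (of_real \<sigma>)) \<le> A"
      using A(2)[of "of_real \<sigma>"] \<sigma> by simp
    have "norm (zeta_num s2) \<le> A * (1 + \<bar>2*t\<bar>) * (1 + \<bar>2*t\<bar>) powr (1/30)"
      using A(2)[of s2] \<sigma> by (simp add: s2_def)
    also have "\<dots> \<le> A * (2 * X) * (2 * X) powr (1/30)"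
      using A(1) by (intro mult_mono powr_mono2) (auto simp: X_def)
    also have "\<dots> = (A * 2 * X * X powr (1/30)) * 2 powr (1/30)"
      using X by (simp add: powr_mult)
    also have "\<dots> \<le> (A * 2 * X * X powr (1/30)) * 2 powr 1"
      using A(1) X by (intro mult_left_mono powr_mono) auto
    finally have 2: "norm (zeta_num s2) \<le> 4 * A * X * Y ^ 4" by (simp add: Y4)
    have n1: "norm (s - 1) \<ge> b * X" using far[OF s(3)] by (simp add: X_def t_def)
    have "norm (s2 - 1) \<ge> norm (s - 1)"
      unfolding s2_def s_eq cmod_def by (intro real_sqrt_le_mono) (auto simp: power_mult_distrib)
    hence n2: "norm (s2 - 1) \<ge> b * X" using n1 by linarith
    have "\<kappa> ^ 12 = (\<kappa> ^ 4) ^ 3" by (simp flip: power_mult)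
    also have "\<dots> \<le> (\<sigma> - 1) ^ 3" using \<kappa> by (intro power_mono) (auto simp: \<sigma>_def)
    finally have n3: "\<kappa> ^ 12 \<le> (\<sigma> - 1) ^ 3" .
    \<comment> \<open>Multiplying the 3-4-1 inequality by
      \<open>(\<sigma> - 1) ^ 3 * norm (s - 1) ^ 4 * norm (s2 - 1)\<close> replaces each zeta value
      by the corresponding value of \<open>zeta_num\<close>.\<close>
    have "\<kappa> ^ 12 * (b * X) ^ 4 * (b * X) * d \<le> (\<sigma> - 1) ^ 3 * norm (s - 1) ^ 4 * norm (s2 - 1) *
        (norm (zeta_series (of_real \<sigma>)) ^ 3 * norm (zeta_series s) ^ 4 * norm (zeta_series s2))"
      using d341[of \<sigma> t] n1 n2 n3 \<kappa> b X d \<sigma> unfolding s_eq s2_def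
      by (intro mult_mono power_mono) auto
    also have "\<dots> = norm (zeta_num (of_real \<sigma>)) ^ 3 * norm (zeta_num s) ^ 4 * norm (zeta_num s2)"
    proof -
      have "norm (zeta_num (of_real \<sigma>)) = (\<sigma> - 1) * norm (zeta_series (of_real \<sigma>))"
        using \<sigma> norm_of_real[of "\<sigma> - 1", where 'a = complex] by (simp add: zeta_num_eq norm_mult)
      moreover have "norm (zeta_num s) = norm (s - 1) * norm (zeta_series s)"
           "norm (zeta_num s2) = norm (s2 - 1) * norm (zeta_series s2)"
        using \<sigma> by (simp_all add: zeta_num_eq norm_mult s_eq s2_def)
      ultimately show ?thesis by (simp add: power_mult_distrib mult_ac)
    qed
    also have "\<dots> \<le> A ^ 3 * norm (zeta_num s) ^ 4 * (4 * A * X * Y ^ 4)"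
      using 1 2 A(1) by (intro mult_mono power_mono) auto
    finally have *: "\<kappa> ^ 12 * (b * X) ^ 4 * (b * X) * d \<le> A ^ 3 * norm (zeta_num s) ^ 4 * (4 * A * X * Y ^ 4)" .
    have "(c * \<kappa> ^ 3 * X / Y) ^ 4 = e * \<kappa> ^ 12 * X ^ 4 / Y ^ 4"
      using c(2) by (simp add: power_mult_distrib power_divide flip: power_mult)
    also have "\<dots> = (\<kappa> ^ 12 * (b * X) ^ 4 * (b * X) * d) / (4 * A ^ 4 * X * Y ^ 4)"
      using X A(1) by (simp add: e_def power_mult_distrib field_simps eval_nat_numeral)
    also have "\<dots> \<le> (A ^ 3 * norm (zeta_num s) ^ 4 * (4 * A * X * Y ^ 4)) / (4 * A ^ 4 * X * Y ^ 4)"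
      using * A(1) X Y by (intro divide_right_mono) auto
    also have "\<dots> = norm (zeta_num s) ^ 4"
      using A(1) X Y by (simp add: field_simps eval_nat_numeral)
    finally have "c * \<kappa> ^ 3 * X / Y \<le> norm (zeta_num s)"
      by (rule power_le_imp_le_base[of _ 3, simplified]) simp
    thus ?thesis by (simp add: X_def Y_def t_def)
  qed
  \<comment> \<open>With \<open>q * B \<le> c / 2\<close>, a move of length at most
    \<open>\<kappa> ^ 4\<close> towards the line costs at most half of the lower bound
    \<open>c * \<kappa> ^ 3 * X / Y\<close>.\<close>
  define q where "q = min 1 (c / (2 * B))"
  have q: "q > 0" "q \<le> 1" "q * B \<le> c / 2"
    using c(1) B(1) by (auto simp: q_def min_def field_simps)
  \<comment> \<open>The value 1/4 serves the neighbourhood of 1, where \<open>X \<le> 2\<close> and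
    \<open>zeta_num\<close> has modulus at least 1/2. The other value is the half that remains after
    the move, with \<open>\<kappa> ^ 3 / Y = q ^ 3 / Y ^ 16\<close>.\<close>
  define c' where "c' = min (1/4) (c * q ^ 3 / 2)"
  show ?thesis
  proof (rule that[of c'])
    show "c' > 0" using c(1) q by (simp add: c'_def)
    fix s :: complex assume s: "1 < Re s" "Re s \<le> 2"
    define X Y where "X = 1 + \<bar>Im s\<bar>" and "Y = X powr (1/120)"
    have X: "X \<ge> 1" and Y: "Y \<ge> 1" by (auto simp: X_def Y_def ge_one_powr_ge_zero)
    have Y4: "X powr (1/30) = Y ^ 4" unfolding Y_def using X
      by (simp add: powr_powr flip: powr_realpow)
    have "c' * X / Y ^ 16 \<le> norm (zeta_num s)"
    proof (cases "norm (s - 1) < \<rho>")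
      case True
      have "\<bar>Im s\<bar> \<le> 1" using True \<rho> abs_Im_le_cmod[of "s - 1"] by simp
      hence "c' * X \<le> 1/4 * 2" using X by (intro mult_mono) (auto simp: c'_def X_def)
      have "c' * X / Y ^ 16 \<le> c' * X / 1"
        using \<open>c' > 0\<close> X Y by (intro divide_left_mono) auto
      also have "\<dots> \<le> 1/2" using \<open>c' * X \<le> 1/4 * 2\<close> by simp
      also have "\<dots> \<le> norm (zeta_num s)" by (rule near[OF True])
      finally show ?thesis .
    next
      case False
      define \<kappa> where "\<kappa> = q / Y ^ 5"
      have \<kappa>: "0 < \<kappa>" "\<kappa> \<le> 1" using q Y by (auto simp: \<kappa>_def field_simps intro: order_trans[of _ 1])
      have k4: "\<kappa> ^ 4 \<le> 1" using \<kappa> by (simp add: power_le_one)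
      have eq: "c * \<kappa> ^ 3 * X / Y = c * q ^ 3 * X / Y ^ 16"
        using Y by (simp add: \<kappa>_def power_divide field_simps eval_nat_numeral)
      have "c' * X / Y ^ 16 \<le> (c * q ^ 3 / 2) * X / Y ^ 16"
        using X Y by (intro divide_right_mono mult_right_mono) (auto simp: c'_def)
      also have "\<dots> = (c * q ^ 3 * X / Y ^ 16) / 2" by simp
      also have "\<dots> = c * \<kappa> ^ 3 * X / (2 * Y)" unfolding eq [symmetric] by simp
      also have "\<dots> \<le> norm (zeta_num s)"
      proof (cases "\<kappa> ^ 4 \<le> Re s - 1")
        case True
        have "c * \<kappa> ^ 3 * X / (2 * Y) \<le> c * \<kappa> ^ 3 * X / Y"
          using c(1) \<kappa> X Y by (intro divide_left_mono) auto
        also have "\<dots> \<le> norm (zeta_num s)"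
          using step[OF s _ _ True] False \<kappa> by (simp add: X_def Y_def)
        finally show ?thesis .
      next
        case F: False
        define s' where "s' = Complex (1 + \<kappa> ^ 4) (Im s)"
        have "(Re s - 1) ^ 2 \<le> (\<kappa> ^ 4) ^ 2" using F s by (intro power_mono) auto
        hence "norm (s - 1) \<le> norm (s' - 1)"
          by (simp add: cmod_def s'_def)
        hence st: "c * \<kappa> ^ 3 * X / Y \<le> norm (zeta_num s')"
          using step[of s' \<kappa>] False \<kappa> k4 by (simp add: s'_def X_def Y_def)
        have "norm (zeta_num s' - zeta_num s) \<le> (B * X * Y ^ 4) * norm (s' - s)"
        proof (rule field_differentiable_bound[of "closed_segment s s'"])
          fix z assume z: "z \<in> closed_segment s s'"
          have "Re z \<in> {1..2} \<and> Im z = Im s"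
          proof -
            from z obtain u where u: "z = (1 - u) *\<^sub>R s + u *\<^sub>R s'" "0 \<le> u" "u \<le> 1"
              by (auto simp: in_segment)
            have "Im z = (1 - u) * Im s + u * Im s" unfolding u(1) by (simp add: s'_def)
            hence Im: "Im z = Im s" by (simp add: algebra_simps)
            have "z \<in> {z. Re z \<ge> 1} \<inter> {z. Re z \<le> 2}"
              by (rule subsetD[OF closed_segment_subset z])
                 (use s k4 \<kappa> in \<open>auto simp: s'_def intro!: convex_Int convex_halfspace_Re_ge convex_halfspace_Re_le\<close>)
            thus ?thesis using Im by auto
          qed
          hence z: "Re z \<ge> 1" "Re z \<le> 2" "Im z = Im s" by auto
          show "(zeta_num has_field_derivative deriv zeta_num z) (at z within closed_segment s s')"
            by (rule has_field_derivative_at_within[OF holomorphic_derivI[OF zeta_num_holomorphic open_halfspace_Re_gt]])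
               (use z in auto)
          show "norm (deriv zeta_num z) \<le> B * X * Y ^ 4"
            using B(2)[of z] z by (simp add: X_def [symmetric] Y4)
        qed auto
        also have "s' - s = of_real (1 + \<kappa> ^ 4 - Re s)"
          by (simp add: s'_def complex_eq_iff)
        also have "norm (of_real (1 + \<kappa> ^ 4 - Re s) :: complex) \<le> \<kappa> ^ 4"
          unfolding norm_of_real using F s by auto
        finally have "norm (zeta_num s' - zeta_num s) \<le> (B * X * Y ^ 4) * \<kappa> ^ 4"
          using B(1) X Y by (simp add: mult_left_mono)
        also have "\<dots> = (q * B) * (\<kappa> ^ 3 * X / Y)"
          using Y by (simp add: \<kappa>_def field_simps eval_nat_numeral)
        also have "\<dots> \<le> c / 2 * (\<kappa> ^ 3 * X / Y)"
          using q \<kappa> X Y by (intro mult_right_mono) auto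
        finally have 1: "norm (zeta_num s' - zeta_num s) \<le> c / 2 * (\<kappa> ^ 3 * X / Y)" .
        define T where "T = c / 2 * (\<kappa> ^ 3 * X / Y)"
        have 2: "norm (zeta_num s') \<le> norm (zeta_num s) + norm (zeta_num s' - zeta_num s)"
          using norm_triangle_ineq[of "zeta_num s" "zeta_num s' - zeta_num s"] by simp
        have 3: "c * \<kappa> ^ 3 * X / Y = 2 * T" "c * \<kappa> ^ 3 * X / (2 * Y) = T"
          by (simp_all add: T_def)
        show ?thesis using 1 2 st unfolding 3 T_def [symmetric] by linarith
      qed
      finally show ?thesis .
    qed
    thus "c' * (1 + \<bar>Im s\<bar>) / ((1 + \<bar>Im s\<bar>) powr (1/120)) ^ 16 \<le> norm (zeta_num s)"
      by (simp add: X_def Y_def)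
  qed
qed

lemma zeta_num_nonzero: "Re s > 1 \<Longrightarrow> zeta_num s \<noteq> 0"
  using zeta_series_nonzero[of s] by (auto simp: zeta_num_eq)

lemma deriv_zeta_num:
  assumes s: "Re s > 1"
  shows "deriv zeta_num s = zeta_series s - (s - 1) * (dirichlet_series mangoldt s * zeta_series s)"
proof -
  have "((\<lambda>s. (s - 1) * zeta_series s) has_field_derivative
          (zeta_series s - (s - 1) * (dirichlet_series mangoldt s * zeta_series s))) (at s)"
    by (rule derivative_eq_intros zeta_series_deriv[OF s] refl)+ (simp add: algebra_simps)
  hence "(zeta_num has_field_derivative
          (zeta_series s - (s - 1) * (dirichlet_series mangoldt s * zeta_series s))) (at s)"
    by (rule has_field_derivative_transform_within_open[of _ _ _ "{s. Re s > 1}"])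
       (use s in \<open>auto simp: open_halfspace_Re_gt zeta_num_eq\<close>)
  thus ?thesis by (rule DERIV_imp_deriv)
qed

text \<open>Both \<open>-\<zeta>'/\<zeta>\<close> and \<open>\<zeta>\<close> have a simple pole with residue 1 at \<open>s = 1\<close>; the
  difference of the Dirichlet series is therefore regular there.\<close>

lemma mangoldt_minus_one_series:
  assumes s: "Re s > 1"
  shows "dirichlet_series (\<lambda>n. mangoldt n - 1) s = - deriv zeta_num s / zeta_num s - zeta_reg s"
proof -
  have "s \<noteq> 1" using s by auto
  \<comment> \<open>Here \<open>a\<close> is \<open>s - 1\<close>, \<open>z\<close> is zeta and
    \<open>F\<close> is the series of the von Mangoldt function; the two contributions
    \<open>1 / a\<close> cancel.\<close>
  have alg: "- (z - a * (F * z)) / (a * z) - (a * z - 1) / a = F - z"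
    if "a \<noteq> 0" "z \<noteq> 0" for a z F :: complex
    using that by (simp add: field_simps)
  from \<open>s \<noteq> 1\<close> show ?thesis
    using alg[of "s - 1" "zeta_series s" "dirichlet_series mangoldt s"] zeta_series_nonzero[OF s]
    by (simp add: dirichlet_series_diff[OF dirichlet_summable_mangoldt dirichlet_summable_one s]
          deriv_zeta_num[OF s] zeta_reg_def zeta_num_eq[OF s])
qed

text \<open>With \<open>X\<close>, \<open>Y\<close> as above, \<open>E\<close> is \<open>O(Y ^ 20 / X\<^sup>2)\<close> on a disc of radius \<open>q / Y ^ 20\<close>; by
  Cauchy's estimate \<open>E''\<close> is \<open>O(Y ^ 60 / X\<^sup>2)\<close>, and the exponent \<open>1/120\<close> is chosen such that
  \<open>Y ^ 60 = X powr (1/2)\<close>.\<close>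

lemma mangoldt_minus_one_transform_bounds:
  obtains E C where "C > 0" "E holomorphic_on {s. Re s > 1}"
    "\<And>s. Re s > 1 \<Longrightarrow> E s = dirichlet_series (\<lambda>n. mangoldt n - 1) s / (s * (s + 1))"
    "\<And>s k. 1 < Re s \<Longrightarrow> Re s \<le> 3/2 \<Longrightarrow> k \<le> 2 \<Longrightarrow>
       norm ((deriv ^^ k) E s) \<le> C * (1 + \<bar>Im s\<bar>) powr (-3/2)"
proof -
  obtain A where A: "A \<ge> 1"
    "\<And>s. 59/60 < Re s \<Longrightarrow> Re s \<le> 3 \<Longrightarrow> norm (zeta_reg s) \<le> A * (1 + \<bar>Im s\<bar>) powr (1/30)"
    using zeta_upper_bounds by metis
  obtain B where B: "B \<ge> 1"
    "\<And>s. 119/120 \<le> Re s \<Longrightarrow> Re s \<le> 2 \<Longrightarrow> norm (deriv zeta_num s) \<le> B * (1 + \<bar>Im s\<bar>) * (1 + \<bar>Im s\<bar>) powr (1/30)"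
    using deriv_zeta_num_bound by metis
  obtain c where c: "c > 0"
    "\<And>s. 1 < Re s \<Longrightarrow> Re s \<le> 2 \<Longrightarrow> norm (zeta_num s) \<ge> c * (1 + \<bar>Im s\<bar>) / ((1 + \<bar>Im s\<bar>) powr (1/120)) ^ 16"
    using zeta_num_lower_bound by metis
  \<comment> \<open>The continued expression is taken instead of the Dirichlet series, so that
    \<open>E\<close> makes sense on discs that cross the line.\<close>
  define E where "E = (\<lambda>s. (- deriv zeta_num s / zeta_num s - zeta_reg s) / (s * (s + 1)))"
  \<comment> \<open>1/240 keeps the discs inside the region where the derivative is bounded;
    \<open>c / (8 * B)\<close> makes \<open>zeta_num\<close> lose at most half of its lower bound on
    them.\<close>
  define q where "q = min (1/240) (c / (8 * B))"
  have q: "q > 0" "q \<le> 1/240" "4 * B * q \<le> c / 2"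
    using c(1) B(1) by (auto simp: q_def min_def field_simps)
  \<comment> \<open>\<open>8 * B / c\<close> bounds the logarithmic derivative and
    \<open>2 * A\<close> the regular part, both in units of \<open>Y ^ 20\<close>; 16 comes from
    \<open>X ^ 2 / 16 \<le> norm (w * (w + 1))\<close>.\<close>
  define M where "M = 16 * (8 * B / c + 2 * A)"
  have M: "M > 0" using A(1) B(1) c(1) by (auto simp: M_def intro!: add_pos_pos)
  define C where "C = 2 * M / q ^ 2"
  have "C > 0" using M q by (simp add: C_def)
  have holZ': "deriv zeta_num holomorphic_on {s. Re s > 59/60}"
    by (rule holomorphic_deriv[OF zeta_num_holomorphic open_halfspace_Re_gt])
  have holE: "E holomorphic_on S" if "S \<subseteq> {s. Re s > 59/60}" "\<And>s. s \<in> S \<Longrightarrow> zeta_num s \<noteq> 0" for S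
  proof -
    have nz: "s \<noteq> 0" "s + 1 \<noteq> 0" if "s \<in> S" for s
      using that \<open>S \<subseteq> _\<close> by (auto simp: complex_eq_iff)
    show ?thesis
      unfolding E_def
      using holomorphic_on_subset[OF zeta_num_holomorphic that(1)] holomorphic_on_subset[OF holZ' that(1)]
        holomorphic_on_subset[OF zeta_reg_holomorphic that(1)] that(2) nz
      by (intro holomorphic_on_divide holomorphic_on_diff holomorphic_on_minus holomorphic_on_mult
            holomorphic_on_add holomorphic_on_ident holomorphic_on_const) auto
  qed
  have bound: "norm ((deriv ^^ k) E s) \<le> C * (1 + \<bar>Im s\<bar>) powr (-3/2)"
    if s: "1 < Re s" "Re s \<le> 3/2" and k: "k \<le> 2" for s k
  proof -
    define X Y where "X = 1 + \<bar>Im s\<bar>" and "Y = X powr (1/120)"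
    have X: "X \<ge> 1" and Y: "Y \<ge> 1" by (auto simp: X_def Y_def ge_one_powr_ge_zero)
    have Y4: "X powr (1/30) = Y ^ 4" unfolding Y_def using X
      by (simp add: powr_powr flip: powr_realpow)
    have Y60: "Y ^ 60 / X ^ 2 = X powr (-3/2)"
    proof -
      have "Y ^ 60 = X powr (1/2)" unfolding Y_def using X by (simp add: powr_power)
      moreover have "X ^ 2 = X powr 2" using X by simp
      ultimately have "Y ^ 60 / X ^ 2 = X powr (1/2 - 2)" by (simp only: powr_diff)
      thus ?thesis by simp
    qed
    \<comment> \<open>The exponent is 4 + 16: over the distance \<open>r\<close> a derivative of
      size \<open>X * Y ^ 4\<close> changes \<open>zeta_num\<close> by a small multiple of
      \<open>X / Y ^ 16\<close>, the order of its lower bound.\<close>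
    define r where "r = q / Y ^ 20"
    have r: "r > 0" "r \<le> q"
      using q Y by (auto simp: r_def field_simps)
    have pw: "(2 * X) powr (1/30) \<le> 2 * Y ^ 4"
    proof -
      have "(2 * X) powr (1/30) = 2 powr (1/30) * Y ^ 4" using X by (simp add: powr_mult Y4)
      also have "\<dots> \<le> 2 powr 1 * Y ^ 4" using Y by (intro mult_right_mono powr_mono) auto
      finally show ?thesis by simp
    qed
    have sub: "119/120 \<le> Re w \<and> Re w \<le> 2 \<and> \<bar>Im w - Im s\<bar> \<le> 1/240" if "dist s w \<le> r" for w
    proof -
      have "norm (s - w) \<le> 1/240" using that r q by (simp add: dist_norm)
      hence "\<bar>Re s - Re w\<bar> \<le> 1/240" "\<bar>Im s - Im w\<bar> \<le> 1/240"
        using abs_Re_le_cmod[of "s - w"] abs_Im_le_cmod[of "s - w"] by auto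
      thus ?thesis using s by (intro conjI; linarith)
    qed
    have lin: "d \<le> 1/240 \<Longrightarrow> a - b \<le> d \<Longrightarrow> 0 \<le> b \<Longrightarrow> 1 + a \<le> 2 * (1 + b)" for a b d :: real
      by argo
    have Z': "norm (deriv zeta_num w) \<le> 4 * B * X * Y ^ 4" if "dist s w \<le> r" for w
    proof -
      note w = sub[OF that]
      have Xw: "1 + \<bar>Im w\<bar> \<le> 2 * X" unfolding X_def
        by (rule lin[OF conjunct2[OF conjunct2[OF w]] abs_triangle_ineq2 abs_ge_zero])
      have "norm (deriv zeta_num w) \<le> B * (1 + \<bar>Im w\<bar>) * (1 + \<bar>Im w\<bar>) powr (1/30)"
        using B(2) w by blast
      also have "\<dots> \<le> B * (2 * X) * (2 * X) powr (1/30)"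
        using Xw B(1) by (intro mult_mono powr_mono2) auto
      also have "\<dots> \<le> B * (2 * X) * (2 * Y ^ 4)"
        using pw B(1) X by (intro mult_left_mono) auto
      finally show ?thesis by (simp add: mult_ac)
    qed
    have Z: "norm (zeta_num w) \<ge> c / 2 * X / Y ^ 16" if w: "dist s w \<le> r" for w
    proof -
      have "norm (zeta_num w - zeta_num s) \<le> (4 * B * X * Y ^ 4) * norm (w - s)"
      proof (rule field_differentiable_bound[of "cball s r"])
        fix z assume z: "z \<in> cball s r"
        show "(zeta_num has_field_derivative deriv zeta_num z) (at z within cball s r)"
          by (rule has_field_derivative_at_within[OF holomorphic_derivI[OF zeta_num_holomorphic open_halfspace_Re_gt]])
             (use sub[of z] z in auto)
        show "norm (deriv zeta_num z) \<le> 4 * B * X * Y ^ 4" using Z'[of z] z by simp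
      qed (use w r in auto)
      also have "\<dots> \<le> (4 * B * X * Y ^ 4) * r"
        using w B(1) X Y by (intro mult_left_mono) (auto simp: dist_norm norm_minus_commute)
      also have "\<dots> = (4 * B * q) * (X / Y ^ 16)"
        using Y by (simp add: r_def field_simps eval_nat_numeral)
      also have "\<dots> \<le> c / 2 * (X / Y ^ 16)"
        using q X Y by (intro mult_right_mono) auto
      finally have 1: "norm (zeta_num w - zeta_num s) \<le> c / 2 * (X / Y ^ 16)" .
      have 2: "norm (zeta_num s) \<ge> c * X / Y ^ 16"
        using c(2)[of s] s by (simp add: X_def Y_def)
      have 3: "norm (zeta_num s) \<le> norm (zeta_num w) + norm (zeta_num w - zeta_num s)"
        using norm_triangle_ineq4[of "zeta_num w" "zeta_num w - zeta_num s"] by simp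
      define T where "T = c / 2 * (X / Y ^ 16)"
      have 4: "c * X / Y ^ 16 = 2 * T" "c / 2 * X / Y ^ 16 = T" by (simp_all add: T_def)
      show ?thesis using 1 2 3 unfolding 4 T_def [symmetric] by linarith
    qed
    have pos: "c / 2 * X / Y ^ 16 > 0" using c(1) X Y by simp
    have hol: "E holomorphic_on cball s r"
    proof (rule holE)
      show "cball s r \<subseteq> {s. 59 / 60 < Re s}" using sub by force
      show "zeta_num w \<noteq> 0" if "w \<in> cball s r" for w
        using Z[of w] pos that by auto
    qed
    have "norm ((deriv ^^ k) E s) \<le> fact k * (M * Y ^ 20 / X ^ 2) / r ^ k"
    proof (rule Cauchy_inequality)
      show "E holomorphic_on ball s r" by (rule holomorphic_on_subset[OF hol]) auto
      show "continuous_on (cball s r) E" by (rule holomorphic_on_imp_continuous_on[OF hol])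
      fix w assume "norm (s - w) = r"
      hence d: "dist s w \<le> r" by (simp add: dist_norm)
      note w = sub[OF d]
      have "norm (deriv zeta_num w / zeta_num w) \<le> (4 * B * X * Y ^ 4) / (c / 2 * X / Y ^ 16)"
        unfolding norm_divide using Z[OF d] Z'[OF d] pos B(1) X Y by (intro frac_le) auto
      also have "\<dots> = 8 * B / c * Y ^ 20"
        using c(1) X Y by (simp add: field_simps eval_nat_numeral)
      finally have 1: "norm (deriv zeta_num w / zeta_num w) \<le> 8 * B / c * Y ^ 20" .
      have Xw: "1 + \<bar>Im w\<bar> \<le> 2 * X" unfolding X_def
        by (rule lin[OF conjunct2[OF conjunct2[OF w]] abs_triangle_ineq2 abs_ge_zero])
      have "norm (zeta_reg w) \<le> A * (1 + \<bar>Im w\<bar>) powr (1/30)" using A(2)[of w] w by auto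
      also have "\<dots> \<le> A * (2 * X) powr (1/30)"
        using Xw A(1) by (intro mult_left_mono powr_mono2) auto
      also have "\<dots> \<le> A * (2 * Y ^ 4)" using pw A(1) by (intro mult_left_mono) auto
      also have "\<dots> \<le> A * (2 * Y ^ 20)"
        using A(1) Y by (intro mult_left_mono power_increasing) auto
      finally have 2: "norm (zeta_reg w) \<le> 2 * A * Y ^ 20" by simp
      have "X \<le> \<bar>Re w\<bar> + \<bar>Im w\<bar> + \<bar>Re w\<bar> + \<bar>Im w\<bar>" "X \<le> \<bar>Re (w+1)\<bar> + \<bar>Im w\<bar> + \<bar>Re (w+1)\<bar> + \<bar>Im w\<bar>"
        using w unfolding X_def by (auto simp: abs_le_iff abs_if split: if_splits)
      hence "X / 4 \<le> norm w" "X / 4 \<le> norm (w + 1)"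
        using abs_Re_le_cmod[of w] abs_Im_le_cmod[of w] abs_Re_le_cmod[of "w + 1"] abs_Im_le_cmod[of "w + 1"]
        by auto
      hence "X / 4 * (X / 4) \<le> norm w * norm (w + 1)" using X by (intro mult_mono) auto
      hence 3: "X ^ 2 / 16 \<le> norm (w * (w + 1))" by (simp add: norm_mult power2_eq_square)
      have "norm (- deriv zeta_num w / zeta_num w - zeta_reg w) \<le> 8 * B / c * Y ^ 20 + 2 * A * Y ^ 20"
        using norm_triangle_ineq4[of "- deriv zeta_num w / zeta_num w" "zeta_reg w"] 1 2 by simp
      hence "norm (E w) \<le> (8 * B / c * Y ^ 20 + 2 * A * Y ^ 20) / (X ^ 2 / 16)"
        unfolding E_def norm_divide[of _ "w * (w + 1)"]
        by (rule frac_le[OF _ _ _ 3, rotated]) (use X A(1) B(1) c(1) Y in \<open>auto intro!: add_nonneg_nonneg\<close>)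
      thus "norm (E w) \<le> M * Y ^ 20 / X ^ 2" by (simp add: M_def algebra_simps)
    qed (use r in auto)
    \<comment> \<open>As \<open>r \<le> 1\<close>, the worst case is \<open>k = 2\<close>; two
      divisions by \<open>r\<close> raise \<open>Y ^ 20\<close> to \<open>Y ^ 60\<close>.\<close>
    also have "\<dots> \<le> 2 * (M * Y ^ 20 / X ^ 2) / r ^ 2"
    proof (intro frac_le mult_right_mono)
      have "fact k \<le> (fact 2 :: real)" by (rule fact_mono[OF k])
      thus "fact k \<le> (2::real)" by simp
      show "r ^ 2 \<le> r ^ k" using k r q by (intro power_decreasing) auto
    qed (use M r X Y in auto)
    also have "\<dots> = 2 * M / q ^ 2 * (Y ^ 60 / X ^ 2)"
      using Y q by (simp add: r_def power_divide field_simps flip: power_mult power_add)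
    finally show ?thesis unfolding Y60 C_def [symmetric] by (simp add: X_def)
  qed
  show ?thesis
  proof (rule that[of C E])
    show "E holomorphic_on {s. Re s > 1}"
      by (rule holE) (auto simp: zeta_num_nonzero)
    show "E s = dirichlet_series (\<lambda>n. mangoldt n - 1) s / (s * (s + 1))" if "Re s > 1" for s
      by (simp add: E_def mangoldt_minus_one_series[OF that])
  qed (use \<open>C > 0\<close> bound in auto)
qed

section \<open>Perron's formula\<close>

lemma integrable_one_plus_abs_powr: "integrable lborel (\<lambda>t::real. (1 + \<bar>t\<bar>) powr (-3/2))"
proof -
  define f where "f = (\<lambda>t::real. (1 + \<bar>t\<bar>) powr (-3/2) * indicator {0..} t)"
  have "(\<integral>\<^sup>+x. ennreal ((1 + \<bar>x\<bar>) powr (-3/2)) * indicator {0..} x \<partial>lborel) = ennreal (0 - (-2 * (1 + 0) powr (-1/2)))"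
  proof (rule nn_integral_FTC_atLeast[where F = "\<lambda>x::real. -2 * (1 + x) powr (-1/2)"])
    show "((\<lambda>x::real. -2 * (1 + x) powr (-1/2)) has_real_derivative (1 + \<bar>x\<bar>) powr (-3/2)) (at x)"
      if "0 \<le> x" for x
      using that by (auto intro!: derivative_eq_intros)
    show "((\<lambda>x::real. -2 * (1 + x) powr (-1/2)) \<longlongrightarrow> 0) at_top" by real_asymp
  qed auto
  hence "(\<integral>\<^sup>+x. ennreal (f x) \<partial>lborel) < \<infinity>"
    by (simp add: f_def ennreal_mult' ennreal_indicator)
  hence f: "integrable lborel f"
    by (intro integrableI_nonneg) (auto simp: f_def)
  \<comment> \<open>Half-line plus reflection covers the whole line. The origin is counted twice, so
    the sum serves as a majorant and not as an equal.\<close>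
  have "integrable lborel (\<lambda>x. f x + f (0 + (-1) * x))"
    by (intro Bochner_Integration.integrable_add f lborel_integrable_real_affine) auto
  thus ?thesis
    by (rule Bochner_Integration.integrable_bound) (auto simp: f_def indicator_def)
qed

text \<open>A bridge between two integrals: contour integration and the fundamental theorem give
  gauge integrals over bounded intervals, whereas exchanging sum and integral takes place in the
  Lebesgue integral over the line. Dominated convergence identifies them.\<close>

lemma lborel_integral_eq_limit:
  fixes f :: "real \<Rightarrow> complex"
  assumes f: "integrable lborel f" and L: "(\<lambda>n. integral {-real n..real n} f) \<longlonglongrightarrow> L"
  shows "integral\<^sup>L lborel f = L"
proof -
  have "(\<lambda>n. \<integral>x. indicator {-real n..real n} x *\<^sub>R f x \<partial>lborel) \<longlonglongrightarrow> integral\<^sup>L lborel f"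
  proof (rule integral_dominated_convergence[where w = "\<lambda>x. norm (f x)"])
    show "AE x in lborel. (\<lambda>n. indicator {-real n..real n} x *\<^sub>R f x) \<longlonglongrightarrow> f x"
    proof (rule AE_I2)
      fix x :: real
      have "\<forall>\<^sub>F n in sequentially. real n \<ge> \<bar>x\<bar>"
        using filterlim_real_sequentially by (simp add: filterlim_at_top)
      hence "\<forall>\<^sub>F n in sequentially. indicator {-real n..real n} x *\<^sub>R f x = f x"
        by eventually_elim (auto simp: indicator_def)
      thus "(\<lambda>n. indicator {-real n..real n} x *\<^sub>R f x) \<longlonglongrightarrow> f x"
        by (rule tendsto_eventually)
    qed
  qed (use f in \<open>auto simp: indicator_def\<close>)
  also have "(\<lambda>n. \<integral>x. indicator {-real n..real n} x *\<^sub>R f x \<partial>lborel) = (\<lambda>n. integral {-real n..real n} f)"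
  proof
    fix n
    have "set_integrable lborel {-real n..real n} f"
      unfolding set_integrable_def by (rule integrable_mult_indicator[OF _ f]) auto
    from set_borel_integral_eq_integral(2)[OF this]
    show "(\<integral>x. indicator {-real n..real n} x *\<^sub>R f x \<partial>lborel) = integral {-real n..real n} f"
      by (simp add: set_lebesgue_integral_def)
  qed
  finally show ?thesis using L by (rule LIMSEQ_unique)
qed

lemma norm_shifted_line_ge:
  assumes "\<sigma> \<ge> 1"
  shows "norm (Complex \<sigma> t) \<ge> (1 + \<bar>t\<bar>) / 2" "norm (Complex \<sigma> t * (Complex \<sigma> t + 1)) \<ge> (1 + \<bar>t\<bar>)\<^sup>2 / 4"
proof -
  show 1: "norm (Complex \<sigma> t) \<ge> (1 + \<bar>t\<bar>) / 2"
    using abs_Re_le_cmod[of "Complex \<sigma> t"] abs_Im_le_cmod[of "Complex \<sigma> t"] assms by simp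
  have 2: "norm (Complex \<sigma> t + 1) \<ge> (1 + \<bar>t\<bar>) / 2"
    using abs_Re_le_cmod[of "Complex \<sigma> t + 1"] abs_Im_le_cmod[of "Complex \<sigma> t + 1"] assms by simp
  show "norm (Complex \<sigma> t * (Complex \<sigma> t + 1)) \<ge> (1 + \<bar>t\<bar>)\<^sup>2 / 4"
    using mult_mono[OF 1 2] by (simp add: norm_mult power2_eq_square)
qed

text \<open>With \<open>v = ln (x / n)\<close> this is
  \<open>(x / n) powr s / (s * (s + 1))\<close>, the kernel of Perron's formula with linear weights.
  Its quadratic decay makes all integrals along vertical lines absolutely convergent.\<close>

definition perron_kernel :: "real \<Rightarrow> complex \<Rightarrow> complex" where
  "perron_kernel v s = exp (of_real v * s) / (s * (s + 1))"

lemma norm_perron_kernel_le: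
  assumes "\<sigma> \<ge> 1"
  shows "norm (perron_kernel v (Complex \<sigma> t)) \<le> 4 * exp (v * \<sigma>) * (1 + \<bar>t\<bar>) powr (-3/2)"
proof -
  define X where "X = 1 + \<bar>t\<bar>"
  have X: "X \<ge> 1" by (simp add: X_def)
  have "norm (perron_kernel v (Complex \<sigma> t)) \<le> exp (v * \<sigma>) / (X\<^sup>2 / 4)"
    unfolding perron_kernel_def norm_divide using norm_shifted_line_ge(2)[OF assms, of t] X
    by (intro frac_le) (auto simp: X_def)
  also have "\<dots> = 4 * exp (v * \<sigma>) * X powr (-2)"
    using X by (simp add: powr_minus field_simps)
  also have "\<dots> \<le> 4 * exp (v * \<sigma>) * X powr (-3/2)"
    using X by (intro mult_left_mono powr_mono) auto
  finally show ?thesis by (simp add: X_def)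
qed

lemma line_nonzero: "\<sigma> > 0 \<Longrightarrow> Complex \<sigma> t \<noteq> 0" "\<sigma> > 0 \<Longrightarrow> Complex \<sigma> t + 1 \<noteq> 0"
  by (auto simp: complex_eq_iff)

lemma Complex_line: "Complex \<sigma> t = of_real \<sigma> + \<i> * of_real t"
  by (simp add: complex_eq_iff)

lemma perron_kernel_integrable:
  assumes "\<sigma> \<ge> 1"
  shows "integrable lborel (\<lambda>t. perron_kernel v (Complex \<sigma> t))"
proof (rule Bochner_Integration.integrable_bound)
  show "integrable lborel (\<lambda>t. 4 * exp (v * \<sigma>) * (1 + \<bar>t\<bar>) powr (-3/2))"
    by (intro integrable_mult_right integrable_one_plus_abs_powr)
  have "continuous_on UNIV (\<lambda>t. perron_kernel v (Complex \<sigma> t))"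
    unfolding perron_kernel_def
    using line_nonzero[of \<sigma>] assms unfolding Complex_line by (intro continuous_intros) auto
  thus "(\<lambda>t. perron_kernel v (Complex \<sigma> t)) \<in> borel_measurable lborel"
    by (simp add: borel_measurable_continuous_onI)
qed (use norm_perron_kernel_le[OF assms] in auto)

text \<open>In terms of the angle this is additivity of the integral over intervals; it lets a full
  circle be cut into quarter and half arcs.\<close>

lemma contour_integral_part_circlepath_split:
  assumes "a < m" "m < b" "r \<ge> 0" and cont: "continuous_on (sphere z r) f"
  shows "contour_integral (part_circlepath z r a b) f =
           contour_integral (part_circlepath z r a m) f + contour_integral (part_circlepath z r m b) f"
proof -
  have int: "f contour_integrable_on part_circlepath z r c d" for c d
    by (rule contour_integrable_continuous_part_circlepath[OF continuous_on_subset[OF cont]])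
       (rule path_image_part_circlepath_subset'[OF assms(3)])
  let ?g = "\<lambda>t. f (z + r * cis t) * r * \<i> * cis t"
  have "(?g has_integral contour_integral (part_circlepath z r c d) f) {c..d}" if "c < d" for c d
    using has_contour_integral_integral[OF int, of c d] that
    by (simp add: has_contour_integral_part_circlepath_iff)
  hence "(?g has_integral (contour_integral (part_circlepath z r a m) f + contour_integral (part_circlepath z r m b) f)) {a..b}"
    using assms by (intro has_integral_combine[of a m b]) auto
  hence "(f has_contour_integral (contour_integral (part_circlepath z r a m) f + contour_integral (part_circlepath z r m b) f))
      (part_circlepath z r a b)"
    using assms by (simp add: has_contour_integral_part_circlepath_iff)
  thus ?thesis by (rule contour_integral_unique)
qed

text \<open>The vertical segment is closed up by a half circle about \<open>\<sigma>\<close>: to the right for \<open>v < 0\<close>,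
  to the left for \<open>v \<ge> 0\<close>. In the latter case segment and left arc together amount to the full circle,
  since the segment can be replaced by the right arc.\<close>

lemma perron_segment:
  assumes \<sigma>: "\<sigma> \<ge> 1" and R: "R > \<sigma> + 1"
  shows "norm (integral {-R..R} (\<lambda>t. perron_kernel v (Complex \<sigma> t)) - 2 * pi * of_real (if v \<ge> 0 then 1 - exp (-v) else 0))
     \<le> exp (v * \<sigma>) * pi * R / ((R - \<sigma>) * (R - \<sigma> - 1))"
proof -
  define f where "f = perron_kernel v"
  define seg where "seg = linepath (Complex \<sigma> (-R)) (Complex \<sigma> R)"
  define arcR where "arcR = part_circlepath (of_real \<sigma>) R (-(pi/2)) (pi/2)"
  define arcL where "arcL = part_circlepath (of_real \<sigma>) R (pi/2) (3*pi/2)"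
  have R0: "R > 0" using \<sigma> R by simp
  have hol: "f holomorphic_on S" if "0 \<notin> S" "-1 \<notin> S" for S
  proof -
    have "s \<noteq> 0" "s + 1 \<noteq> 0" if "s \<in> S" for s
      using that \<open>0 \<notin> S\<close> \<open>-1 \<notin> S\<close> by (auto simp flip: eq_neg_iff_add_eq_0)
    thus ?thesis unfolding f_def perron_kernel_def by (intro holomorphic_intros) auto
  qed
  have ends: "pathstart seg = Complex \<sigma> (-R)" "pathfinish seg = Complex \<sigma> R"
     "pathstart arcR = Complex \<sigma> (-R)" "pathfinish arcR = Complex \<sigma> R"
    by (auto simp: seg_def arcR_def exp_eq_polar cis_conv_exp [symmetric] complex_eq_iff)
  have Re_arcR: "Re z \<ge> \<sigma>" if "z \<in> path_image arcR" for z
  proof -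
    from that obtain x where x: "x \<in> closed_segment (-(pi/2)) (pi/2)" "z = of_real \<sigma> + R * cis x"
      by (auto simp: arcR_def path_image_part_circlepath')
    hence "cos x \<ge> 0" by (intro cos_ge_zero) (auto simp: closed_segment_eq_real_ivl split: if_splits)
    thus ?thesis using x R0 by simp
  qed
  have Re_arcL: "Re z \<le> \<sigma>" if "z \<in> path_image arcL" for z
  proof -
    from that obtain x where x: "x \<in> closed_segment (pi/2) (3*pi/2)" "z = of_real \<sigma> + R * cis x"
      by (auto simp: arcL_def path_image_part_circlepath')
    hence "cos (x - pi) \<ge> 0" by (intro cos_ge_zero) (auto simp: closed_segment_eq_real_ivl split: if_splits)
    hence "cos x \<le> 0" by (simp add: cos_diff)
    thus ?thesis using x R0 by (simp add: mult_nonneg_nonpos)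
  qed
  have norm_arc: "norm (z - of_real \<sigma>) = R" if "z \<in> path_image arcR \<union> path_image arcL" for z
    using that R0 by (auto simp: arcR_def arcL_def dest!: in_path_image_part_circlepath)
  have norm_ge: "norm z \<ge> R - \<sigma>" "norm (z + 1) \<ge> R - \<sigma> - 1" if "z \<in> path_image arcR \<union> path_image arcL" for z
  proof -
    show 1: "norm z \<ge> R - \<sigma>"
      using norm_arc[OF that] norm_triangle_ineq4[of z "of_real \<sigma>"] \<sigma> by simp
    show "norm (z + 1) \<ge> R - \<sigma> - 1"
      using 1 norm_triangle_ineq4[of "z + 1" 1] by simp
  qed
  define B where "B = exp (v * \<sigma>) / ((R - \<sigma>) * (R - \<sigma> - 1))"
  have B0: "B \<ge> 0" using R by (simp add: B_def)
  have f_le: "norm (f z) \<le> B" if "z \<in> path_image arcR \<union> path_image arcL" "v * Re z \<le> v * \<sigma>" for z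
    unfolding f_def perron_kernel_def norm_divide norm_mult B_def
    using norm_ge[OF that(1)] that(2) R by (intro frac_le mult_mono) auto
  have nR: "0 \<notin> path_image arcR" "-1 \<notin> path_image arcR" using Re_arcR[of 0] Re_arcR[of "-1"] \<sigma> by auto
  have nL: "0 \<notin> path_image arcL" "-1 \<notin> path_image arcL" using norm_ge[of 0] norm_ge[of "-1"] R by auto
  have intR: "f contour_integrable_on arcR" unfolding arcR_def
    by (rule contour_integrable_continuous_part_circlepath[OF holomorphic_on_imp_continuous_on[OF hol]])
       (use nR in \<open>auto simp: arcR_def\<close>)
  have intL: "f contour_integrable_on arcL" unfolding arcL_def
    by (rule contour_integrable_continuous_part_circlepath[OF holomorphic_on_imp_continuous_on[OF hol]])
       (use nL in \<open>auto simp: arcL_def\<close>)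
  have seg_sub: "path_image seg \<subseteq> {z. Re z > 0}"
    unfolding seg_def path_image_linepath
    by (rule closed_segment_subset) (use \<sigma> in \<open>auto simp: convex_halfspace_Re_gt\<close>)
  have intS: "f contour_integrable_on seg" unfolding seg_def
    by (rule contour_integrable_continuous_linepath[OF holomorphic_on_imp_continuous_on[OF hol]])
       (use seg_sub in \<open>auto simp: seg_def\<close>)
  have vp: "valid_path seg" "valid_path arcR" "valid_path arcL" by (auto simp: seg_def arcR_def arcL_def)
  have "(f has_contour_integral 0) (seg +++ reversepath arcR)"
  proof (rule Cauchy_theorem_convex_simple)
    show "f holomorphic_on {z. Re z > 0}" by (rule hol) auto
    show "convex {z::complex. Re z > 0}" by (rule convex_halfspace_Re_gt)
    show "path_image (seg +++ reversepath arcR) \<subseteq> {z. Re z > 0}"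
      using seg_sub Re_arcR \<sigma> ends by (subst path_image_join) force+
  qed (use vp ends in \<open>auto intro!: valid_path_join\<close>)
  hence "contour_integral (seg +++ reversepath arcR) f = 0" by (rule contour_integral_unique)
  hence eq: "contour_integral seg f = contour_integral arcR f"
    using intS intR vp
    by (subst (asm) contour_integral_join) (auto simp: contour_integrable_reversepath contour_integral_reversepath)
  have seg_int: "contour_integral seg f = \<i> * integral {-R..R} (\<lambda>t. f (Complex \<sigma> t))"
    unfolding seg_def by (rule contour_integral_linepath_same_Re) (use R0 in auto)
  define J where "J = integral {-R..R} (\<lambda>t. f (Complex \<sigma> t))"
  have "norm (J - 2 * pi * of_real (if v \<ge> 0 then 1 - exp (-v) else 0)) \<le> B * R * pi"
  proof (cases "v \<ge> 0")
    case False
    have "norm (contour_integral arcR f) \<le> B * R * \<bar>pi/2 - (-(pi/2))\<bar>"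
      unfolding arcR_def
    proof (rule contour_integral_bound_part_circlepath)
      fix z assume "z \<in> path_image (part_circlepath (complex_of_real \<sigma>) R (- (pi / 2)) (pi / 2))"
      hence z: "z \<in> path_image arcR" by (simp add: arcR_def)
      show "norm (f z) \<le> B" using False Re_arcR[OF z] z by (intro f_le) (auto intro: mult_left_mono_neg)
    qed (use intR B0 R0 in \<open>auto simp: arcR_def\<close>)
    moreover have "norm J = norm (contour_integral arcR f)"
      using eq seg_int by (simp add: J_def norm_mult flip: eq)
    ultimately show ?thesis using False by simp
  next
    case True
    have circ: "contour_integral (circlepath (of_real \<sigma>) R) f = contour_integral arcR f + contour_integral arcL f"
    proof -
      have cont: "continuous_on (sphere (of_real \<sigma>) R) f"
      proof (rule holomorphic_on_imp_continuous_on[OF hol])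
        have "norm (complex_of_real \<sigma> + 1) = \<sigma> + 1"
          using \<sigma> norm_of_real[of "\<sigma> + 1", where 'a = complex] by simp
        thus "-1 \<notin> sphere (complex_of_real \<sigma>) R" "0 \<notin> sphere (complex_of_real \<sigma>) R"
          using R \<sigma> by (auto simp: dist_norm)
      qed
      note split = contour_integral_part_circlepath_split[OF _ _ _ cont]
      \<comment> \<open>The full circle starts at angle 0 but the right arc at
        \<open>-(pi/2)\<close>; by periodicity the last quarter of the circle is the first half of
        that arc.\<close>
      have "part_circlepath (of_real \<sigma>) R (3*pi/2) (2*pi) = part_circlepath (of_real \<sigma>) R (-(pi/2)) 0"
      proof
        fix x
        have "linepath (3*pi/2) (2*pi) x = linepath (-(pi/2)) 0 x + 2 * pi"
          by (simp add: linepath_def field_simps)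
        hence "cis (linepath (3*pi/2) (2*pi) x) = cis (linepath (-(pi/2)) 0 x)"
          by (simp add: complex_eq_iff)
        thus "part_circlepath (of_real \<sigma>) R (3*pi/2) (2*pi) x = part_circlepath (of_real \<sigma>) R (-(pi/2)) 0 x"
          by (simp add: part_circlepath_def cis_conv_exp)
      qed
      thus ?thesis
        using split[of 0 "3*pi/2" "2*pi"] split[of 0 "pi/2" "3*pi/2"] split[of "-(pi/2)" 0 "pi/2"] R0
        by (simp add: circlepath_def arcR_def arcL_def)
    qed
    \<comment> \<open>Partial fractions \<open>1 / s - 1 / (s + 1)\<close>: the poles 0 and -1 lie
      inside the circle, since \<open>R > \<sigma> + 1\<close>, and contribute \<open>1\<close> and
      \<open>- exp (-v)\<close>.\<close>
    have h1: "((\<lambda>s. exp (of_real v * s) / (s - 0)) has_contour_integral (2 * of_real pi * \<i> * exp (of_real v * 0))) (circlepath (of_real \<sigma>) R)"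
      by (rule Cauchy_integral_circlepath_simple) (use \<sigma> R in \<open>auto intro!: holomorphic_intros\<close>)
    have h2: "((\<lambda>s. exp (of_real v * s) / (s - (-1))) has_contour_integral (2 * of_real pi * \<i> * exp (of_real v * (-1)))) (circlepath (of_real \<sigma>) R)"
    proof (rule Cauchy_integral_circlepath_simple)
      have "norm (- 1 - complex_of_real \<sigma>) = \<sigma> + 1"
        using \<sigma> by (metis abs_of_nonneg add.commute add_nonneg_nonneg diff_minus_eq_add minus_add_distrib norm_minus_cancel norm_of_real of_real_1 of_real_add uminus_add_conv_diff zero_le_one order_trans)
      thus "norm (- 1 - complex_of_real \<sigma>) < R" using R by simp
    qed (auto intro!: holomorphic_intros)
    have "((\<lambda>s. exp (of_real v * s) / (s - 0) - exp (of_real v * s) / (s - (-1))) has_contour_integral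
       (2 * of_real pi * \<i> * exp (of_real v * 0) - 2 * of_real pi * \<i> * exp (of_real v * (-1)))) (circlepath (of_real \<sigma>) R)"
      by (rule has_contour_integral_diff[OF h1 h2])
    hence "(f has_contour_integral
       (2 * of_real pi * \<i> * exp (of_real v * 0) - 2 * of_real pi * \<i> * exp (of_real v * (-1)))) (circlepath (of_real \<sigma>) R)"
    proof (rule has_contour_integral_eq)
      fix s assume "s \<in> path_image (circlepath (of_real \<sigma>) R)"
      hence n: "norm (s - of_real \<sigma>) = R" using R0 by (simp add: dist_norm norm_minus_commute)
      have "s \<noteq> 0" using n R \<sigma> by auto
      moreover have "s + 1 \<noteq> 0"
      proof
        assume "s + 1 = 0"
        hence "s = -1" by (simp only: eq_neg_iff_add_eq_0)
        hence "norm (s - of_real \<sigma>) \<le> 1 + \<sigma>" using norm_triangle_ineq4[of s "of_real \<sigma>"] \<sigma> by simp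
        thus False using n R by simp
      qed
      ultimately show "exp (of_real v * s) / (s - 0) - exp (of_real v * s) / (s - (-1)) = f s"
        by (simp add: f_def perron_kernel_def field_simps)
    qed
    hence "contour_integral arcR f + contour_integral arcL f = 2 * of_real pi * \<i> * (1 - of_real (exp (-v)))"
      unfolding circ [symmetric] using exp_of_real[of "-v", where 'a = complex]
      by (simp add: contour_integral_unique algebra_simps)
    hence "\<i> * J - 2 * of_real pi * \<i> * (1 - of_real (exp (-v))) = - contour_integral arcL f"
      using eq seg_int unfolding J_def by (simp add: algebra_simps)
    hence "\<i> * (J - 2 * of_real pi * (1 - of_real (exp (-v)))) = - contour_integral arcL f"
      by (simp add: algebra_simps)
    hence "norm (J - 2 * of_real pi * (1 - of_real (exp (-v)))) = norm (contour_integral arcL f)"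
      by (metis mult_1 norm_ii norm_minus_cancel norm_mult)
    also have "\<dots> \<le> B * R * \<bar>3*pi/2 - pi/2\<bar>"
      unfolding arcL_def
    proof (rule contour_integral_bound_part_circlepath)
      fix z assume "z \<in> path_image (part_circlepath (complex_of_real \<sigma>) R (pi / 2) (3*pi / 2))"
      hence z: "z \<in> path_image arcL" by (simp add: arcL_def)
      show "norm (f z) \<le> B" using True Re_arcL[OF z] z by (intro f_le) (auto intro: mult_left_mono)
    qed (use intL B0 R0 in \<open>auto simp: arcL_def\<close>)
    finally show ?thesis using True by simp
  qed
  thus ?thesis unfolding J_def f_def B_def by (simp add: mult_ac)
qed

text \<open>The contribution of the closing arc is \<open>O(1 / R)\<close> and disappears as the
  segment grows.\<close>

lemma perron_integral:
  assumes \<sigma>: "\<sigma> \<ge> 1"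
  shows "(\<integral>t. perron_kernel v (Complex \<sigma> t) \<partial>lborel) = 2 * pi * of_real (if v \<ge> 0 then 1 - exp (-v) else 0)"
proof (rule lborel_integral_eq_limit[OF perron_kernel_integrable[OF \<sigma>]])
  let ?I = "\<lambda>n. integral {-real n..real n} (\<lambda>t. perron_kernel v (Complex \<sigma> t))"
  let ?L = "2 * pi * of_real (if v \<ge> 0 then 1 - exp (-v) else 0) :: complex"
  have "(\<lambda>n. ?I n - ?L) \<longlonglongrightarrow> 0"
  proof (rule Lim_null_comparison)
    have "\<forall>\<^sub>F n in sequentially. real n > \<sigma> + 1"
      using filterlim_real_sequentially by (simp add: filterlim_at_top_dense)
    thus "\<forall>\<^sub>F n in sequentially. norm (?I n - ?L) \<le> exp (v * \<sigma>) * pi * real n / ((real n - \<sigma>) * (real n - \<sigma> - 1))"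
      by eventually_elim (rule perron_segment[OF \<sigma>])
    show "(\<lambda>n. exp (v * \<sigma>) * pi * real n / ((real n - \<sigma>) * (real n - \<sigma> - 1))) \<longlonglongrightarrow> 0"
      by real_asymp
  qed
  thus "?I \<longlonglongrightarrow> ?L" by (simp only: LIM_zero_iff)
qed

lemma finite_nat_le_real: "finite {n::nat. 0 < n \<and> real n \<le> x}"
  by (rule finite_subset[of _ "{..nat \<lfloor>x\<rfloor>}"]) (auto simp: le_nat_floor)

lemma perron_kernel_diff_ln:
  assumes "n > 0"
  shows "perron_kernel (v - ln (real n)) s = of_nat n powr (-s) * (exp (of_real v * s) / (s * (s + 1)))"
  using assms by (simp add: perron_kernel_def powr_def Ln_of_nat algebra_simps exp_diff exp_minus divide_simps)

text \<open>Integrate term by term with the kernel at \<open>v - ln n\<close>; absolute convergence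
  at \<open>\<sigma> > 1\<close> permits the exchange. Terms with \<open>n > exp v\<close> have a
  negative argument and integrate to 0, which truncates the series.\<close>

lemma perron_sum:
  fixes a :: "nat \<Rightarrow> complex"
  assumes a: "dirichlet_summable a" and \<sigma>: "\<sigma> > 1"
  shows "(\<integral>t. exp (of_real v * Complex \<sigma> t) * (dirichlet_series a (Complex \<sigma> t) / (Complex \<sigma> t * (Complex \<sigma> t + 1))) \<partial>lborel)
     = 2 * of_real pi * (\<Sum>n | 0 < n \<and> real n \<le> exp v. a n * of_real (1 - real n * exp (-v)))"
proof -
  \<comment> \<open>At index 0 the value \<open>ln 0\<close> would be a mere default, so the term is
    set to 0; this agrees with \<open>0 powr (-s) = 0\<close> in the series.\<close>
  define f where "f = (\<lambda>n t. (if n = 0 then 0 else a n * perron_kernel (v - ln (real n)) (Complex \<sigma> t)))"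
  have f_eq: "f n t = a n * of_nat n powr (-Complex \<sigma> t) * (exp (of_real v * Complex \<sigma> t) / (Complex \<sigma> t * (Complex \<sigma> t + 1)))" for n t
    by (simp add: f_def perron_kernel_diff_ln)
  have int: "integrable lborel (f n)" for n
    unfolding f_def using perron_kernel_integrable[of \<sigma>] \<sigma> by (cases "n = 0") auto
  define I where "I = (\<integral>t. (1 + \<bar>t::real\<bar>) powr (-3/2) \<partial>lborel)"
  have norm_int: "(\<integral>t. norm (f n t) \<partial>lborel) \<le> 4 * exp (v * \<sigma>) * I * (norm (a n) * real n powr (-\<sigma>))" for n
  proof (cases "n = 0")
    case False
    have "(\<integral>t. norm (f n t) \<partial>lborel) \<le> (\<integral>t. norm (a n) * (4 * exp ((v - ln (real n)) * \<sigma>)) * (1 + \<bar>t::real\<bar>) powr (-3/2) \<partial>lborel)"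
    proof (rule integral_mono)
      show "integrable lborel (\<lambda>t. norm (f n t))" by (rule integrable_norm[OF int])
      show "integrable lborel (\<lambda>t. norm (a n) * (4 * exp ((v - ln (real n)) * \<sigma>)) * (1 + \<bar>t::real\<bar>) powr (-3/2))"
        by (intro integrable_mult_right integrable_one_plus_abs_powr)
      fix t :: real
      show "norm (f n t) \<le> norm (a n) * (4 * exp ((v - ln (real n)) * \<sigma>)) * (1 + \<bar>t\<bar>) powr (-3/2)"
        using mult_left_mono[OF norm_perron_kernel_le[of \<sigma> "v - ln (real n)" t], of "norm (a n)"] \<sigma> False
        by (simp add: f_def norm_mult mult_ac)
    qed
    also have "exp ((v - ln (real n)) * \<sigma>) = exp (v * \<sigma>) * real n powr (-\<sigma>)"
      using False by (simp add: powr_def algebra_simps exp_diff exp_minus divide_simps)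
    finally show ?thesis by (simp add: I_def mult_ac)
  qed (simp add: f_def)
  have sm: "summable (\<lambda>n. norm (a n) * real n powr (-\<sigma>))"
    by (rule dirichlet_summableD[OF a \<sigma>])
  have "(\<integral>t. (\<Sum>n. f n t) \<partial>lborel) = (\<Sum>n. integral\<^sup>L lborel (f n))"
  proof (rule integral_suminf[OF int])
    show "AE t in lborel. summable (\<lambda>n. norm (f n t))"
    proof (rule AE_I2)
      fix t :: real
      have "summable (\<lambda>n. norm (a n * of_nat n powr (-Complex \<sigma> t)) * norm (exp (of_real v * Complex \<sigma> t) / (Complex \<sigma> t * (Complex \<sigma> t + 1))))"
        by (intro summable_mult2 dirichlet_summable_norm[OF a]) (use \<sigma> in auto)
      thus "summable (\<lambda>n. norm (f n t))" unfolding f_eq norm_mult .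
    qed
    show "summable (\<lambda>n. \<integral>t. norm (f n t) \<partial>lborel)"
      by (rule summable_comparison_test'[OF summable_mult[OF sm, of "4 * exp (v * \<sigma>) * I"], of 0])
         (use norm_int in \<open>auto simp: Bochner_Integration.integral_nonneg\<close>)
  qed
  also have "(\<lambda>t. \<Sum>n. f n t) = (\<lambda>t. exp (of_real v * Complex \<sigma> t) * (dirichlet_series a (Complex \<sigma> t) / (Complex \<sigma> t * (Complex \<sigma> t + 1))))"
  proof
    fix t
    have "(\<lambda>n. f n t) sums (dirichlet_series a (Complex \<sigma> t) * (exp (of_real v * Complex \<sigma> t) / (Complex \<sigma> t * (Complex \<sigma> t + 1))))"
      unfolding f_eq by (intro sums_mult2 dirichlet_series_sums a) (use \<sigma> in auto)
    thus "(\<Sum>n. f n t) = exp (of_real v * Complex \<sigma> t) * (dirichlet_series a (Complex \<sigma> t) / (Complex \<sigma> t * (Complex \<sigma> t + 1)))"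
      by (simp add: sums_iff)
  qed
  also have "(\<Sum>n. integral\<^sup>L lborel (f n)) = (\<Sum>n | 0 < n \<and> real n \<le> exp v. integral\<^sup>L lborel (f n))"
  proof (rule suminf_finite[OF finite_nat_le_real])
    fix n assume n: "n \<notin> {n. 0 < n \<and> real n \<le> exp v}"
    show "integral\<^sup>L lborel (f n) = 0"
    proof (cases "n = 0")
      case False
      with n have "ln (real n) > v" using exp_le_cancel_iff[of "ln (real n)" v] by (auto simp: not_le)
      thus ?thesis using False \<sigma> by (simp add: f_def perron_integral)
    qed (simp add: f_def)
  qed
  also have "\<dots> = (\<Sum>n | 0 < n \<and> real n \<le> exp v. 2 * of_real pi * (a n * of_real (1 - real n * exp (-v))))"
  proof (rule sum.cong[OF refl])
    fix n assume n: "n \<in> {n. 0 < n \<and> real n \<le> exp v}"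
    hence "ln (real n) \<le> v" using ln_le_cancel_iff[of "real n" "exp v"] by simp
    moreover have "exp (-(v - ln (real n))) = real n * exp (-v)"
      using n by (simp add: exp_diff exp_minus field_simps)
    ultimately show "integral\<^sup>L lborel (f n) = 2 * of_real pi * (a n * of_real (1 - real n * exp (-v)))"
      using n \<sigma> by (simp add: f_def perron_integral)
  qed
  also have "\<dots> = 2 * of_real pi * (\<Sum>n | 0 < n \<and> real n \<le> exp v. a n * of_real (1 - real n * exp (-v)))"
    by (simp add: sum_distrib_left)
  finally show ?thesis .
qed

text \<open>\<open>G\<close> is chosen such that both integrations by parts are done at once.\<close>

lemma line_integral_by_parts:
  assumes hol: "E holomorphic_on {s. Re s > 1}" and v: "v > 0" and \<sigma>: "\<sigma> > 1"
  assumes bound: "\<And>k t. k \<le> 2 \<Longrightarrow> norm ((deriv ^^ k) E (Complex \<sigma> t)) \<le> C * (1 + \<bar>t\<bar>) powr (-3/2)"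
  shows "norm (\<integral>t. exp (of_real v * Complex \<sigma> t) * E (Complex \<sigma> t) \<partial>lborel)
           \<le> exp (v * \<sigma>) / v\<^sup>2 * (C * (\<integral>t. (1 + \<bar>t::real\<bar>) powr (-3/2) \<partial>lborel))"
proof -
  define D where "D = (\<lambda>k t. (deriv ^^ k) E (Complex \<sigma> t))"
  define e where "e = (\<lambda>t. exp (of_real v * Complex \<sigma> t))"
  have norm_e: "norm (e t) = exp (v * \<sigma>)" for t by (simp add: e_def)
  have holD: "(deriv ^^ k) E holomorphic_on {s. Re s > 1}" for k
    by (rule holomorphic_higher_deriv[OF hol open_halfspace_Re_gt])
  have derD: "((deriv ^^ k) E has_field_derivative (deriv ^^ Suc k) E s) (at s)" if "Re s > 1" for s k
    using holomorphic_derivI[OF holD[of k] open_halfspace_Re_gt, of s] that by simp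
  have der_line: "(Complex \<sigma> has_vector_derivative \<i>) (at t)" for t
    unfolding Complex_line by (auto intro!: derivative_eq_intros simp: has_vector_derivative_def scaleR_conv_of_real mult.commute)
  have contline: "continuous_on UNIV (Complex \<sigma>)"
    unfolding Complex_line by (intro continuous_intros)
  have contD: "continuous_on UNIV (D k)" for k
    unfolding D_def
    by (rule continuous_on_compose2[OF holomorphic_on_imp_continuous_on[OF holD] contline]) (use \<sigma> in auto)
  have conte: "continuous_on UNIV e"
    unfolding e_def by (intro continuous_intros contline)
  have int: "integrable lborel (\<lambda>t. e t * D k t)" if "k \<le> 2" for k
  proof (rule Bochner_Integration.integrable_bound)
    show "integrable lborel (\<lambda>t. exp (v * \<sigma>) * C * (1 + \<bar>t\<bar>) powr (-3/2))"
      by (intro integrable_mult_right integrable_one_plus_abs_powr)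
    have "continuous_on UNIV (\<lambda>t. e t * D k t)" by (intro continuous_intros conte contD)
    thus "(\<lambda>t. e t * D k t) \<in> borel_measurable lborel"
      by (simp add: borel_measurable_continuous_onI)
    show "AE t in lborel. norm (e t * D k t) \<le> norm (exp (v * \<sigma>) * C * (1 + \<bar>t\<bar>) powr (-3/2))"
    proof (rule AE_I2)
      fix t :: real
      have "norm (e t * D k t) \<le> exp (v * \<sigma>) * (C * (1 + \<bar>t\<bar>) powr (-3/2))"
        unfolding norm_mult norm_e D_def by (intro mult_left_mono bound that) auto
      thus "norm (e t * D k t) \<le> norm (exp (v * \<sigma>) * C * (1 + \<bar>t\<bar>) powr (-3/2))"
        by simp
    qed
  qed
  define p where "p = 1 / complex_of_real v"
  have p: "of_real v * p = 1" "norm p = 1 / v" using v by (simp_all add: p_def norm_divide)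
  define G where "G = (\<lambda>t. - \<i> * (e t * (p * D 0 t - p ^ 2 * D 1 t)))"
  have derG: "(G has_vector_derivative (e t * D 0 t - p ^ 2 * (e t * D 2 t))) (at t)" for t
  proof -
    let ?s = "Complex \<sigma> t"
    define g where "g = (\<lambda>s. - \<i> * (exp (of_real v * s) * (p * (deriv ^^ 0) E s - p ^ 2 * (deriv ^^ 1) E s)))"
    define g' where "g' = - \<i> * (exp (of_real v * ?s) * (p * (deriv ^^ 1) E ?s - p ^ 2 * (deriv ^^ 2) E ?s)
       + of_real v * exp (of_real v * ?s) * (p * (deriv ^^ 0) E ?s - p ^ 2 * (deriv ^^ 1) E ?s))"
    have Es: "((deriv ^^ 0) E has_field_derivative (deriv ^^ 1) E ?s) (at ?s)"
       "((deriv ^^ 1) E has_field_derivative (deriv ^^ 2) E ?s) (at ?s)"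
      using derD[of ?s 0] derD[of ?s 1] \<sigma> by (simp_all add: numeral_2_eq_2)
    have ex: "((\<lambda>s. exp (of_real v * s)) has_field_derivative (of_real v * exp (of_real v * ?s))) (at ?s)"
      by (auto intro!: derivative_eq_intros)
    have "(g has_field_derivative g') (at ?s)"
      unfolding g_def g'_def
      using DERIV_cmult[OF DERIV_mult[OF ex DERIV_diff[OF DERIV_cmult[OF Es(1), of p] DERIV_cmult[OF Es(2), of "p ^ 2"]]], of "-\<i>"]
      by (simp add: algebra_simps)
    from field_vector_diff_chain_at[OF der_line this]
    have "(G has_vector_derivative (\<i> * g')) (at t)"
      by (simp add: G_def g_def e_def D_def o_def)
    also have "\<i> * g' = e t * (p * D 1 t - p ^ 2 * D 2 t) + (of_real v * p) * e t * (D 0 t - p * D 1 t)"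
      by (simp add: g'_def e_def D_def algebra_simps power2_eq_square)
    also have "\<dots> = e t * D 0 t - p ^ 2 * (e t * D 2 t)"
      unfolding p(1) by (simp add: algebra_simps)
    finally show ?thesis .
  qed
  \<comment> \<open>The antiderivative \<open>G\<close> vanishes at both ends of the line. So the
    integral of \<open>e * E\<close> equals \<open>p ^ 2\<close> times that of
    \<open>e * E''\<close>, and \<open>p ^ 2\<close> supplies the gain
    \<open>1 / v ^ 2\<close>.\<close>
  have "(\<integral>t. e t * D 0 t - p ^ 2 * (e t * D 2 t) \<partial>lborel) = 0"
  proof (rule lborel_integral_eq_limit)
    show "integrable lborel (\<lambda>t. e t * D 0 t - p ^ 2 * (e t * D 2 t))"
      by (intro Bochner_Integration.integrable_diff integrable_mult_right int) auto
    have "integral {-real n..real n} (\<lambda>t. e t * D 0 t - p ^ 2 * (e t * D 2 t)) = G (real n) - G (-real n)" for n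
      by (rule integral_unique[OF fundamental_theorem_of_calculus])
         (auto intro!: has_vector_derivative_at_within derG)
    moreover have "(\<lambda>n. G (real n) - G (-real n)) \<longlonglongrightarrow> 0"
    proof (rule Lim_null_comparison)
      have nG: "norm (G t) \<le> exp (v * \<sigma>) * (C / v + C / v ^ 2) * (1 + \<bar>t\<bar>) powr (-3/2)" for t
      proof -
        have "norm (G t) = exp (v * \<sigma>) * norm (p * D 0 t - p ^ 2 * D 1 t)"
          by (simp add: G_def norm_mult norm_e)
        also have "\<dots> \<le> exp (v * \<sigma>) * (norm (D 0 t) / v + norm (D 1 t) / v ^ 2)"
          using norm_triangle_ineq4[of "p * D 0 t" "p ^ 2 * D 1 t"]
          by (intro mult_left_mono) (auto simp: norm_mult norm_power p(2) power_divide)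
        also have "\<dots> \<le> exp (v * \<sigma>) * (C * (1 + \<bar>t\<bar>) powr (-3/2) / v + C * (1 + \<bar>t\<bar>) powr (-3/2) / v ^ 2)"
          unfolding D_def using v by (intro mult_left_mono add_mono divide_right_mono bound) auto
        finally show ?thesis by (simp add: algebra_simps)
      qed
      have "norm (G (real n) - G (-real n)) \<le> 2 * (exp (v * \<sigma>) * (C / v + C / v ^ 2) * (1 + real n) powr (-3/2))" for n
        using add_mono[OF nG[of "real n"] nG[of "-real n"]] norm_triangle_ineq4[of "G (real n)" "G (-real n)"]
        by simp
      thus "\<forall>\<^sub>F n in sequentially. norm (G (real n) - G (-real n)) \<le> 2 * (exp (v * \<sigma>) * (C / v + C / v ^ 2) * (1 + real n) powr (-3/2))"
        by (rule always_eventually[OF allI])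
      show "(\<lambda>n. 2 * (exp (v * \<sigma>) * (C / v + C / v ^ 2) * (1 + real n) powr (-3/2))) \<longlonglongrightarrow> 0"
        by (intro tendsto_mult_right_zero) real_asymp
    qed
    ultimately show "(\<lambda>n. integral {-real n..real n} (\<lambda>t. e t * D 0 t - p ^ 2 * (e t * D 2 t))) \<longlonglongrightarrow> 0"
      by simp
  qed
  also have "(\<integral>t. e t * D 0 t - p ^ 2 * (e t * D 2 t) \<partial>lborel)
       = (\<integral>t. e t * D 0 t \<partial>lborel) - (\<integral>t. p ^ 2 * (e t * D 2 t) \<partial>lborel)"
    by (intro Bochner_Integration.integral_diff integrable_mult_right int) auto
  finally have "norm (\<integral>t. e t * D 0 t \<partial>lborel) = norm (\<integral>t. p ^ 2 * (e t * D 2 t) \<partial>lborel)"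
    by simp
  also have "\<dots> \<le> (\<integral>t. exp (v * \<sigma>) / v ^ 2 * (C * (1 + \<bar>t::real\<bar>) powr (-3/2)) \<partial>lborel)"
  proof (rule order_trans[OF integral_norm_bound integral_mono])
    show "integrable lborel (\<lambda>t. norm (p ^ 2 * (e t * D 2 t)))"
      by (intro integrable_norm integrable_mult_right int) auto
    show "integrable lborel (\<lambda>t. exp (v * \<sigma>) / v ^ 2 * (C * (1 + \<bar>t::real\<bar>) powr (-3/2)))"
      by (intro integrable_mult_right integrable_one_plus_abs_powr)
    fix t :: real
    have "norm (p ^ 2 * (e t * D 2 t)) = exp (v * \<sigma>) / v ^ 2 * norm (D 2 t)"
      by (simp add: norm_mult norm_power norm_e p(2) power_divide)
    also have "\<dots> \<le> exp (v * \<sigma>) / v ^ 2 * (C * (1 + \<bar>t\<bar>) powr (-3/2))"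
      unfolding D_def by (intro mult_left_mono bound) auto
    finally show "norm (p ^ 2 * (e t * D 2 t)) \<le> exp (v * \<sigma>) / v ^ 2 * (C * (1 + \<bar>t\<bar>) powr (-3/2))" .
  qed
  also have "\<dots> = exp (v * \<sigma>) / v\<^sup>2 * (C * (\<integral>t. (1 + \<bar>t::real\<bar>) powr (-3/2) \<partial>lborel))"
    by simp
  finally show ?thesis by (simp add: e_def D_def)
qed

text \<open>The bound for the line integral holds with the same constants for all
  \<open>\<sigma>\<close> in \<open>(1, 3/2)\<close>. With \<open>x\<close> fixed,
  \<open>\<sigma>\<close> tends to 1 and \<open>x powr \<sigma>\<close> becomes \<open>x\<close>;
  the second factor \<open>x\<close> comes from replacing the weights \<open>1 - n / x\<close> by
  \<open>x - n\<close>.\<close>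

lemma smoothed_mangoldt_sum_bound:
  obtains K where "K > 0"
    "\<And>x. x > 1 \<Longrightarrow> \<bar>\<Sum>n | 0 < n \<and> real n \<le> x. (mangoldt n - 1) * (x - real n)\<bar> \<le> K * x\<^sup>2 / (ln x)\<^sup>2"
proof (rule mangoldt_minus_one_transform_bounds)
  fix E C
  assume C: "C > 0" and hol: "E holomorphic_on {s. Re s > 1}"
    and E: "\<And>s. Re s > 1 \<Longrightarrow> E s = dirichlet_series (\<lambda>n. mangoldt n - 1) s / (s * (s + 1))"
    and bound: "\<And>s k. 1 < Re s \<Longrightarrow> Re s \<le> 3/2 \<Longrightarrow> k \<le> 2 \<Longrightarrow>
       norm ((deriv ^^ k) E s) \<le> C * (1 + \<bar>Im s\<bar>) powr (-3/2)"
  define I where "I = (\<integral>t. (1 + \<bar>t::real\<bar>) powr (-3/2) \<partial>lborel)"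
  have I: "I \<ge> 0" unfolding I_def by (intro Bochner_Integration.integral_nonneg) auto
  define K where "K = C * I + 1"
  have K: "K > 0" using C I by (simp add: K_def add_nonneg_pos)
  have summ: "dirichlet_summable (\<lambda>n. mangoldt n - 1)"
    by (intro dirichlet_summable_diff dirichlet_summable_mangoldt dirichlet_summable_one)
  have "\<bar>\<Sum>n | 0 < n \<and> real n \<le> x. (mangoldt n - 1) * (x - real n)\<bar> \<le> K * x\<^sup>2 / (ln x)\<^sup>2" if x: "x > 1" for x
  proof -
    define v where "v = ln x"
    have v: "v > 0" and xv: "x = exp v" using x by (auto simp: v_def)
    define S where "S = (\<Sum>n | 0 < n \<and> real n \<le> exp v. (mangoldt n - 1) * (1 - real n * exp (-v)))"
    have "2 * pi * \<bar>S\<bar> \<le> exp (v * \<sigma>) / v\<^sup>2 * (C * I)" if \<sigma>: "1 < \<sigma>" "\<sigma> < 3/2" for \<sigma>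
    proof -
      have "(\<integral>t. exp (of_real v * Complex \<sigma> t) * E (Complex \<sigma> t) \<partial>lborel) = 2 * of_real pi * of_real S"
        using perron_sum[OF summ \<sigma>(1), of v] \<sigma> by (simp add: E S_def)
      moreover have "norm (\<integral>t. exp (of_real v * Complex \<sigma> t) * E (Complex \<sigma> t) \<partial>lborel) \<le> exp (v * \<sigma>) / v\<^sup>2 * (C * I)"
        unfolding I_def by (rule line_integral_by_parts[OF hol v \<sigma>(1)]) (use bound[of "Complex \<sigma> t" for t] \<sigma> in auto)
      ultimately show ?thesis by (simp add: norm_mult)
    qed
    hence ev: "\<forall>\<^sub>F \<sigma> in at_right 1. 2 * pi * \<bar>S\<bar> \<le> exp (v * \<sigma>) / v\<^sup>2 * (C * I)"
      using eventually_at_right_real[of 1 "3/2"] by (auto elim!: eventually_mono)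
    have "((\<lambda>\<sigma>. exp (v * \<sigma>) / v\<^sup>2 * (C * I)) \<longlongrightarrow> exp (v * 1) / v\<^sup>2 * (C * I)) (at_right 1)"
      by (intro tendsto_intros) (use v in auto)
    from tendsto_lowerbound[OF this ev] have "2 * pi * \<bar>S\<bar> \<le> exp v / v\<^sup>2 * (C * I)" by simp
    moreover have "1 * \<bar>S\<bar> \<le> 2 * pi * \<bar>S\<bar>" using pi_ge_two by (intro mult_right_mono) auto
    ultimately have "\<bar>S\<bar> \<le> exp v / v\<^sup>2 * (C * I)" by simp
    also have "\<dots> \<le> exp v / v\<^sup>2 * K" by (intro mult_left_mono) (auto simp: K_def)
    finally have "x * \<bar>S\<bar> \<le> x * (x / v\<^sup>2 * K)" using x xv by (intro mult_left_mono) auto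
    moreover have "x * S = (\<Sum>n | 0 < n \<and> real n \<le> x. (mangoldt n - 1) * (x - real n))"
      unfolding S_def sum_distrib_left xv
      by (intro sum.cong) (auto simp: algebra_simps exp_minus field_simps)
    moreover have "x * \<bar>S\<bar> = \<bar>x * S\<bar>" using x by (simp add: abs_mult)
    ultimately show ?thesis by (simp add: v_def power2_eq_square mult_ac)
  qed
  with K show thesis using that by blast
qed

section \<open>The prime number theorem with error term\<close>

definition chebyshev_psi :: "real \<Rightarrow> real" where
  "chebyshev_psi x = (\<Sum>n | 0 < n \<and> real n \<le> x. mangoldt n)"

lemma nat_le_real_eq: "x \<ge> 0 \<Longrightarrow> {n::nat. 0 < n \<and> real n \<le> x} = {1..nat \<lfloor>x\<rfloor>}"
  by (auto simp: le_nat_floor Suc_le_eq) (meson le_nat_floor of_nat_floor of_nat_le_iff order_trans)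

text \<open>The contribution of the subtracted constant 1, which supplies the main term
  \<open>x^2 / 2\<close>. With \<open>N\<close> the floor of \<open>x\<close>, the deviation is
  exactly \<open>- (x - N)^2 / 2 - N / 2\<close>.\<close>

lemma sum_linear_weights:
  assumes x: "x \<ge> 0"
  shows "\<bar>(\<Sum>n | 0 < n \<and> real n \<le> x. x - real n) - x\<^sup>2 / 2\<bar> \<le> x / 2 + 1"
proof -
  define N where "N = nat \<lfloor>x\<rfloor>"
  have N: "real N \<le> x" "x \<le> real N + 1" using x by (auto simp: N_def)
  have "(\<Sum>n | 0 < n \<and> real n \<le> x. x - real n) = (\<Sum>n=1..N. x - real n)"
    unfolding nat_le_real_eq[OF x] N_def ..
  also have "\<dots> = real N * x - (\<Sum>n=1..N. real n)" by (simp add: sum_subtractf)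
  also have "(\<Sum>n=1..N. real n) = real N * (real N + 1) / 2"
    by (induction N) (auto simp: field_simps)
  finally have eq: "(\<Sum>n | 0 < n \<and> real n \<le> x. x - real n) - x\<^sup>2 / 2 = - (x - real N)\<^sup>2 / 2 - real N / 2"
    by (simp add: power2_eq_square field_simps)
  have "(x - real N)\<^sup>2 \<le> 1" using N by (intro power_le_one) auto
  thus ?thesis
    unfolding eq abs_le_iff using x N zero_le_power2[of "x - real N"] by (intro conjI) linarith+
qed

text \<open>This is the integral of \<open>chebyshev_psi\<close> from 0 to \<open>x\<close>, written
  as a finite sum.\<close>

definition mangoldt_sum1 :: "real \<Rightarrow> real" where
  "mangoldt_sum1 x = (\<Sum>n | 0 < n \<and> real n \<le> x. mangoldt n * (x - real n))"

lemma mangoldt_sum1_bound: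
  obtains K where "K > 0"
    "\<forall>\<^sub>F x in at_top. \<bar>mangoldt_sum1 x - x\<^sup>2 / 2\<bar> \<le> K * x\<^sup>2 / (ln x)\<^sup>2"
proof -
  obtain K where K: "K > 0"
    "\<And>x. x > 1 \<Longrightarrow> \<bar>\<Sum>n | 0 < n \<and> real n \<le> x. (mangoldt n - 1) * (x - real n)\<bar> \<le> K * x\<^sup>2 / (ln x)\<^sup>2"
    using smoothed_mangoldt_sum_bound by blast
  have "\<forall>\<^sub>F x::real in at_top. x / 2 + 1 \<le> x\<^sup>2 / (ln x)\<^sup>2" by real_asymp
  hence "\<forall>\<^sub>F x in at_top. \<bar>mangoldt_sum1 x - x\<^sup>2 / 2\<bar> \<le> (K + 1) * x\<^sup>2 / (ln x)\<^sup>2"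
    using eventually_gt_at_top[of 1]
  proof eventually_elim
    case (elim x)
    have "mangoldt_sum1 x = (\<Sum>n | 0 < n \<and> real n \<le> x. (mangoldt n - 1) * (x - real n)) + (\<Sum>n | 0 < n \<and> real n \<le> x. x - real n)"
      unfolding mangoldt_sum1_def by (simp add: algebra_simps flip: sum.distrib)
    hence "\<bar>mangoldt_sum1 x - x\<^sup>2 / 2\<bar> \<le> K * x\<^sup>2 / (ln x)\<^sup>2 + (x / 2 + 1)"
      using K(2)[of x] sum_linear_weights[of x] elim by linarith
    also have "\<dots> \<le> K * x\<^sup>2 / (ln x)\<^sup>2 + x\<^sup>2 / (ln x)\<^sup>2" using elim by simp
    also have "\<dots> = (K + 1) * x\<^sup>2 / (ln x)\<^sup>2" by (simp add: algebra_simps add_divide_distrib)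
    finally show ?case .
  qed
  with K(1) show ?thesis by (intro that[of "K + 1"]) auto
qed

text \<open>Monotonicity of \<open>chebyshev_psi\<close> in integrated form: over an interval of
  length \<open>h\<close> the mean value lies between the values at the two ends.\<close>

lemma mangoldt_sum1_increment:
  assumes "h \<ge> 0"
  shows "chebyshev_psi x * h \<le> mangoldt_sum1 (x + h) - mangoldt_sum1 x"
    and "mangoldt_sum1 (x + h) - mangoldt_sum1 x \<le> chebyshev_psi (x + h) * h"
proof -
  let ?A = "{n. 0 < n \<and> real n \<le> x}" and ?B = "{n. 0 < n \<and> real n \<le> x + h}"
  have sub: "?A \<subseteq> ?B" using assms by auto
  have fin: "finite ?B" by (rule finite_nat_le_real)
  have eq: "mangoldt_sum1 (x + h) - mangoldt_sum1 x =
      (\<Sum>n\<in>?A. mangoldt n * h) + (\<Sum>n\<in>?B - ?A. mangoldt n * (x + h - real n))"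
  proof -
    have "(\<Sum>n\<in>?A. mangoldt n * (x + h - real n)) - (\<Sum>n\<in>?A. mangoldt n * (x - real n)) = (\<Sum>n\<in>?A. mangoldt n * h)"
      unfolding sum_subtractf [symmetric] by (rule sum.cong) (auto simp: algebra_simps)
    thus ?thesis
      unfolding mangoldt_sum1_def sum.subset_diff[OF sub fin, of "\<lambda>n. mangoldt n * (x + h - real n)"] by linarith
  qed
  have "(\<Sum>n\<in>?B - ?A. mangoldt n * (x + h - real n)) \<ge> 0"
    by (intro sum_nonneg mult_nonneg_nonneg mangoldt_nonneg) auto
  thus "chebyshev_psi x * h \<le> mangoldt_sum1 (x + h) - mangoldt_sum1 x"
    unfolding eq chebyshev_psi_def sum_distrib_right by simp
  have "(\<Sum>n\<in>?B - ?A. mangoldt n * (x + h - real n)) \<le> (\<Sum>n\<in>?B - ?A. mangoldt n * h)"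
    by (intro sum_mono mult_left_mono mangoldt_nonneg) auto
  thus "mangoldt_sum1 (x + h) - mangoldt_sum1 x \<le> chebyshev_psi (x + h) * h"
    unfolding eq chebyshev_psi_def sum_distrib_right sum.subset_diff[OF sub fin, of "\<lambda>n. mangoldt n * h"] by simp
qed

text \<open>The step \<open>h = x / ln x\<close> is the balance point: the second-order term
  \<open>h^2 / 2\<close> of the main part and the error \<open>x^2 / (ln x)^2 = h^2\<close> have the
  same order, and division by \<open>h\<close> leaves \<open>O(h)\<close>.\<close>

lemma chebyshev_psi_asymptotics:
  obtains K where "K > 0" "\<forall>\<^sub>F x in at_top. \<bar>chebyshev_psi x - x\<bar> \<le> K * x / ln x"
proof -
  obtain K where K: "K > 0" and ev: "\<forall>\<^sub>F x in at_top. \<bar>mangoldt_sum1 x - x\<^sup>2 / 2\<bar> \<le> K * x\<^sup>2 / (ln x)\<^sup>2"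
    by (rule mangoldt_sum1_bound)
  define g where "g = (\<lambda>x::real. x\<^sup>2 / (ln x)\<^sup>2)"
  define h where "h = (\<lambda>x::real. x / ln x)"
  define B where "B = (\<lambda>x. \<bar>mangoldt_sum1 x - x\<^sup>2 / 2\<bar> \<le> K * g x)"
  have evB: "\<forall>\<^sub>F x in at_top. B x" using ev by (simp add: B_def g_def)
  have ev1: "\<forall>\<^sub>F x in at_top. B (x + h x)"
    by (rule eventually_compose_filterlim[OF evB]) (unfold h_def, real_asymp)
  have ev2: "\<forall>\<^sub>F x in at_top. B (x - h x)"
    by (rule eventually_compose_filterlim[OF evB]) (unfold h_def, real_asymp)
  have ev3: "\<forall>\<^sub>F x in at_top. g (x + h x) \<le> 2 * g x"
    unfolding g_def h_def by real_asymp
  have ev4: "\<forall>\<^sub>F x in at_top. g (x - h x) \<le> 2 * g x"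
    unfolding g_def h_def by real_asymp
  have ev5: "\<forall>\<^sub>F x in at_top. h x > 0" unfolding h_def by real_asymp
  \<comment> \<open>1/2 comes from \<open>h^2 / 2\<close>; \<open>3 * K\<close> is one
    \<open>K\<close> for the error at \<open>x\<close> and two for the error at the shifted
    point.\<close>
  define M where "M = 1/2 + 3 * K"
  have "\<forall>\<^sub>F x in at_top. \<bar>chebyshev_psi x - x\<bar> \<le> M * x / ln x"
    using evB ev1 ev2 ev3 ev4 ev5 eventually_gt_at_top[of 1]
  proof eventually_elim
    case (elim x)
    define H where "H = h x"
    have H: "H > 0" using elim by (simp add: H_def)
    have gH: "g x = H * H" by (simp add: g_def H_def h_def power2_eq_square)
    have a1: "\<bar>mangoldt_sum1 x - x\<^sup>2 / 2\<bar> \<le> K * (H * H)"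
      using elim by (simp add: B_def gH)
    have "\<bar>mangoldt_sum1 (x + H) - (x + H)\<^sup>2 / 2\<bar> \<le> K * g (x + H)"
      using elim by (simp add: B_def H_def)
    also have "\<dots> \<le> K * (2 * (H * H))" using elim K by (intro mult_left_mono) (auto simp: H_def gH)
    finally have a2: "\<bar>mangoldt_sum1 (x + H) - (x + H)\<^sup>2 / 2\<bar> \<le> 2 * (K * (H * H))" by simp
    have "\<bar>mangoldt_sum1 (x - H) - (x - H)\<^sup>2 / 2\<bar> \<le> K * g (x - H)"
      using elim by (simp add: B_def H_def)
    also have "\<dots> \<le> K * (2 * (H * H))" using elim K by (intro mult_left_mono) (auto simp: H_def gH)
    finally have a3: "\<bar>mangoldt_sum1 (x - H) - (x - H)\<^sup>2 / 2\<bar> \<le> 2 * (K * (H * H))" by simp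
    have b1: "(x + H)\<^sup>2 / 2 = x\<^sup>2 / 2 + x * H + H * H / 2" "(x - H)\<^sup>2 / 2 = x\<^sup>2 / 2 - x * H + H * H / 2"
      by (simp_all add: power2_eq_square field_simps)
    have "chebyshev_psi x * H \<le> x * H + H * H / 2 + 3 * (K * (H * H))"
      using mangoldt_sum1_increment(1)[of H x] H a1 a2 unfolding b1 by linarith
    also have "\<dots> = (x + M * H) * H" by (simp add: M_def field_simps)
    finally have u: "chebyshev_psi x \<le> x + M * H" using H by simp
    have "x * H - H * H / 2 - 3 * (K * (H * H)) \<le> chebyshev_psi x * H"
      using mangoldt_sum1_increment(2)[of H "x - H"] H a1 a3 unfolding b1 by simp
    also have "x * H - H * H / 2 - 3 * (K * (H * H)) = (x - M * H) * H" by (simp add: M_def field_simps)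
    finally have "x - M * H \<le> chebyshev_psi x" using H by simp
    with u have "\<bar>chebyshev_psi x - x\<bar> \<le> M * H" by (simp add: abs_le_iff)
    thus ?case by (simp add: H_def h_def)
  qed
  moreover have "M > 0" using K by (simp add: M_def)
  ultimately show ?thesis using that by blast
qed

section \<open>From the Chebyshev function to the prime counting function\<close>

lemma finite_primes_le: "finite {p::nat. prime p \<and> real p \<le> x}"
  by (rule finite_subset[OF _ finite_nat_le_real[of x]]) (auto simp: prime_gt_0_nat)

text \<open>A prime \<open>p \<le> x\<close> has at most \<open>ln x / ln p\<close> powers up to
  \<open>x\<close>, each of weight \<open>ln p\<close>; so it contributes at most
  \<open>ln x\<close>.\<close>

lemma chebyshev_psi_le_prime_pi:
  assumes x: "x \<ge> 1"
  shows "chebyshev_psi x \<le> real (prime_pi x) * ln x"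
proof -
  let ?P = "{p::nat. prime p \<and> real p \<le> x}"
  let ?Q = "{n::nat. 0 < n \<and> real n \<le> x \<and> primepow n}"
  have finQ: "finite ?Q" by (rule finite_subset[OF _ finite_nat_le_real[of x]]) auto
  have "chebyshev_psi x = (\<Sum>n\<in>?Q. ln (real (aprimedivisor n)))"
    unfolding chebyshev_psi_def
    by (rule sum.mono_neutral_cong_right[OF finite_nat_le_real]) (auto simp: mangoldt_def)
  also have "\<dots> = (\<Sum>p\<in>?P. \<Sum>n\<in>{n\<in>?Q. aprimedivisor n = p}. ln (real (aprimedivisor n)))"
  proof (rule sum.group [symmetric, OF finQ finite_primes_le])
    show "aprimedivisor ` ?Q \<subseteq> ?P"
    proof safe
      fix n :: nat assume n: "0 < n" "real n \<le> x" "primepow n"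
      hence n1: "n > 1" using primepow_gt_Suc_0 by auto
      show "prime (aprimedivisor n)" using n1 by (intro prime_aprimedivisor') auto
      have "aprimedivisor n \<le> n" using n1 by (intro dvd_imp_le aprimedivisor_dvd') auto
      thus "real (aprimedivisor n) \<le> x" using n by linarith
    qed
  qed
  also have "\<dots> \<le> (\<Sum>p\<in>?P. ln x)"
  proof (rule sum_mono)
    fix p assume p: "p \<in> ?P"
    hence p1: "p > 1" using prime_gt_1_nat by blast
    hence lp: "ln (real p) > 0" by simp
    define k where "k = nat \<lfloor>ln x / ln (real p)\<rfloor>"
    have k: "real k \<le> ln x / ln (real p)"
      using x lp by (simp add: k_def)
    have "{n\<in>?Q. aprimedivisor n = p} \<subseteq> (\<lambda>i. p ^ i) ` {1..k}"
    proof
      fix n assume n: "n \<in> {n\<in>?Q. aprimedivisor n = p}"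
      then obtain q i where qi: "prime q" "i > 0" "n = q ^ i"
        by (auto simp: primepow_def)
      hence q: "q = p" using n by (simp add: aprimedivisor_prime_power)
      have "real i * ln (real p) = ln (real n)"
        using qi q p1 by (simp add: ln_realpow)
      also have "\<dots> \<le> ln x" using n by simp
      finally have "real i \<le> ln x / ln (real p)" using lp by (simp add: field_simps)
      hence "i \<le> k" unfolding k_def by (simp add: le_nat_floor)
      thus "n \<in> (\<lambda>i. p ^ i) ` {1..k}" using qi q by auto
    qed
    hence "card {n\<in>?Q. aprimedivisor n = p} \<le> card ((\<lambda>i. p ^ i) ` {1..k})"
      by (rule card_mono[rotated]) simp
    also have "\<dots> \<le> card {1..k}" by (rule card_image_le) simp
    finally have card_le: "card {n\<in>?Q. aprimedivisor n = p} \<le> k" by simp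
    have "(\<Sum>n\<in>{n\<in>?Q. aprimedivisor n = p}. ln (real (aprimedivisor n))) = real (card {n\<in>?Q. aprimedivisor n = p}) * ln (real p)"
      by simp
    also have "\<dots> \<le> ln x / ln (real p) * ln (real p)"
      using card_le k lp by (intro mult_right_mono) auto
    also have "\<dots> = ln x" using lp by simp
    finally show "(\<Sum>n\<in>{n\<in>?Q. aprimedivisor n = p}. ln (real (aprimedivisor n))) \<le> ln x" .
  qed
  also have "\<dots> = real (prime_pi x) * ln x" by (simp add: prime_pi_def)
  finally show ?thesis .
qed

text \<open>Primes up to \<open>y\<close> are counted trivially; each larger one contributes at
  least \<open>ln y\<close> to \<open>chebyshev_psi\<close>. This takes the place of partial
  summation.\<close>

lemma prime_pi_le_chebyshev_psi:
  assumes y: "y > 1"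
  shows "real (prime_pi x) \<le> y + chebyshev_psi x / ln y"
proof -
  let ?A = "{p::nat. prime p \<and> real p \<le> x \<and> real p \<le> y}"
  let ?B = "{p::nat. prime p \<and> real p \<le> x \<and> real p > y}"
  have "prime_pi x = card (?A \<union> ?B)"
    unfolding prime_pi_def by (rule arg_cong[where f = card]) auto
  also have "\<dots> \<le> card ?A + card ?B" by (rule card_Un_le)
  finally have 1: "real (prime_pi x) \<le> real (card ?A) + real (card ?B)" by linarith
  have "card ?A \<le> card {1..nat \<lfloor>y\<rfloor>}"
    by (intro card_mono) (auto simp: le_nat_floor Suc_le_eq prime_gt_0_nat)
  hence 2: "real (card ?A) \<le> y" using y by simp linarith
  have "real (card ?B) * ln y = (\<Sum>p\<in>?B. ln y)" by simp
  also have "\<dots> \<le> (\<Sum>p\<in>?B. mangoldt p)"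
    using y by (intro sum_mono) auto
  also have "\<dots> \<le> chebyshev_psi x"
    unfolding chebyshev_psi_def by (intro sum_mono2 finite_nat_le_real mangoldt_nonneg) (auto simp: prime_gt_0_nat)
  finally have "real (card ?B) \<le> chebyshev_psi x / ln y" using y by (simp add: field_simps)
  with 1 2 show ?thesis by linarith
qed

text \<open>The cut \<open>y = x / (ln x)^2\<close> makes the trivially counted part harmless, while
  \<open>ln y = ln x - 2 * ln (ln x)\<close>. Replacing \<open>ln y\<close> by \<open>ln x\<close>
  is the one place where the factor \<open>ln (ln x)\<close> is lost.\<close>

lemma prime_pi_asymptotics:
  obtains K where "K > 0"
    "\<forall>\<^sub>F x in at_top. \<bar>real (prime_pi x) - x / ln x\<bar> \<le> K * x * ln (ln x) / (ln x)\<^sup>2"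
proof -
  obtain K where K: "K > 0" and ev: "\<forall>\<^sub>F x in at_top. \<bar>chebyshev_psi x - x\<bar> \<le> K * x / ln x"
    by (rule chebyshev_psi_asymptotics)
  have ev1: "\<forall>\<^sub>F x::real in at_top. x / (ln x)\<^sup>2 > 1" by real_asymp
  have ev2: "\<forall>\<^sub>F x::real in at_top. ln (x / (ln x)\<^sup>2) \<ge> ln x / 2" by real_asymp
  have ev3: "\<forall>\<^sub>F x::real in at_top. x / ln (x / (ln x)\<^sup>2) - x / ln x \<le> 3 * (x * ln (ln x) / (ln x)\<^sup>2)" by real_asymp
  have ev4: "\<forall>\<^sub>F x::real in at_top. x / (ln x)\<^sup>2 \<le> x * ln (ln x) / (ln x)\<^sup>2" by real_asymp
  define M where "M = 4 + 2 * K"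
  have "\<forall>\<^sub>F x in at_top. \<bar>real (prime_pi x) - x / ln x\<bar> \<le> M * x * ln (ln x) / (ln x)\<^sup>2"
    using ev ev1 ev2 ev3 ev4 eventually_gt_at_top[of 1]
  proof eventually_elim
    case (elim x)
    define y where "y = x / (ln x)\<^sup>2"
    define T where "T = x * ln (ln x) / (ln x)\<^sup>2"
    have lx: "ln x > 0" using elim by simp
    have y: "y > 1" "y \<le> T" "ln y \<ge> ln x / 2" using elim by (auto simp: y_def T_def)
    have ly: "ln y > 0" using y by simp
    have "chebyshev_psi x \<le> real (prime_pi x) * ln x"
      by (rule chebyshev_psi_le_prime_pi) (use elim in auto)
    moreover have "x - K * x / ln x \<le> chebyshev_psi x" using elim by linarith
    ultimately have "x - K * x / ln x \<le> real (prime_pi x) * ln x" by linarith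
    hence "(x - K * x / ln x) / ln x \<le> real (prime_pi x)" using lx by (simp add: field_simps)
    moreover have "(x - K * x / ln x) / ln x = x / ln x - K * y"
      using lx by (simp add: y_def field_simps power2_eq_square)
    ultimately have lower: "x / ln x - K * y \<le> real (prime_pi x)" by simp
    have "real (prime_pi x) \<le> y + chebyshev_psi x / ln y"
      by (rule prime_pi_le_chebyshev_psi[OF y(1)])
    also have "chebyshev_psi x / ln y \<le> (x + K * x / ln x) / ln y"
      using elim ly by (intro divide_right_mono) auto
    also have "(x + K * x / ln x) / ln y = x / ln y + K * x / ln x / ln y"
      by (simp add: add_divide_distrib)
    also have "K * x / ln x / ln y \<le> K * x / ln x / (ln x / 2)"
      using y(3) lx ly K elim by (intro divide_left_mono) auto
    also have "K * x / ln x / (ln x / 2) = 2 * (K * y)"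
      by (simp add: y_def power2_eq_square)
    also have "x / ln y \<le> x / ln x + 3 * T" using elim by (simp add: y_def T_def)
    finally have upper: "real (prime_pi x) \<le> y + (x / ln x + 3 * T + 2 * (K * y))" by simp
    have Ky: "0 \<le> K * y" "K * y \<le> K * T" using K y by (auto intro: mult_left_mono)
    have "M * x * ln (ln x) / (ln x)\<^sup>2 = M * T" by (simp add: T_def)
    also have "\<dots> = 4 * T + 2 * (K * T)" by (simp add: M_def algebra_simps)
    finally have MT: "M * x * ln (ln x) / (ln x)\<^sup>2 = 4 * T + 2 * (K * T)" .
    show ?case unfolding MT abs_le_iff using upper lower y Ky by linarith
  qed
  moreover have "M > 0" using K by (simp add: M_def)
  ultimately show ?thesis using that by blast
qed

section \<open>Ramanujan primes\<close>

definition pi_main :: "real \<Rightarrow> real" where "pi_main x = x / ln x"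

definition rel_err :: "real \<Rightarrow> real" where "rel_err x = ln (ln x) / ln x"

text \<open>\<open>ln u / u\<close> decreases from \<open>u = exp 1\<close> on; here
  \<open>u = ln x\<close>, hence the threshold \<open>exp (exp 1)\<close>.\<close>

lemma rel_err_antimono:
  assumes "exp (exp 1) \<le> x" "x \<le> y"
  shows "rel_err y \<le> rel_err x"
proof -
  have "exp 1 \<le> ln x" using assms(1) by (subst ln_ge_iff) (auto intro: less_le_trans[OF exp_gt_zero])
  moreover have "0 < x" using assms(1) less_le_trans[OF exp_gt_zero] by blast
  ultimately show ?thesis
    unfolding rel_err_def using assms(2) by (intro ln_x_over_x_mono) auto
qed

lemma pi_main_mono:
  assumes "exp 1 \<le> x" "x \<le> y"
  shows "pi_main x \<le> pi_main y"
proof -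
  have x: "0 < x" using assms(1) less_le_trans[OF exp_gt_zero] by blast
  have lx: "ln x \<ge> 1" using assms(1) x by (simp add: ln_ge_iff)
  have ly: "ln y \<ge> ln x" using assms x by simp
  have "ln y / y \<le> ln x / x" using assms by (intro ln_x_over_x_mono) auto
  hence "x * ln y \<le> y * ln x" using x assms(2) by (simp add: field_simps)
  thus ?thesis unfolding pi_main_def using lx ly by (subst frac_le_eq) (auto simp: divide_le_0_iff mult_ac)
qed

lemma rel_err_tendsto: "((\<lambda>n. rel_err (real n)) \<longlongrightarrow> 0) sequentially"
  unfolding rel_err_def by real_asymp

lemma prime_pi_pi_main:
  obtains K where "K > 0"
    "\<forall>\<^sub>F x in at_top. \<bar>real (prime_pi x) - pi_main x\<bar> \<le> K * (pi_main x * rel_err x)"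
proof -
  obtain K where K: "K > 0"
    "\<forall>\<^sub>F x in at_top. \<bar>real (prime_pi x) - x / ln x\<bar> \<le> K * x * ln (ln x) / (ln x)\<^sup>2"
    by (rule prime_pi_asymptotics)
  show ?thesis
    by (rule that[of K]) (use K in \<open>auto simp: pi_main_def rel_err_def power2_eq_square mult.assoc\<close>)
qed

lemma prime_pi_mono: "x \<le> y \<Longrightarrow> prime_pi x \<le> prime_pi y"
  unfolding prime_pi_def by (intro card_mono finite_primes_le) auto

lemma prime_pi_le: "x \<ge> 0 \<Longrightarrow> real (prime_pi x) \<le> x"
proof -
  assume x: "x \<ge> 0"
  have "prime_pi x \<le> card {n::nat. 0 < n \<and> real n \<le> x}"
    unfolding prime_pi_def by (intro card_mono finite_nat_le_real) (auto simp: prime_gt_0_nat)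
  also have "\<dots> = nat \<lfloor>x\<rfloor>" by (simp add: nat_le_real_eq[OF x])
  finally show ?thesis using x by linarith
qed

text \<open>A prime in \<open>(x, r]\<close> can only be \<open>r\<close> itself, because
  \<open>r - 1 \<le> x\<close>.\<close>

lemma prime_pi_step:
  assumes "real r \<le> x + 1"
  shows "prime_pi (real r) \<le> prime_pi x + 1"
proof -
  have "{p. prime p \<and> real p \<le> real r} \<subseteq> insert r {p. prime p \<and> real p \<le> x}"
  proof safe
    fix p assume p: "prime p" "real p \<le> real r" "p \<noteq> r" 
    hence "p + 1 \<le> r" by simp
    hence "real p + 1 \<le> real r" by linarith
    thus "real p \<le> x" using assms by linarith
  qed
  hence "prime_pi (real r) \<le> card (insert r {p. prime p \<and> real p \<le> x})"
    unfolding prime_pi_def by (intro card_mono) (auto simp: finite_primes_le)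
  also have "\<dots> \<le> prime_pi x + 1"
    unfolding prime_pi_def by (rule order_trans[OF card_insert_le_m1]) auto
  finally show ?thesis .
qed

section \<open>Counting primes in the interval from c x to x\<close>

locale ramanujan =
  fixes c :: real
  assumes c: "0 < c" "c < 1"
begin

definition prime_gap_count :: "real \<Rightarrow> real" where
  "prime_gap_count x = real (prime_pi x) - real (prime_pi (c * x))"

lemma prime_gap_count_nonneg: "x \<ge> 0 \<Longrightarrow> prime_gap_count x \<ge> 0"
  using prime_pi_mono[of "c * x" x] c by (simp add: prime_gap_count_def mult_left_le_one_le)

lemma prime_gap_count_le: "x \<ge> 0 \<Longrightarrow> prime_gap_count x \<le> x"
  using prime_pi_le[of x] by (simp add: prime_gap_count_def)

lemma prime_gap_count_step:
  assumes "real r \<le> x + 1" "x \<le> real r"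
  shows "prime_gap_count (real r) \<le> prime_gap_count x + 1"
  using prime_pi_step[OF assms(1)] prime_pi_mono[of "c * x" "c * real r"] assms(2) c
  by (simp add: prime_gap_count_def)

lemma prime_gap_count_asymptotics:
  obtains K where "K > 0"
    "\<forall>\<^sub>F x in at_top. \<bar>real (prime_pi x) - pi_main x\<bar> \<le> K * (pi_main x * rel_err x)"
    "\<forall>\<^sub>F x in at_top. \<bar>prime_gap_count x - (1 - c) * pi_main x\<bar> \<le> K * (pi_main x * rel_err x)"
proof -
  obtain K where K: "K > 0"
    and ev: "\<forall>\<^sub>F x in at_top. \<bar>real (prime_pi x) - pi_main x\<bar> \<le> K * (pi_main x * rel_err x)"
    by (rule prime_pi_pi_main)
  have "filterlim (\<lambda>x. c * x) at_top at_top"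
    using c by real_asymp
  from eventually_compose_filterlim[OF ev this]
  have ev': "\<forall>\<^sub>F x in at_top. \<bar>real (prime_pi (c * x)) - pi_main (c * x)\<bar> \<le> K * (pi_main (c * x) * rel_err (c * x))" .
  define d where "d = - ln c"
  have d: "d > 0" using c by (simp add: d_def)
  have "\<forall>\<^sub>F x in at_top. \<bar>c * x / (ln x - d) - c * (x / ln x)\<bar> \<le> x / ln x * (ln (ln x) / ln x)"
    using c d by real_asymp
  hence 1: "\<forall>\<^sub>F x in at_top. \<bar>pi_main (c * x) - c * pi_main x\<bar> \<le> pi_main x * rel_err x"
    using eventually_gt_at_top[of 0]
  proof eventually_elim
    case (elim x)
    hence "ln (c * x) = ln x - d" using c by (simp add: ln_mult d_def)
    with elim show ?case by (simp add: pi_main_def rel_err_def)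
  qed
  \<comment> \<open>The quotient of the two sides tends to \<open>c < 1\<close>, so the error at
    \<open>c * x\<close> is absorbed by the error at \<open>x\<close>.\<close>
  have 2: "\<forall>\<^sub>F x in at_top. pi_main (c * x) * rel_err (c * x) \<le> pi_main x * rel_err x"
    unfolding pi_main_def rel_err_def using c by real_asymp
  have 3: "\<forall>\<^sub>F x in at_top. pi_main x * rel_err x \<ge> 0"
    unfolding pi_main_def rel_err_def by real_asymp
  define M where "M = 2 * K + 1"
  show ?thesis
  proof (rule that[of M])
    show "M > 0" using K by (simp add: M_def)
    show "\<forall>\<^sub>F x in at_top. \<bar>real (prime_pi x) - pi_main x\<bar> \<le> M * (pi_main x * rel_err x)"
      using ev 3
    proof eventually_elim
      case (elim x)
      have "K * (pi_main x * rel_err x) \<le> M * (pi_main x * rel_err x)"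
        using elim K by (intro mult_right_mono) (auto simp: M_def)
      with elim show ?case by linarith
    qed
    show "\<forall>\<^sub>F x in at_top. \<bar>prime_gap_count x - (1 - c) * pi_main x\<bar> \<le> M * (pi_main x * rel_err x)"
      using ev ev' 1 2
    proof eventually_elim
      case (elim x)
      define T where "T = pi_main x * rel_err x"
      have a: "\<bar>real (prime_pi (c * x)) - pi_main (c * x)\<bar> \<le> K * T"
        using elim(2) mult_left_mono[OF elim(4), of K] K unfolding T_def by linarith
      have "\<bar>prime_gap_count x - (1 - c) * pi_main x\<bar> \<le>
          \<bar>real (prime_pi x) - pi_main x\<bar> + \<bar>real (prime_pi (c * x)) - pi_main (c * x)\<bar> + \<bar>pi_main (c * x) - c * pi_main x\<bar>"
        unfolding prime_gap_count_def by (simp add: algebra_simps)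
      also have "\<dots> \<le> K * T + K * T + T"
        using elim(1,3) a unfolding T_def by linarith
      also have "\<dots> = M * T" by (simp add: M_def algebra_simps)
      finally show ?case by (simp add: T_def)
    qed
  qed
qed

section \<open>Ramanujan primes and their counting function\<close>

lemma ramanujan_prime_altdef:
  "ramanujan_prime c n = (LEAST R::nat. R > 0 \<and> (\<forall>x::real. x \<ge> real R \<longrightarrow> prime_gap_count x \<ge> real n))"
proof -
  have "int (prime_pi x) - int (prime_pi (c * x)) \<ge> int n \<longleftrightarrow> prime_gap_count x \<ge> real n" for x
    unfolding prime_gap_count_def by linarith
  thus ?thesis unfolding ramanujan_prime_def by simp
qed

text \<open>Ensures that some \<open>R\<close> satisfies the condition under \<open>LEAST\<close>,
  so that every Ramanujan prime is a genuine minimum.\<close>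

lemma prime_gap_count_at_top: "filterlim prime_gap_count at_top at_top"
proof -
  obtain K where K: "K > 0" and "\<forall>\<^sub>F x in at_top. \<bar>prime_gap_count x - (1 - c) * pi_main x\<bar> \<le> K * (pi_main x * rel_err x)"
    by (rule prime_gap_count_asymptotics)
  hence "\<forall>\<^sub>F x in at_top. (1 - c) * pi_main x - K * (pi_main x * rel_err x) \<le> prime_gap_count x"
    by (auto elim!: eventually_mono)
  moreover have "filterlim (\<lambda>x. (1 - c) * pi_main x - K * (pi_main x * rel_err x)) at_top at_top"
    unfolding pi_main_def rel_err_def using c K by real_asymp
  ultimately show ?thesis by (rule filterlim_at_top_mono[rotated])
qed

lemma ramanujan_prime_spec:
  "ramanujan_prime c n > 0 \<and> (\<forall>x. x \<ge> real (ramanujan_prime c n) \<longrightarrow> prime_gap_count x \<ge> real n)"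
  unfolding ramanujan_prime_altdef
proof (rule LeastI_ex)
  have "\<forall>\<^sub>F x in at_top. prime_gap_count x \<ge> real n"
    using prime_gap_count_at_top by (simp add: filterlim_at_top)
  then obtain X where X: "\<And>x. x \<ge> X \<Longrightarrow> prime_gap_count x \<ge> real n"
    by (auto simp: eventually_at_top_linorder)
  define R where "R = Suc (nat \<lceil>X\<rceil>)"
  have "real R \<ge> X" unfolding R_def by linarith
  thus "\<exists>R>0. \<forall>x. x \<ge> real R \<longrightarrow> prime_gap_count x \<ge> real n"
    using X by (intro exI[of _ R]) (auto simp: R_def)
qed

text \<open>The condition under \<open>LEAST\<close> is inherited by larger numbers, so being above
  the minimum is the same as satisfying it.\<close>

lemma ramanujan_prime_le_iff:
  assumes "N > 0"
  shows "ramanujan_prime c n \<le> N \<longleftrightarrow> (\<forall>x\<ge>real N. prime_gap_count x \<ge> real n)"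
proof
  assume "ramanujan_prime c n \<le> N"
  thus "\<forall>x\<ge>real N. prime_gap_count x \<ge> real n" using ramanujan_prime_spec[of n] by force
next
  assume "\<forall>x\<ge>real N. prime_gap_count x \<ge> real n"
  thus "ramanujan_prime c n \<le> N"
    unfolding ramanujan_prime_altdef using assms by (intro Least_le) auto
qed

lemma ramanujan_prime_ge: "n \<le> ramanujan_prime c n"
proof -
  have "real n \<le> prime_gap_count (real (ramanujan_prime c n))" using ramanujan_prime_spec[of n] by auto
  also have "\<dots> \<le> real (ramanujan_prime c n)" by (rule prime_gap_count_le) auto
  finally show ?thesis by simp
qed

text \<open>By minimality the count drops below \<open>n\<close> somewhere in \<open>[R - 1, R)\<close>, and it increases by at most
  one from there to \<open>R\<close>.\<close>

lemma prime_gap_count_ramanujan_prime: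
  assumes n: "n \<ge> 2"
  shows "prime_gap_count (real (ramanujan_prime c n)) < real n + 1"
proof -
  define R where "R = ramanujan_prime c n"
  \<comment> \<open>\<open>n \<ge> 2\<close> makes \<open>R - 1\<close> positive, as the criterion
    for \<open>ramanujan_prime c n \<le> R - 1\<close> demands.\<close>
  have R: "R \<ge> 2" using ramanujan_prime_ge[of n] n by (simp add: R_def)
  have "\<not> ramanujan_prime c n \<le> R - 1" using R by (simp add: R_def)
  then obtain x where x: "x \<ge> real (R - 1)" "prime_gap_count x < real n"
    using R by (subst (asm) ramanujan_prime_le_iff) (auto simp: not_le)
  have "x < real R" using x(2) ramanujan_prime_spec[of n] by (force simp: R_def not_le)
  moreover have "real R \<le> x + 1" using x(1) R by (simp add: of_nat_diff)
  ultimately have "prime_gap_count (real R) \<le> prime_gap_count x + 1"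
    by (intro prime_gap_count_step) auto
  thus ?thesis using x(2) by (simp add: R_def)
qed

text \<open>If the count is at least \<open>n + 1\<close> from \<open>R\<close> on, it is at least
  \<open>n\<close> from \<open>R - 1\<close> on, as the last unit step adds at most one. Hence
  different indices give different primes, and counting the primes amounts to counting
  indices.\<close>

lemma ramanujan_prime_strict_mono: "strict_mono (\<lambda>n. ramanujan_prime c (Suc n))"
proof (rule strict_mono_Suc_iff[THEN iffD2], rule allI)
  fix k
  define n where "n = Suc k"
  define R where "R = ramanujan_prime c (Suc n)"
  have R: "R > 0" "\<And>x. x \<ge> real R \<Longrightarrow> prime_gap_count x \<ge> real (Suc n)"
    using ramanujan_prime_spec[of "Suc n"] by (auto simp: R_def)
  have "R \<ge> 2" using ramanujan_prime_ge[of "Suc n"] by (simp add: R_def n_def)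
  have "ramanujan_prime c n \<le> R - 1"
  proof (subst ramanujan_prime_le_iff)
    show "R - 1 > 0" using \<open>R \<ge> 2\<close> by simp
    show "\<forall>x\<ge>real (R - 1). real n \<le> prime_gap_count x"
    proof (intro allI impI)
      fix x assume x: "x \<ge> real (R - 1)"
      show "real n \<le> prime_gap_count x"
      proof (cases "x \<ge> real R")
        case True
        thus ?thesis using R(2)[of x] by simp
      next
        case False
        have "prime_gap_count (real R) \<le> prime_gap_count x + 1"
          using x False R(1) by (intro prime_gap_count_step) (auto simp: of_nat_diff)
        thus ?thesis using R(2)[of "real R"] by simp
      qed
    qed
  qed
  thus "ramanujan_prime c (Suc k) < ramanujan_prime c (Suc (Suc k))"
    using \<open>R \<ge> 2\<close> by (simp add: R_def n_def)
qed

lemma ramanujan_pi_eq: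
  assumes N: "N > 0"
  shows "ramanujan_pi c (real N) = card {n. 1 \<le> n \<and> (\<forall>x\<ge>real N. prime_gap_count x \<ge> real n)}"
proof -
  have inj: "inj_on (ramanujan_prime c) {1..}"
  proof (rule inj_onI)
    fix m n :: nat assume mn: "m \<in> {1..}" "n \<in> {1..}" "ramanujan_prime c m = ramanujan_prime c n"
    then obtain m' n' where "m = Suc m'" "n = Suc n'" by (cases m; cases n) auto
    thus "m = n" using strict_mono_eq[OF ramanujan_prime_strict_mono, of m' n'] mn(3) by simp
  qed
  have "{r \<in> ramanujan_primes c. real r \<le> real N} = ramanujan_prime c ` {n. 1 \<le> n \<and> ramanujan_prime c n \<le> N}"
    by (auto simp: ramanujan_primes_def)
  moreover have "card (ramanujan_prime c ` {n. 1 \<le> n \<and> ramanujan_prime c n \<le> N}) = card {n. 1 \<le> n \<and> ramanujan_prime c n \<le> N}"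
    by (rule card_image[OF inj_on_subset[OF inj]]) auto
  ultimately show ?thesis
    unfolding ramanujan_pi_def ramanujan_prime_le_iff[OF N] by simp
qed

lemma ramanujan_pi_le:
  assumes N: "N > 0"
  shows "real (ramanujan_pi c (real N)) \<le> prime_gap_count (real N)"
proof -
  define b where "b = prime_gap_count (real N)"
  have b: "b \<ge> 0" unfolding b_def by (rule prime_gap_count_nonneg) simp
  have "{n. 1 \<le> n \<and> (\<forall>x\<ge>real N. prime_gap_count x \<ge> real n)} \<subseteq> {1..nat \<lfloor>b\<rfloor>}"
    by (auto simp: b_def le_nat_floor)
  hence "ramanujan_pi c (real N) \<le> card {1..nat \<lfloor>b\<rfloor>}"
    unfolding ramanujan_pi_eq[OF N] by (intro card_mono) auto
  hence "real (ramanujan_pi c (real N)) \<le> real (nat \<lfloor>b\<rfloor>)" by simp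
  also have "\<dots> \<le> b" using b by simp
  finally show ?thesis by (simp add: b_def)
qed

text \<open>Every positive index up to \<open>b\<close> is counted; the loss of 1 is the rounding of
  \<open>b\<close>.\<close>

lemma ramanujan_pi_ge:
  assumes N: "N > 0" and b: "\<And>x. x \<ge> real N \<Longrightarrow> prime_gap_count x \<ge> b"
  shows "real (ramanujan_pi c (real N)) \<ge> b - 1"
proof -
  have "{1..nat \<lfloor>b\<rfloor>} \<subseteq> {n. 1 \<le> n \<and> (\<forall>x\<ge>real N. prime_gap_count x \<ge> real n)}"
  proof safe
    fix n x assume n: "n \<in> {1..nat \<lfloor>b\<rfloor>}" and x: "real N \<le> x"
    have "real n \<le> b" using n by auto linarith
    thus "real n \<le> prime_gap_count x" using b[OF x] by simp
  qed auto
  moreover have "finite {n. 1 \<le> n \<and> (\<forall>x\<ge>real N. prime_gap_count x \<ge> real n)}"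
    by (rule finite_subset[of _ "{..nat \<lfloor>prime_gap_count (real N)\<rfloor>}"]) (auto simp: le_nat_floor)
  ultimately have "card {1..nat \<lfloor>b\<rfloor>} \<le> ramanujan_pi c (real N)"
    unfolding ramanujan_pi_eq[OF N] by (intro card_mono)
  thus ?thesis by simp linarith
qed

text \<open>For the upper bound the count at \<open>N\<close> suffices. The lower bound needs all
  \<open>x \<ge> N\<close> at once: since \<open>pi_main\<close> increases and
  \<open>rel_err\<close> decreases, the estimate at \<open>N\<close> is a lower bound for all of
  them.\<close>

lemma ramanujan_pi_ratio:
  "\<exists>\<beta>. \<forall>\<^sub>F N::nat in sequentially.
     \<bar>real (ramanujan_pi c (real N)) / real (prime_pi (real N)) - (1 - c)\<bar> \<le> \<beta> * rel_err (real N)"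
proof -
  obtain K where K: "K > 0"
    and ev1: "\<forall>\<^sub>F x in at_top. \<bar>real (prime_pi x) - pi_main x\<bar> \<le> K * (pi_main x * rel_err x)"
    and ev2: "\<forall>\<^sub>F x in at_top. \<bar>prime_gap_count x - (1 - c) * pi_main x\<bar> \<le> K * (pi_main x * rel_err x)"
    by (rule prime_gap_count_asymptotics)
  \<comment> \<open>The bound 1/2 yields \<open>P \<ge> f / 2\<close> for the denominator; the bound
    \<open>1 - c\<close> keeps the factor \<open>1 - c - K * \<epsilon>\<close> nonnegative, so that
    the product is monotone.\<close>
  have ev3: "\<forall>\<^sub>F x in at_top. K * rel_err x \<le> min (1/2) (1 - c)"
  proof -
    have "((\<lambda>x. K * rel_err x) \<longlongrightarrow> 0) at_top" unfolding rel_err_def by real_asymp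
    moreover have "min (1/2) (1 - c) > 0" using c by simp
    ultimately have "\<forall>\<^sub>F x in at_top. K * rel_err x < min (1/2) (1 - c)" by (rule order_tendstoD(2))
    thus ?thesis by (rule eventually_mono) (rule less_imp_le)
  qed
  have ev4: "\<forall>\<^sub>F x in at_top. 1 \<le> pi_main x * rel_err x"
    unfolding pi_main_def rel_err_def by real_asymp
  have ev5: "\<forall>\<^sub>F x in at_top. pi_main x > 0"
    unfolding pi_main_def by real_asymp
  have "\<forall>\<^sub>F x in at_top. \<bar>real (prime_pi x) - pi_main x\<bar> \<le> K * (pi_main x * rel_err x) \<and>
     \<bar>prime_gap_count x - (1 - c) * pi_main x\<bar> \<le> K * (pi_main x * rel_err x) \<and>
     K * rel_err x \<le> min (1/2) (1 - c) \<and> 1 \<le> pi_main x * rel_err x \<and> pi_main x > 0 \<and> x \<ge> exp (exp 1)"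
    using ev1 ev2 ev3 ev4 ev5 eventually_ge_at_top[of "exp (exp 1)"] by eventually_elim simp
  then obtain X where X: "\<And>x. x \<ge> X \<Longrightarrow> \<bar>real (prime_pi x) - pi_main x\<bar> \<le> K * (pi_main x * rel_err x) \<and>
     \<bar>prime_gap_count x - (1 - c) * pi_main x\<bar> \<le> K * (pi_main x * rel_err x) \<and>
     K * rel_err x \<le> min (1/2) (1 - c) \<and> 1 \<le> pi_main x * rel_err x \<and> pi_main x > 0 \<and> x \<ge> exp (exp 1)"
    by (auto simp: eventually_at_top_linorder)
  have main: "\<bar>real (ramanujan_pi c (real N)) / real (prime_pi (real N)) - (1 - c)\<bar> \<le> (4 * K + 2) * rel_err (real N)"
    if N: "real N \<ge> X" for N
  proof -
    define f where "f = pi_main (real N)"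
    define \<epsilon> where "\<epsilon> = rel_err (real N)"
    note XN = X[OF N, folded f_def \<epsilon>_def]
    have N0: "N > 0" using XN by (intro Nat.gr0I) auto
    have f: "f > 0" and fe: "f * \<epsilon> \<ge> 1" using XN by auto
    have upper: "real (ramanujan_pi c (real N)) \<le> (1 - c) * f + K * (f * \<epsilon>)"
      using ramanujan_pi_le[OF N0] XN by linarith
    have "prime_gap_count x \<ge> f * (1 - c - K * \<epsilon>)" if x: "x \<ge> real N" for x
    proof -
      have Xx: "x \<ge> X" using x N by simp
      have eN: "exp (exp 1) \<le> real N" using XN by simp
      have "exp 1 \<le> exp (exp (1::real))" using exp_ge_add_one_self[of 1] by simp
      hence "exp 1 \<le> real N" using eN by linarith
      hence "f \<le> pi_main x" unfolding f_def using x by (intro pi_main_mono) auto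
      moreover have "rel_err x \<le> \<epsilon>" unfolding \<epsilon>_def using eN x by (intro rel_err_antimono) auto
      moreover from this have "K * rel_err x \<le> K * \<epsilon>" using K by (intro mult_left_mono) auto
      ultimately have "f * (1 - c - K * \<epsilon>) \<le> pi_main x * (1 - c - K * rel_err x)"
        using f XN by (intro mult_mono) auto
      also have "\<dots> = (1 - c) * pi_main x - K * (pi_main x * rel_err x)" by (simp add: algebra_simps)
      also have "\<dots> \<le> prime_gap_count x" using X[OF Xx] by linarith
      finally show ?thesis .
    qed
    from ramanujan_pi_ge[OF N0 this]
    have "real (ramanujan_pi c (real N)) \<ge> f * (1 - c - K * \<epsilon>) - 1" by simp
    also have "f * (1 - c - K * \<epsilon>) = (1 - c) * f - K * (f * \<epsilon>)" by (simp add: algebra_simps)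
    finally have lower: "real (ramanujan_pi c (real N)) \<ge> (1 - c) * f - K * (f * \<epsilon>) - 1" .
    define P where "P = real (prime_pi (real N))"
    have Pf: "\<bar>P - f\<bar> \<le> K * (f * \<epsilon>)" using XN by (simp add: P_def)
    have "f * (K * \<epsilon>) \<le> f * (1/2)" using XN f by (intro mult_left_mono) auto
    hence P: "P \<ge> f / 2" using Pf by (simp add: algebra_simps abs_le_iff)
    have "\<bar>(1 - c) * (P - f)\<bar> \<le> 1 * (K * (f * \<epsilon>))"
      unfolding abs_mult using c Pf by (intro mult_mono) auto
    moreover have "(1 - c) * (P - f) = (1 - c) * P - (1 - c) * f" by (simp add: algebra_simps)
    ultimately have "\<bar>real (ramanujan_pi c (real N)) - (1 - c) * P\<bar> \<le> 2 * (K * (f * \<epsilon>)) + f * \<epsilon>"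
      using upper lower fe by linarith
    also have "\<dots> = (4 * K + 2) * \<epsilon> * (f / 2)" by (simp add: algebra_simps)
    also have "\<dots> \<le> (4 * K + 2) * \<epsilon> * P"
    proof -
      have "\<epsilon> > 0" using fe f by (smt (verit) mult_nonneg_nonpos)
      thus ?thesis using K P by (intro mult_left_mono) auto
    qed
    finally have "\<bar>real (ramanujan_pi c (real N)) - (1 - c) * P\<bar> / P \<le> (4 * K + 2) * \<epsilon>"
      using P f by (simp add: divide_le_eq)
    moreover have "real (ramanujan_pi c (real N)) / P - (1 - c) = (real (ramanujan_pi c (real N)) - (1 - c) * P) / P"
      using P f by (simp add: diff_divide_distrib)
    ultimately show ?thesis using P f by (simp add: P_def \<epsilon>_def abs_divide)
  qed
  have "\<forall>\<^sub>F N::nat in sequentially. real N \<ge> X"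
    using filterlim_real_sequentially by (simp add: filterlim_at_top)
  hence "\<forall>\<^sub>F N::nat in sequentially. \<bar>real (ramanujan_pi c (real N)) / real (prime_pi (real N)) - (1 - c)\<bar> \<le> (4 * K + 2) * rel_err (real N)"
    by eventually_elim (rule main)
  thus ?thesis by blast
qed

end

section \<open>Inverting the main term: the prime of given index and the Ramanujan prime\<close>

lemma prime_pi_nth_prime:
  assumes "m \<ge> 1"
  shows "real (prime_pi (real (nth_prime m))) = of_int \<lfloor>m\<rfloor>" "real (nth_prime m) \<ge> m - 2"
proof -
  let ?S = "{p::nat. prime p}"
  have inf: "infinite ?S" using primes_infinite by simp
  define k where "k = nat \<lfloor>m\<rfloor> - 1"
  have fl: "\<lfloor>m\<rfloor> \<ge> 1" using assms by simp
  obtain j where j: "\<lfloor>m\<rfloor> = int j" using fl by (metis nonneg_int_cases order_trans zero_le_one)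
  have k: "int k = \<lfloor>m\<rfloor> - 1" using fl unfolding k_def j by (simp add: of_nat_diff)
  have eq: "nth_prime m = enumerate ?S k" by (simp add: nth_prime_def k_def)
  have "{p. prime p \<and> real p \<le> real (nth_prime m)} = enumerate ?S ` {..k}"
  proof safe
    fix p :: nat assume p: "prime p" "real p \<le> real (nth_prime m)"
    obtain i where i: "enumerate ?S i = p" using enumerate_Ex[OF inf, of p] p by auto
    have "i \<le> k"
    proof (rule ccontr)
      assume "\<not> i \<le> k"
      hence "enumerate ?S k < enumerate ?S i" by (intro enumerate_mono inf) auto
      thus False using p i eq by simp
    qed
    thus "p \<in> enumerate ?S ` {..k}" using i by auto
  next
    fix i assume "i \<le> k"
    show "prime (enumerate ?S i)" using enumerate_in_set[OF inf, of i] by simp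
    show "real (enumerate ?S i) \<le> real (nth_prime m)"
      unfolding eq using \<open>i \<le> k\<close> inf by (simp add: enumerate_mono_le_iff)
  qed
  moreover have "inj_on (enumerate ?S) {..k}"
    using inj_enumerate[OF inf] by (rule inj_on_subset) auto
  ultimately have "prime_pi (real (nth_prime m)) = Suc k"
    by (simp add: prime_pi_def card_image)
  thus "real (prime_pi (real (nth_prime m))) = of_int \<lfloor>m\<rfloor>"
    using k by linarith
  \<comment> \<open>A crude bound that serves to push the prime past the thresholds of the
    asymptotic estimates.\<close>
  have "k \<le> nth_prime m" unfolding eq by (rule le_enumerate[OF inf])
  thus "real (nth_prime m) \<ge> m - 2" using k by linarith
qed

text \<open>By the mean value theorem, as the derivative \<open>(ln z - 1) / (ln z)^2\<close> is at
  least \<open>1 / (2 * ln z)\<close> once \<open>ln z \<ge> 2\<close>. The factor \<open>L\<close>,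
  of order \<open>ln n\<close> in the application, turns an error \<open>n * rel_err n\<close> in
  the values into \<open>n * ln (ln n)\<close> in the arguments.\<close>

lemma pi_main_diff_ge:
  assumes y: "exp 2 \<le> a" "a \<le> b" "ln b \<le> L"
  shows "b - a \<le> 2 * L * (pi_main b - pi_main a)"
proof (cases "a = b")
  case False
  hence ab: "a < b" using y by simp
  have a0: "a > 0" using y(1) less_le_trans[OF exp_gt_zero] by blast
  have "\<exists>z. z > a \<and> z < b \<and> pi_main b - pi_main a = (b - a) * ((ln z - 1) / (ln z)\<^sup>2)"
  proof (rule MVT2[OF ab])
    fix x assume x: "a \<le> x" "x \<le> b"
    have x0: "x > 0" using x a0 by simp
    have "ln x \<ge> 2" using x y(1) x0 by (simp add: ln_ge_iff)
    thus "(pi_main has_real_derivative (ln x - 1) / (ln x)\<^sup>2) (at x)"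
      unfolding pi_main_def using x0
      by (auto intro!: derivative_eq_intros simp: power2_eq_square)
  qed
  then obtain z where z: "z > a" "z < b" "pi_main b - pi_main a = (b - a) * ((ln z - 1) / (ln z)\<^sup>2)" by blast
  have z0: "z > 0" using z a0 by simp
  have lz: "ln z \<ge> 2" using z y(1) z0 by (simp add: ln_ge_iff)
  have lzL: "ln z \<le> L" using z z0 y(3) ln_le_cancel_iff[of z b] by linarith
  have "1 / (2 * L) \<le> 1 / (2 * ln z)" using lz lzL by (intro divide_left_mono) auto
  also have "\<dots> = (ln z / 2) / (ln z)\<^sup>2" using lz by (simp add: power2_eq_square)
  also have "\<dots> \<le> (ln z - 1) / (ln z)\<^sup>2" using lz by (intro divide_right_mono) auto
  finally have "(b - a) * (1 / (2 * L)) \<le> pi_main b - pi_main a"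
    unfolding z(3) using ab by (intro mult_left_mono) auto
  thus ?thesis using lz lzL by (simp add: field_simps)
qed (use assms in auto)

text \<open>The point is to trade error terms in \<open>y\<close> for error terms in \<open>n\<close>; this works since
  \<open>n \<le> y \<le> n\<^sup>3\<close>.\<close>

lemma pi_main_inverse:
  assumes K: "K > 0" and a: "a \<ge> 1"
  obtains Y where "\<And>y n. y \<ge> Y \<Longrightarrow> real n \<ge> max (4 * a\<^sup>2) (exp (exp 1)) \<Longrightarrow>
     \<bar>pi_main y - a * real n\<bar> \<le> K * (pi_main y * rel_err y) \<Longrightarrow>
     exp 2 \<le> y \<and> ln y \<le> 3 * ln (real n) \<and> real n * ln (real n) / 2 \<le> y \<and>
     \<bar>pi_main y - a * real n\<bar> \<le> 2 * K * a * real n * rel_err (real n)"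
proof -
  have "((\<lambda>x. K * rel_err x) \<longlongrightarrow> 0) at_top" unfolding rel_err_def by real_asymp
  hence ev1: "\<forall>\<^sub>F x in at_top. K * rel_err x < 1/2" by (rule order_tendstoD) simp
  have ev2: "\<forall>\<^sub>F x in at_top. x \<le> (pi_main x)\<^sup>2" unfolding pi_main_def by real_asymp
  have ev3: "\<forall>\<^sub>F x in at_top. rel_err x > 0" unfolding rel_err_def by real_asymp
  have "\<forall>\<^sub>F x in at_top. K * rel_err x < 1/2 \<and> x \<le> (pi_main x)\<^sup>2 \<and> rel_err x > 0 \<and> x \<ge> exp (exp 1)"
    using ev1 ev2 ev3 eventually_ge_at_top[of "exp (exp 1)"] by eventually_elim simp
  then obtain Y where Y: "\<And>x. x \<ge> Y \<Longrightarrow> K * rel_err x < 1/2 \<and> x \<le> (pi_main x)\<^sup>2 \<and> rel_err x > 0 \<and> x \<ge> exp (exp 1)"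
    by (auto simp: eventually_at_top_linorder)
  show ?thesis
  proof (rule that[of Y])
    fix y :: real and n :: nat
    assume y: "y \<ge> Y" and n: "real n \<ge> max (4 * a\<^sup>2) (exp (exp 1))"
      and b: "\<bar>pi_main y - a * real n\<bar> \<le> K * (pi_main y * rel_err y)"
    note Yy = Y[OF y]
    define f where "f = pi_main y"
    have e1: "exp 1 \<ge> (2::real)" using exp_ge_add_one_self[of 1] by simp
    have ee: "exp (exp 1) \<le> real n" "exp (exp 1) \<le> y" using n Yy by auto
    have "exp 2 \<le> exp (exp (1::real))" using e1 by simp
    hence y2: "exp 2 \<le> y" using ee by linarith
    have y0: "y > 0" using y2 less_le_trans[OF exp_gt_zero] by blast
    have n0: "real n > 0" using ee less_le_trans[OF exp_gt_zero] by blast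
    have ly: "ln y \<ge> 2" using y2 y0 by (simp add: ln_ge_iff)
    have f0: "f > 0" unfolding f_def pi_main_def using ly y0 by (intro divide_pos_pos) linarith+
    have yf: "y = f * ln y" using ly by (simp add: f_def pi_main_def)
    \<comment> \<open>A relative error of at most 1/2 already fixes \<open>f\<close> up to a
      constant factor of \<open>a * n\<close>; these rough bounds are fed back into the error
      term.\<close>
    have "f * (K * rel_err y) \<le> f * (1/2)" using Yy f0 by (intro mult_left_mono) auto
    hence "\<bar>f - a * real n\<bar> \<le> f / 2" using b by (simp add: f_def algebra_simps)
    from abs_le_D1[OF this] abs_le_D2[OF this]
    have f1: "f \<le> 2 * (a * real n)" "a * real n \<le> 3/2 * f" by argo+
    have an: "real n \<le> a * real n" using a n0 by simp
    have "2 * f \<le> f * ln y" using ly f0 by simp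
    hence ny: "real n \<le> y" using yf f1(2) an f0 by linarith
    hence lny: "ln (real n) \<le> ln y" using n0 y0 by simp
    have "real n / 2 \<le> f" using f1(2) an f0 n0 by linarith
    hence "real n / 2 * ln (real n) \<le> f * ln y"
      using lny f0 n0 ee e1 by (intro mult_mono) (auto simp: ln_ge_iff intro!: ln_ge_zero)
    hence low: "real n * ln (real n) / 2 \<le> y" using yf by simp
    \<comment> \<open>The square leaves room for the logarithm in \<open>pi_main\<close>. Together
      with \<open>4 * a^2 \<le> n\<close> it gives \<open>y \<le> n^3\<close>, which is where the
      factor 3 in \<open>ln y \<le> 3 * ln n\<close> comes from.\<close>
    have "y \<le> f\<^sup>2" using Yy by (simp add: f_def)
    also have "\<dots> \<le> (2 * (a * real n))\<^sup>2" using f1(1) f0 by (intro power_mono) auto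
    also have "\<dots> = (4 * a\<^sup>2) * (real n)\<^sup>2" by (simp add: power_mult_distrib)
    also have "\<dots> \<le> real n * (real n)\<^sup>2" using n by (intro mult_right_mono) auto
    also have "\<dots> = real n ^ 3" by (simp add: eval_nat_numeral)
    finally have "ln y \<le> ln (real n ^ 3)" using y0 n0 by (subst ln_le_cancel_iff) auto
    hence up: "ln y \<le> 3 * ln (real n)" using n0 by (simp add: ln_realpow)
    have "f * rel_err y \<le> (2 * (a * real n)) * rel_err (real n)"
      using f1(1) f0 rel_err_antimono[OF ee(1) ny] Yy a n0 by (intro mult_mono) auto
    hence "K * (f * rel_err y) \<le> K * ((2 * (a * real n)) * rel_err (real n))"
      using K by (intro mult_left_mono) auto
    hence "\<bar>pi_main y - a * real n\<bar> \<le> 2 * K * a * real n * rel_err (real n)"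
      using b by (simp add: f_def mult_ac)
    with y2 up low show "exp 2 \<le> y \<and> ln y \<le> 3 * ln (real n) \<and> real n * ln (real n) / 2 \<le> y \<and>
     \<bar>pi_main y - a * real n\<bar> \<le> 2 * K * a * real n * rel_err (real n)" by blast
  qed
qed

context ramanujan
begin

text \<open>Both numbers solve \<open>pi_main y = n / (1 - c)\<close> up to the same relative error,
  and \<open>pi_main_diff_ge\<close> compares two such solutions. The lower bound for the prime is
  recorded for passing to the quotient.\<close>

lemma ramanujan_prime_nth_prime:
  "\<exists>\<beta>>0. \<forall>\<^sub>F n::nat in sequentially.
     \<bar>real (ramanujan_prime c n) - real (nth_prime (real n / (1 - c)))\<bar> \<le> \<beta> * real n * ln (ln (real n)) \<and>
     real n * ln (real n) / 2 \<le> real (nth_prime (real n / (1 - c)))"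
proof -
  obtain K where K: "K > 0"
    and ev1: "\<forall>\<^sub>F x in at_top. \<bar>real (prime_pi x) - pi_main x\<bar> \<le> K * (pi_main x * rel_err x)"
    and ev2: "\<forall>\<^sub>F x in at_top. \<bar>prime_gap_count x - (1 - c) * pi_main x\<bar> \<le> K * (pi_main x * rel_err x)"
    by (rule prime_gap_count_asymptotics)
  have ev3: "\<forall>\<^sub>F x in at_top. 1 \<le> pi_main x * rel_err x"
    unfolding pi_main_def rel_err_def by real_asymp
  have "\<forall>\<^sub>F x in at_top. \<bar>real (prime_pi x) - pi_main x\<bar> \<le> K * (pi_main x * rel_err x) \<and>
     \<bar>prime_gap_count x - (1 - c) * pi_main x\<bar> \<le> K * (pi_main x * rel_err x) \<and> 1 \<le> pi_main x * rel_err x"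
    using ev1 ev2 ev3 by eventually_elim simp
  then obtain X where X: "\<And>x. x \<ge> X \<Longrightarrow> \<bar>real (prime_pi x) - pi_main x\<bar> \<le> K * (pi_main x * rel_err x) \<and>
     \<bar>prime_gap_count x - (1 - c) * pi_main x\<bar> \<le> K * (pi_main x * rel_err x) \<and> 1 \<le> pi_main x * rel_err x"
    by (auto simp: eventually_at_top_linorder)
  define a where "a = 1 / (1 - c)"
  have a: "a \<ge> 1" "a * (1 - c) = 1" using c by (auto simp: a_def field_simps)
  \<comment> \<open>The summand 1 absorbs rounding, in the count at \<open>R\<close> (between
    \<open>n\<close> and \<open>n + 1\<close>) and in the floor of the index; the factor
    \<open>a\<close> arises when the estimate for the count is divided by
    \<open>1 - c\<close>.\<close>
  define M where "M = a * (K + 1)"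
  have M: "M > 0" using a K by (simp add: M_def)
  obtain Y where Y: "\<And>y n. y \<ge> Y \<Longrightarrow> real n \<ge> max (4 * a\<^sup>2) (exp (exp 1)) \<Longrightarrow>
     \<bar>pi_main y - a * real n\<bar> \<le> M * (pi_main y * rel_err y) \<Longrightarrow>
     exp 2 \<le> y \<and> ln y \<le> 3 * ln (real n) \<and> real n * ln (real n) / 2 \<le> y \<and>
     \<bar>pi_main y - a * real n\<bar> \<le> 2 * M * a * real n * rel_err (real n)"
    using pi_main_inverse[OF M a(1)] by metis
  \<comment> \<open>24 is 2 * 3 from \<open>pi_main_diff_ge\<close> with
    \<open>L = 3 * ln n\<close>, times 2 for two deviations, times 2 from the bound for
    each.\<close>
  define \<beta> where "\<beta> = 24 * M * a"
  have main: "\<bar>real (ramanujan_prime c n) - real (nth_prime (real n / (1 - c)))\<bar> \<le> \<beta> * real n * ln (ln (real n)) \<and>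
     real n * ln (real n) / 2 \<le> real (nth_prime (real n / (1 - c)))"
    if n1: "real n \<ge> max (4 * a\<^sup>2) (exp (exp 1))" and n2: "real n \<ge> max X Y + 2" and n3: "n \<ge> 2" for n
  proof -
    define R where "R = real (ramanujan_prime c n)"
    define m where "m = a * real n"
    define p where "p = real (nth_prime m)"
    define T where "T = 2 * M * a * real n * rel_err (real n)"
    have m_eq: "real n / (1 - c) = m" by (simp add: m_def a_def)
    have mn: "m \<ge> real n" using mult_right_mono[OF a(1), of "real n"] by (simp add: m_def)
    have m1: "m \<ge> 1" using mn n3 by simp
    have R: "R \<ge> real n" using ramanujan_prime_ge[of n] by (simp add: R_def)
    have p: "p \<ge> real n - 2" using prime_pi_nth_prime(2)[OF m1] mn by (simp add: p_def)
    have RX: "R \<ge> X" "R \<ge> Y" and pX: "p \<ge> X" "p \<ge> Y" using R p n2 by auto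
    have ex: "exp 2 \<le> R \<and> ln R \<le> 3 * ln (real n) \<and> real n * ln (real n) / 2 \<le> R \<and> \<bar>pi_main R - m\<bar> \<le> T"
      unfolding m_def T_def
    proof (rule Y[OF RX(2) n1])
      define E where "E = pi_main R * rel_err R"
      have E: "E \<ge> 1" using X[OF RX(1)] by (simp add: E_def)
      have "real n \<le> prime_gap_count R" "prime_gap_count R < real n + 1"
        using ramanujan_prime_spec[of n] prime_gap_count_ramanujan_prime[OF n3] by (auto simp: R_def)
      hence "\<bar>(1 - c) * pi_main R - real n\<bar> \<le> K * E + E"
        using X[OF RX(1)] E unfolding E_def by linarith
      hence "a * \<bar>(1 - c) * pi_main R - real n\<bar> \<le> a * (K * E + E)"
        using a(1) by (intro mult_left_mono) auto
      moreover have "a * \<bar>(1 - c) * pi_main R - real n\<bar> = \<bar>a * ((1 - c) * pi_main R - real n)\<bar>"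
        using a(1) by (simp add: abs_mult)
      moreover have "a * ((1 - c) * pi_main R - real n) = (a * (1 - c)) * pi_main R - a * real n"
        by (simp add: algebra_simps)
      ultimately have "\<bar>pi_main R - a * real n\<bar> \<le> a * (K * E + E)" using a(2) by simp
      also have "\<dots> = M * E" by (simp add: M_def algebra_simps)
      finally show "\<bar>pi_main R - a * real n\<bar> \<le> M * (pi_main R * rel_err R)" by (simp add: E_def)
    qed
    have ey: "exp 2 \<le> p \<and> ln p \<le> 3 * ln (real n) \<and> real n * ln (real n) / 2 \<le> p \<and> \<bar>pi_main p - m\<bar> \<le> T"
      unfolding m_def T_def
    proof (rule Y[OF pX(2) n1])
      define E where "E = pi_main p * rel_err p"
      have E: "E \<ge> 1" using X[OF pX(1)] by (simp add: E_def)
      have "m - 1 \<le> real (prime_pi p)" "real (prime_pi p) \<le> m"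
        using prime_pi_nth_prime(1)[OF m1] by (auto simp: p_def)
      hence "\<bar>pi_main p - m\<bar> \<le> K * E + E"
        using X[OF pX(1)] E unfolding E_def by linarith
      also have "\<dots> = 1 * ((K + 1) * E)" by (simp add: algebra_simps)
      also have "\<dots> \<le> a * ((K + 1) * E)" using a(1) K E by (intro mult_right_mono) auto
      also have "\<dots> = M * E" by (simp add: M_def)
      finally show "\<bar>pi_main p - a * real n\<bar> \<le> M * (pi_main p * rel_err p)" by (simp add: E_def m_def)
    qed
    have ln0: "ln (real n) > 0" using n3 by simp
    have "\<bar>R - p\<bar> \<le> 2 * (3 * ln (real n)) * \<bar>pi_main R - pi_main p\<bar>"
    proof (cases "R \<le> p")
      case True
      have "p - R \<le> 2 * (3 * ln (real n)) * (pi_main p - pi_main R)"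
        using ex ey True by (intro pi_main_diff_ge) auto
      also have "\<dots> \<le> 2 * (3 * ln (real n)) * \<bar>pi_main R - pi_main p\<bar>"
        using ln0 by (intro mult_left_mono) auto
      finally show ?thesis using True by simp
    next
      case False
      have "R - p \<le> 2 * (3 * ln (real n)) * (pi_main R - pi_main p)"
        using ex ey False by (intro pi_main_diff_ge) auto
      also have "\<dots> \<le> 2 * (3 * ln (real n)) * \<bar>pi_main R - pi_main p\<bar>"
        using ln0 by (intro mult_left_mono) auto
      finally show ?thesis using False by simp
    qed
    also have "\<dots> \<le> 2 * (3 * ln (real n)) * (2 * T)"
    proof -
      have "\<bar>pi_main R - pi_main p\<bar> \<le> \<bar>pi_main R - m\<bar> + \<bar>pi_main p - m\<bar>" by linarith
      hence "\<bar>pi_main R - pi_main p\<bar> \<le> 2 * T" using ex ey by linarith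
      thus ?thesis using ln0 by (intro mult_left_mono) auto
    qed
    also have "\<dots> = \<beta> * real n * ln (ln (real n))"
      using ln0 by (simp add: T_def rel_err_def \<beta>_def)
    finally show ?thesis using ey unfolding m_eq by (simp add: R_def p_def)
  qed
  have "\<forall>\<^sub>F n::nat in sequentially. real n \<ge> z" for z
    using filterlim_real_sequentially by (simp add: filterlim_at_top)
  hence "\<forall>\<^sub>F n::nat in sequentially. real n \<ge> max (4 * a\<^sup>2) (exp (exp 1)) \<and> real n \<ge> max X Y + 2 \<and> n \<ge> 2"
    by (intro eventually_conj eventually_ge_at_top)
  hence "\<forall>\<^sub>F n::nat in sequentially.
     \<bar>real (ramanujan_prime c n) - real (nth_prime (real n / (1 - c)))\<bar> \<le> \<beta> * real n * ln (ln (real n)) \<and>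
     real n * ln (real n) / 2 \<le> real (nth_prime (real n / (1 - c)))"
    by eventually_elim (rule main, auto)
  moreover have "\<beta> > 0" using M a by (simp add: \<beta>_def)
  ultimately show ?thesis by blast
qed

end

theorem theorem1:
  fixes c :: real
  assumes "0 < c" and "c < 1"
  shows "((\<lambda>n::nat. real (ramanujan_prime c n) / real (nth_prime (real n / (1 - c))))
            \<longlonglongrightarrow> 1)
       \<and> (\<exists>\<beta>1::real. \<beta>1 > 0 \<and>
            (\<forall>\<^sub>F n::nat in sequentially.
               \<bar>real (ramanujan_prime c n) - real (nth_prime (real n / (1 - c)))\<bar>
                 \<le> \<beta>1 * real n * ln (ln (real n))))
       \<and> (\<exists>\<beta>5::real. \<forall>\<^sub>F N::nat in sequentially.
            \<bar>real (ramanujan_pi c (real N)) / real (prime_pi (real N)) - (1 - c)\<bar>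
              \<le> \<beta>5 * ln (ln (real N)) / ln (real N))
       \<and> ((\<lambda>N::nat. real (ramanujan_pi c (real N)) / real (prime_pi (real N)))
            \<longlonglongrightarrow> 1 - c)"
proof -
  interpret ramanujan c by unfold_locales (use assms in auto)
  obtain \<beta> where \<beta>: "\<beta> > 0" and ev: "\<forall>\<^sub>F n::nat in sequentially.
     \<bar>real (ramanujan_prime c n) - real (nth_prime (real n / (1 - c)))\<bar> \<le> \<beta> * real n * ln (ln (real n)) \<and>
     real n * ln (real n) / 2 \<le> real (nth_prime (real n / (1 - c)))"
    using ramanujan_prime_nth_prime by blast
  obtain \<gamma> where ev': "\<forall>\<^sub>F N::nat in sequentially.
     \<bar>real (ramanujan_pi c (real N)) / real (prime_pi (real N)) - (1 - c)\<bar> \<le> \<gamma> * rel_err (real N)"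
    using ramanujan_pi_ratio by blast
  \<comment> \<open>Dividing the error \<open>\<beta> * n * ln (ln n)\<close> by the lower bound
    \<open>n * ln n / 2\<close> for the prime leaves \<open>2 * \<beta> * rel_err n\<close>, which
    tends to 0.\<close>
  have "(\<lambda>n::nat. real (ramanujan_prime c n) / real (nth_prime (real n / (1 - c))) - 1) \<longlonglongrightarrow> 0"
  proof (rule Lim_null_comparison)
    show "\<forall>\<^sub>F n::nat in sequentially. norm (real (ramanujan_prime c n) / real (nth_prime (real n / (1 - c))) - 1)
        \<le> 2 * \<beta> * rel_err (real n)"
      using ev eventually_ge_at_top[of "2::nat"]
    proof eventually_elim
      case (elim n)
      define p where "p = real (nth_prime (real n / (1 - c)))"
      define R where "R = real (ramanujan_prime c n)"
      have q: "real n * ln (real n) / 2 > 0" using elim by simp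
      have p1: "p \<ge> real n * ln (real n) / 2" using elim by (simp add: p_def)
      have p: "p \<ge> real n * ln (real n) / 2" "p > 0" using p1 less_le_trans[OF q p1] by auto
      have "\<bar>R / p - 1\<bar> = \<bar>R - p\<bar> / p" using p(2) by (simp add: field_simps abs_divide)
      also have "\<dots> \<le> \<bar>R - p\<bar> / (real n * ln (real n) / 2)"
        using p q by (intro divide_left_mono) auto
      also have "\<dots> \<le> (\<beta> * real n * ln (ln (real n))) / (real n * ln (real n) / 2)"
        using elim q by (intro divide_right_mono) (auto simp: R_def p_def)
      also have "\<dots> = 2 * \<beta> * rel_err (real n)" using elim by (simp add: rel_err_def)
      finally show ?case by (simp add: R_def p_def)
    qed
    show "(\<lambda>n. 2 * \<beta> * rel_err (real n)) \<longlonglongrightarrow> 0"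
      by (rule tendsto_mult_right_zero[OF rel_err_tendsto])
  qed
  hence 1: "(\<lambda>n::nat. real (ramanujan_prime c n) / real (nth_prime (real n / (1 - c)))) \<longlonglongrightarrow> 1"
    by (simp only: LIM_zero_iff)
  have 2: "\<exists>\<beta>1::real. \<beta>1 > 0 \<and> (\<forall>\<^sub>F n::nat in sequentially.
               \<bar>real (ramanujan_prime c n) - real (nth_prime (real n / (1 - c)))\<bar>
                 \<le> \<beta>1 * real n * ln (ln (real n)))"
    using \<beta> ev by (intro exI[of _ \<beta>]) (auto elim!: eventually_mono)
  have 3: "\<exists>\<beta>5::real. \<forall>\<^sub>F N::nat in sequentially.
            \<bar>real (ramanujan_pi c (real N)) / real (prime_pi (real N)) - (1 - c)\<bar>
              \<le> \<beta>5 * ln (ln (real N)) / ln (real N)"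
    using ev' by (intro exI[of _ \<gamma>]) (simp add: rel_err_def)
  have "(\<lambda>N::nat. real (ramanujan_pi c (real N)) / real (prime_pi (real N)) - (1 - c)) \<longlonglongrightarrow> 0"
    by (rule Lim_null_comparison[OF _ tendsto_mult_right_zero[OF rel_err_tendsto, of \<gamma>]])
       (use ev' in simp)
  hence 4: "(\<lambda>N::nat. real (ramanujan_pi c (real N)) / real (prime_pi (real N))) \<longlonglongrightarrow> 1 - c"
    by (simp only: LIM_zero_iff)
  from 1 2 3 4 show ?thesis by blast
qed

end
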